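(* Let $n\ge1$ and let $\Lambda_n$ be the algebra of lower triangular $n\times n$ matrices over a field $K$. In the expansion of the polynomial $$h_n(x_1,\dots,x_n)=\prod_{r=1}^n\left(\prod_{s=1}^r(1+x_s)-1\right),$$ the coefficient of the monomial $x_1^{t_1}\cdots x_n^{t_n}$ is equal to the number of isomorphism classes of basic faithfully balanced $\Lambda_n$-modules $M$ having, for every $i\in\{1,\dots,n\}$, exactly $t_i$ indecomposable summands with top $S[i]$.
   Context: Modules are finitely generated left modules. A module $M$ over an algebra $\Lambda$ is faithfully balanced if the natural map $\Lambda\to\mathrm{End}_E(M)$, $E=\mathrm{End}_\Lambda(M)$, is bijective; it is basic if its indecomposable summands occur with multiplicity one. $\Lambda_n$ is the path algebra of $1\to2\to\cdots\to n$. Its indecomposable modules are the modules $M_{ij}$, $1\le i\le j\le n$, where $M_{ij}$ is the uniserial module with top the simple $S[i]$ and socle the simple $S[j]$ (the representation with $K$ at vertices $i,\dots,j$ and identity maps). *)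

theory Defs
  imports
    "HOL-Algebra.Module"
    "HOL-Algebra.AbelCoset"
    "HOL-Library.Poly_Mapping"
    "Jordan_Normal_Form.Matrix"
begin

section \<open>Left modules over a not necessarily commutative ring\<close>

text \<open>
  The locale \<open>module\<close> of HOL-Algebra requires a commutative ring of scalars, so left modules
  are set up here.  Its record type is reused; as in HOL-Algebra, the fields \<open>mult\<close>
  and \<open>one\<close> of that record play no role for modules.  The locale \<open>submodule\<close>
  of HOL-Algebra makes no assumption on the ring of scalars and is used unchanged.
\<close>

locale left_module = R?: ring R + M?: abelian_group M for R (structure) and M (structure) +
  assumes smult_closed:
      "\<lbrakk>a \<in> carrier R; x \<in> carrier M\<rbrakk> \<Longrightarrow> a \<odot>\<^bsub>M\<^esub> x \<in> carrier M"
    and smult_l_distr: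
      "\<lbrakk>a \<in> carrier R; b \<in> carrier R; x \<in> carrier M\<rbrakk>
        \<Longrightarrow> (a \<oplus> b) \<odot>\<^bsub>M\<^esub> x = a \<odot>\<^bsub>M\<^esub> x \<oplus>\<^bsub>M\<^esub> b \<odot>\<^bsub>M\<^esub> x"
    and smult_r_distr:
      "\<lbrakk>a \<in> carrier R; x \<in> carrier M; y \<in> carrier M\<rbrakk>
        \<Longrightarrow> a \<odot>\<^bsub>M\<^esub> (x \<oplus>\<^bsub>M\<^esub> y) = a \<odot>\<^bsub>M\<^esub> x \<oplus>\<^bsub>M\<^esub> a \<odot>\<^bsub>M\<^esub> y"
    and smult_assoc:
      "\<lbrakk>a \<in> carrier R; b \<in> carrier R; x \<in> carrier M\<rbrakk>
        \<Longrightarrow> (a \<otimes> b) \<odot>\<^bsub>M\<^esub> x = a \<odot>\<^bsub>M\<^esub> (b \<odot>\<^bsub>M\<^esub> x)"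
    and smult_one:
      "x \<in> carrier M \<Longrightarrow> \<one> \<odot>\<^bsub>M\<^esub> x = x"

definition finitely_generated :: "('r, 'q) ring_scheme \<Rightarrow> ('r, 'a) module \<Rightarrow> bool" where
  "finitely_generated R M \<longleftrightarrow>
     (\<exists>S. finite S \<and> S \<subseteq> carrier M \<and>
          (\<forall>N. submodule N R M \<and> S \<subseteq> N \<longrightarrow> N = carrier M))"

text \<open>Linear maps are extensional functions, so that equality of maps on the carrier is equality.\<close>

definition linear_maps ::
  "('r, 'q) ring_scheme \<Rightarrow> ('r, 'a) module \<Rightarrow> ('r, 'b) module \<Rightarrow> ('a \<Rightarrow> 'b) set" where
  "linear_maps R M N =
     {f \<in> carrier M \<rightarrow>\<^sub>E carrier N.
        (\<forall>x\<in>carrier M. \<forall>y\<in>carrier M. f (x \<oplus>\<^bsub>M\<^esub> y) = f x \<oplus>\<^bsub>N\<^esub> f y) \<and>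
        (\<forall>a\<in>carrier R. \<forall>x\<in>carrier M. f (a \<odot>\<^bsub>M\<^esub> x) = a \<odot>\<^bsub>N\<^esub> f x)}"

definition isomorphic ::
  "('r, 'q) ring_scheme \<Rightarrow> ('r, 'a) module \<Rightarrow> ('r, 'b) module \<Rightarrow> bool" where
  "isomorphic R M N \<longleftrightarrow> (\<exists>f\<in>linear_maps R M N. bij_betw f (carrier M) (carrier N))"

definition isomorphism_classes ::
  "('r, 'q) ring_scheme \<Rightarrow> ('r, 'a) module set \<Rightarrow> ('r, 'a) module set set" where
  "isomorphism_classes R \<M> = \<M> // {(M, N) \<in> \<M> \<times> \<M>. isomorphic R M N}"

abbreviation restrict_to :: "('r, 'a) module \<Rightarrow> 'a set \<Rightarrow> ('r, 'a) module" where
  "restrict_to M N \<equiv> M\<lparr>carrier := N\<rparr>"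


subsection \<open>Faithfully balanced modules\<close>

definition endo_ring ::
  "('r, 'q) ring_scheme \<Rightarrow> ('r, 'a) module \<Rightarrow> ('a \<Rightarrow> 'a) ring" where
  "endo_ring R M =
     \<lparr>carrier = linear_maps R M M,
      monoid.mult = (\<lambda>f g. compose (carrier M) f g),
      one = (\<lambda>x\<in>carrier M. x),
      zero = (\<lambda>x\<in>carrier M. \<zero>\<^bsub>M\<^esub>),
      add = (\<lambda>f g. \<lambda>x\<in>carrier M. f x \<oplus>\<^bsub>M\<^esub> g x)\<rparr>"

text \<open>The module \<open>M\<close> viewed as a left module over its endomorphism ring, by evaluation.\<close>

definition as_endo_module :: "('r, 'a) module \<Rightarrow> ('a \<Rightarrow> 'a, 'a) module" where
  "as_endo_module M =
     \<lparr>carrier = carrier M, monoid.mult = monoid.mult M, one = one M, zero = zero M, add = add M,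
      smult = (\<lambda>f x. f x)\<rparr>"

definition faithfully_balanced :: "('r, 'q) ring_scheme \<Rightarrow> ('r, 'a) module \<Rightarrow> bool" where
  "faithfully_balanced R M \<longleftrightarrow>
     bij_betw (\<lambda>a. \<lambda>x\<in>carrier M. a \<odot>\<^bsub>M\<^esub> x)
       (carrier R) (carrier (endo_ring (endo_ring R M) (as_endo_module M)))"


subsection \<open>Decompositions into indecomposable summands\<close>

definition indecomposable :: "('r, 'q) ring_scheme \<Rightarrow> ('r, 'a) module \<Rightarrow> bool" where
  "indecomposable R M \<longleftrightarrow>
     carrier M \<noteq> {\<zero>\<^bsub>M\<^esub>} \<and>
     (\<forall>A B. submodule A R M \<and> submodule B R M \<and>
            A <+>\<^bsub>M\<^esub> B = carrier M \<and> A \<inter> B = {\<zero>\<^bsub>M\<^esub>}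
            \<longrightarrow> A = {\<zero>\<^bsub>M\<^esub>} \<or> B = {\<zero>\<^bsub>M\<^esub>})"

text \<open>
  \<open>M\<close> is the internal direct sum of the finite set \<open>D\<close> of indecomposable submodules.
  Distinct members of \<open>D\<close> may well be isomorphic; since the zero module is not indecomposable,
  nothing is lost by using a set rather than a family of submodules.
\<close>

definition indecomposable_decomposition ::
  "('r, 'q) ring_scheme \<Rightarrow> ('r, 'a) module \<Rightarrow> 'a set set \<Rightarrow> bool" where
  "indecomposable_decomposition R M D \<longleftrightarrow>
     finite D \<and>
     (\<forall>N\<in>D. submodule N R M \<and> indecomposable R (restrict_to M N)) \<and>
     (\<forall>x\<in>carrier M. \<exists>!f. f \<in> (\<Pi>\<^sub>E N\<in>D. N) \<and> x = (\<Oplus>\<^bsub>M\<^esub>N\<in>D. f N))"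

text \<open>
  By the Krull-Schmidt theorem the next two notions do not depend on the
  choice of the decomposition for finitely generated modules over a finite-dimensional algebra.
\<close>

definition basic :: "('r, 'q) ring_scheme \<Rightarrow> ('r, 'a) module \<Rightarrow> bool" where
  "basic R M \<longleftrightarrow>
     (\<exists>D. indecomposable_decomposition R M D \<and>
          (\<forall>X\<in>D. \<forall>Y\<in>D. isomorphic R (restrict_to M X) (restrict_to M Y) \<longrightarrow> X = Y))"

definition maximal_submodule ::
  "'a set \<Rightarrow> ('r, 'q) ring_scheme \<Rightarrow> ('r, 'a) module \<Rightarrow> bool" where
  "maximal_submodule N R M \<longleftrightarrow>
     submodule N R M \<and> N \<noteq> carrier M \<and>
     (\<forall>L. submodule L R M \<and> N \<subseteq> L \<longrightarrow> L = N \<or> L = carrier M)"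

definition radical :: "('r, 'q) ring_scheme \<Rightarrow> ('r, 'a) module \<Rightarrow> 'a set" where
  "radical R M = carrier M \<inter> \<Inter>{N. maximal_submodule N R M}"

definition quotient_module :: "('r, 'a) module \<Rightarrow> 'a set \<Rightarrow> ('r, 'a set) module" where
  "quotient_module M N =
     \<lparr>carrier = a_rcosets\<^bsub>M\<^esub> N, monoid.mult = undefined, one = undefined,
      zero = N, add = (\<lambda>X Y. X <+>\<^bsub>M\<^esub> Y),
      smult = (\<lambda>a X. N <+>\<^bsub>M\<^esub> ((\<lambda>x. a \<odot>\<^bsub>M\<^esub> x) ` X))\<rparr>"

definition top_of :: "('r, 'q) ring_scheme \<Rightarrow> ('r, 'a) module \<Rightarrow> ('r, 'a set) module" where
  "top_of R M = quotient_module M (radical R M)"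

definition has_summands_with_top ::
  "('r, 'q) ring_scheme \<Rightarrow> ('r, 'a) module \<Rightarrow> ('r, 'b) module \<Rightarrow> nat \<Rightarrow> bool" where
  "has_summands_with_top R M S k \<longleftrightarrow>
     (\<exists>D. indecomposable_decomposition R M D \<and>
          card {N \<in> D. isomorphic R (top_of R (restrict_to M N)) S} = k)"


section \<open>The algebra of lower triangular matrices\<close>

text \<open>
  Matrix indices start at \<open>0\<close>.  The vertex \<open>i\<close> of the quiver \<open>1 \<rightarrow> \<dots> \<rightarrow> n\<close> corresponds to the
  diagonal matrix unit in position \<open>(i - 1, i - 1)\<close>; a matrix unit in position \<open>(j - 1, i - 1)\<close> with
  \<open>i \<le> j\<close> maps the component at \<open>i\<close> of a left module to the component at \<open>j\<close>.
\<close>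

definition lower_triangular_algebra :: "'k::field itself \<Rightarrow> nat \<Rightarrow> 'k mat ring" where
  "lower_triangular_algebra ty n =
     (ring_mat ty n ())
       \<lparr>carrier := {A \<in> carrier_mat n n. \<forall>i<n. \<forall>j<n. i < j \<longrightarrow> A $$ (i, j) = 0}\<rparr>"

definition simple_module :: "nat \<Rightarrow> ('k::field mat, 'k) module" where
  "simple_module i =
     \<lparr>carrier = UNIV, monoid.mult = undefined, one = undefined, zero = 0, add = (+),
      smult = (\<lambda>A x. A $$ (i - 1, i - 1) * x)\<rparr>"

lemma ring_lower_triangular_algebra: "ring (lower_triangular_algebra TYPE('k::field) n)"
proof -
  let ?T = "{A \<in> carrier_mat n n. \<forall>i<n. \<forall>j<n. i < j \<longrightarrow> A $$ (i, j) = (0::'k)}"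
  have mult: "A * B \<in> ?T" if "A \<in> ?T" "B \<in> ?T" for A B
  proof -
    have "(\<Sum>k = 0..<n. A $$ (i, k) * B $$ (k, j)) = 0" if "i < n" "j < n" "i < j" for i j
    proof (rule sum.neutral, rule ballI)
      fix k assume "k \<in> {0..<n}"
      then show "A $$ (i, k) * B $$ (k, j) = 0"
        using \<open>A \<in> ?T\<close> \<open>B \<in> ?T\<close> that by (cases "i < k") auto
    qed
    then show ?thesis using that by (auto simp: scalar_prod_def)
  qed
  have neg: "\<exists>B\<in>?T. B + A = 0\<^sub>m n n \<and> A + B = 0\<^sub>m n n" if "A \<in> ?T" for A
    using that by (intro bexI[of _ "- A"]) (auto simp: minus_add_uminus_mat[symmetric])
  show ?thesis
    unfolding lower_triangular_algebra_def
    using mult neg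
    by unfold_locales
      (auto simp: ring_mat_def algebra_simps Units_def
        add_mult_distrib_mat mult_add_distrib_mat)
qed

lemma left_module_simple_module:
  assumes "1 \<le> i" "i \<le> n"
  shows "left_module (lower_triangular_algebra TYPE('k::field) n) (simple_module i)"
proof -
  interpret R: ring "lower_triangular_algebra TYPE('k) n" by (rule ring_lower_triangular_algebra)
  have "\<exists>y. y + x = 0 \<and> x + y = 0" for x :: 'k
    by (rule exI[of _ "- x"]) simp
  then have "abelian_group (simple_module i :: ('k mat, 'k) module)"
    by unfold_locales (auto simp: simple_module_def Units_def algebra_simps)
  then interpret M: abelian_group "simple_module i :: ('k mat, 'k) module" .
  have "(A * B) $$ (i - 1, i - 1) = A $$ (i - 1, i - 1) * B $$ (i - 1, i - 1)"
    if "A \<in> carrier (lower_triangular_algebra TYPE('k) n)"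
       "B \<in> carrier (lower_triangular_algebra TYPE('k) n)" for A B
  proof -
    let ?i = "i - 1"
    have i: "?i < n" using assms by simp
    have "(A * B) $$ (?i, ?i) = (\<Sum>k = 0..<n. A $$ (?i, k) * B $$ (k, ?i))"
      using that i by (auto simp: lower_triangular_algebra_def scalar_prod_def)
    also have "\<dots> = (\<Sum>k = 0..<n. if k = ?i then A $$ (?i, ?i) * B $$ (?i, ?i) else 0)"
    proof (rule sum.cong[OF refl])
      fix k assume "k \<in> {0..<n}"
      then show "A $$ (?i, k) * B $$ (k, ?i)
          = (if k = ?i then A $$ (?i, ?i) * B $$ (?i, ?i) else 0)"
        using that i by (cases k ?i rule: linorder_cases) (auto simp: lower_triangular_algebra_def)
    qed
    finally show ?thesis using i by simp
  qed
  then show ?thesis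
    using assms
    by unfold_locales
      (auto simp: simple_module_def lower_triangular_algebra_def ring_mat_def algebra_simps)
qed


subsection \<open>Finitely generated modules live on sets of vectors\<close>

text \<open>
  Isomorphism classes will be formed among modules whose carrier is a set of vectors over \<open>K\<close>.
  By the following lemmas this loses no finitely generated module, whatever its carrier type.
\<close>

lemma (in left_module) generated_submodule:
  assumes S: "finite S" "S \<subseteq> carrier M"
  shows "submodule {\<Oplus>\<^bsub>M\<^esub>x\<in>S. c x \<odot>\<^bsub>M\<^esub> x | c. c \<in> S \<rightarrow>\<^sub>E carrier R} R M" (is "submodule ?N R M")
    and "S \<subseteq> {\<Oplus>\<^bsub>M\<^esub>x\<in>S. c x \<odot>\<^bsub>M\<^esub> x | c. c \<in> S \<rightarrow>\<^sub>E carrier R}"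
proof -
  let ?f = "\<lambda>c. \<Oplus>\<^bsub>M\<^esub>x\<in>S. c x \<odot>\<^bsub>M\<^esub> x"
  have sc: "c x \<odot>\<^bsub>M\<^esub> x \<in> carrier M" if "c \<in> S \<rightarrow> carrier R" "x \<in> S" for c x
    using that S by (auto intro!: smult_closed)
  have fc: "?f c \<in> carrier M" if "c \<in> S \<rightarrow> carrier R" for c
    using sc[OF that] by (intro M.finsum_closed) auto
  have ext: "?f (restrict c S) = ?f c" if "c \<in> S \<rightarrow> carrier R" for c
    using sc[OF that] by (intro M.finsum_cong') auto
  have mem: "?f c \<in> ?N" if "c \<in> S \<rightarrow> carrier R" for c
    using ext[OF that] that by (auto intro!: exI[of _ "restrict c S"])
  have elim: "\<exists>c. c \<in> S \<rightarrow> carrier R \<and> u = ?f c" if "u \<in> ?N" for u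
    using that by (auto simp: PiE_def)
  have add: "?f c \<oplus>\<^bsub>M\<^esub> ?f d = ?f (\<lambda>x. c x \<oplus> d x)"
    if c: "c \<in> S \<rightarrow> carrier R" and d: "d \<in> S \<rightarrow> carrier R" for c d
  proof -
    have "?f (\<lambda>x. c x \<oplus> d x) = (\<Oplus>\<^bsub>M\<^esub>x\<in>S. c x \<odot>\<^bsub>M\<^esub> x \<oplus>\<^bsub>M\<^esub> d x \<odot>\<^bsub>M\<^esub> x)"
      using c d S sc[OF c] sc[OF d]
      by (intro M.finsum_cong') (auto simp: smult_l_distr Pi_iff subset_iff)
    also have "\<dots> = ?f c \<oplus>\<^bsub>M\<^esub> ?f d"
      using sc[OF c] sc[OF d] by (intro M.finsum_addf) auto
    finally show ?thesis by simp
  qed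
  have zero_smult: "\<zero> \<odot>\<^bsub>M\<^esub> x = \<zero>\<^bsub>M\<^esub>" if x: "x \<in> carrier M" for x
  proof -
    have "\<zero> \<odot>\<^bsub>M\<^esub> x \<oplus>\<^bsub>M\<^esub> \<zero> \<odot>\<^bsub>M\<^esub> x = \<zero> \<odot>\<^bsub>M\<^esub> x"
      using smult_l_distr[of \<zero> \<zero> x] x by simp
    then show ?thesis using smult_closed[of \<zero> x] x by (metis M.add.r_cancel_one' R.zero_closed)
  qed
  have smult_zero: "a \<odot>\<^bsub>M\<^esub> \<zero>\<^bsub>M\<^esub> = \<zero>\<^bsub>M\<^esub>" if a: "a \<in> carrier R" for a
  proof -
    have "a \<odot>\<^bsub>M\<^esub> \<zero>\<^bsub>M\<^esub> \<oplus>\<^bsub>M\<^esub> a \<odot>\<^bsub>M\<^esub> \<zero>\<^bsub>M\<^esub> = a \<odot>\<^bsub>M\<^esub> \<zero>\<^bsub>M\<^esub>"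
      using smult_r_distr[of a "\<zero>\<^bsub>M\<^esub>" "\<zero>\<^bsub>M\<^esub>"] a by simp
    then show ?thesis
      using smult_closed[of a "\<zero>\<^bsub>M\<^esub>"] a by (metis M.add.r_cancel_one' M.zero_closed)
  qed
  have zero: "?f (\<lambda>_. \<zero>) = \<zero>\<^bsub>M\<^esub>"
    using S by (intro M.add.finprod_one_eqI) (auto simp: zero_smult)
  have smult: "a \<odot>\<^bsub>M\<^esub> ?f c = ?f (\<lambda>x. a \<otimes> c x)"
    if a: "a \<in> carrier R" and c: "c \<in> S \<rightarrow> carrier R" for a c
  proof -
    have "a \<odot>\<^bsub>M\<^esub> (\<Oplus>\<^bsub>M\<^esub>x\<in>U. c x \<odot>\<^bsub>M\<^esub> x) = (\<Oplus>\<^bsub>M\<^esub>x\<in>U. (a \<otimes> c x) \<odot>\<^bsub>M\<^esub> x)" if "U \<subseteq> S" for U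
      using finite_subset[OF that S(1)] that
    proof (induction U rule: finite_induct)
      case empty
      then show ?case by (simp add: smult_zero a)
    next
      case (insert y U)
      have y: "y \<in> carrier M" "c y \<in> carrier R" using insert.prems S c by auto
      have 1: "(\<lambda>x. c x \<odot>\<^bsub>M\<^esub> x) \<in> U \<rightarrow> carrier M"
        using insert.prems sc[OF c] by auto
      have 2: "(\<lambda>x. (a \<otimes> c x) \<odot>\<^bsub>M\<^esub> x) \<in> U \<rightarrow> carrier M"
        using insert.prems S c a by (fastforce intro!: smult_closed)
      show ?case
        using insert 1 2 y a
        by (simp add: M.finsum_insert M.finsum_closed smult_closed smult_r_distr smult_assoc)
    qed
    then show ?thesis by blast
  qed
  show "submodule ?N R M"
  proof
    show "?N \<subseteq> carrier (add_monoid M)" using fc by auto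
    show "u \<otimes>\<^bsub>add_monoid M\<^esub> v \<in> ?N" if "u \<in> ?N" "v \<in> ?N" for u v
    proof -
      from elim[OF that(1)] obtain c where c: "c \<in> S \<rightarrow> carrier R" "u = ?f c" by blast
      from elim[OF that(2)] obtain d where d: "d \<in> S \<rightarrow> carrier R" "v = ?f d" by blast
      note cd = c d
      from cd have "u \<otimes>\<^bsub>add_monoid M\<^esub> v = ?f (\<lambda>x. c x \<oplus> d x)" by (simp add: add)
      then show ?thesis using mem[of "\<lambda>x. c x \<oplus> d x"] cd by (auto simp: Pi_iff)
    qed
    show "\<one>\<^bsub>add_monoid M\<^esub> \<in> ?N" using mem[of "\<lambda>_. \<zero>"] zero by simp
    show "inv\<^bsub>add_monoid M\<^esub> u \<in> ?N" if "u \<in> ?N" for u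
    proof -
      from elim[OF that] obtain c where c: "c \<in> S \<rightarrow> carrier R" "u = ?f c" by blast
      let ?d = "\<lambda>x. \<ominus> c x"
      have d: "?d \<in> S \<rightarrow> carrier R" using c by (auto simp: Pi_iff)
      have "?f ?d \<oplus>\<^bsub>M\<^esub> u = ?f (\<lambda>x. ?d x \<oplus> c x)" using c d by (simp add: add)
      also have "\<dots> = \<zero>\<^bsub>M\<^esub>"
        using c S by (intro M.add.finprod_one_eqI) (auto simp: R.l_neg Pi_iff zero_smult subset_iff)
      finally have "\<ominus>\<^bsub>M\<^esub> u = ?f ?d" using c d fc by (intro M.minus_equality) auto
      then show ?thesis using mem[OF d] by (simp add: a_inv_def)
    qed
    show "a \<odot>\<^bsub>M\<^esub> u \<in> ?N" if "a \<in> carrier R" "u \<in> ?N" for a u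
    proof -
      from elim[OF that(2)] obtain c where c: "c \<in> S \<rightarrow> carrier R" "u = ?f c" by blast
      then show ?thesis
        using smult[OF that(1) c(1)] mem[of "\<lambda>x. a \<otimes> c x"] that(1) by (auto simp: Pi_iff)
    qed
  qed
  show "S \<subseteq> ?N"
  proof
    fix y assume y: "y \<in> S"
    let ?c = "\<lambda>x. if x = y then \<one> else \<zero>"
    have "?f ?c = (\<Oplus>\<^bsub>M\<^esub>x\<in>S. if y = x then x else \<zero>\<^bsub>M\<^esub>)"
      using S by (intro M.finsum_cong') (auto simp: smult_one zero_smult subset_iff)
    also have "\<dots> = y"
      using y S M.finsum_singleton[of y S "\<lambda>x. x"] by auto
    finally show "y \<in> ?N" using mem[of ?c] by auto
  qed
qed

lemma left_module_transport:
  fixes M :: "('r, 'a) module" and \<phi> :: "'a \<Rightarrow> 'b"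
  assumes "left_module R M" and inj: "inj_on \<phi> (carrier M)"
  shows "\<exists>M' :: ('r, 'b) module. left_module R M' \<and> isomorphic R M M'"
proof -
  interpret left_module R M by fact
  define \<psi> where "\<psi> = the_inv_into (carrier M) \<phi>"
  define M' :: "('r, 'b) module" where "M' =
    \<lparr>carrier = \<phi> ` carrier M, monoid.mult = undefined, one = undefined, zero = \<phi> \<zero>\<^bsub>M\<^esub>,
     add = (\<lambda>u v. \<phi> (\<psi> u \<oplus>\<^bsub>M\<^esub> \<psi> v)), smult = (\<lambda>a u. \<phi> (a \<odot>\<^bsub>M\<^esub> \<psi> u))\<rparr>"
  have \<psi>: "\<psi> (\<phi> x) = x" if "x \<in> carrier M" for x
    unfolding \<psi>_def using that inj by (simp add: the_inv_into_f_f)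
  have neg: "\<exists>y\<in>carrier M. y \<oplus>\<^bsub>M\<^esub> x = \<zero>\<^bsub>M\<^esub> \<and> x \<oplus>\<^bsub>M\<^esub> y = \<zero>\<^bsub>M\<^esub>" if "x \<in> carrier M" for x
    using that by (intro bexI[of _ "\<ominus>\<^bsub>M\<^esub> x"]) (auto simp: M.l_neg M.r_neg)
  have "abelian_group M'"
  proof (rule abelian_groupI)
    fix u assume "u \<in> carrier M'"
    then show "\<exists>v\<in>carrier M'. v \<oplus>\<^bsub>M'\<^esub> u = \<zero>\<^bsub>M'\<^esub>"
      using neg by (force simp: M'_def \<psi>)
  qed (auto simp: M'_def \<psi> M.a_ac)
  then interpret M': abelian_group M' .
  have "left_module R M'"
    by unfold_locales
      (auto simp: M'_def \<psi> smult_closed smult_one smult_assoc smult_l_distr smult_r_distr)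
  moreover have "restrict \<phi> (carrier M) \<in> linear_maps R M M'"
    by (auto simp: linear_maps_def M'_def \<psi> smult_closed)
  moreover have "bij_betw (restrict \<phi> (carrier M)) (carrier M) (carrier M')"
    using inj by (simp add: bij_betw_def M'_def inj_on_def)
  ultimately show ?thesis unfolding isomorphic_def by blast
qed

lemma finitely_generated_isomorphic_on_vectors:
  fixes M :: "('k::field mat, 'a) module"
  assumes "left_module (lower_triangular_algebra TYPE('k) n) M"
    and "finitely_generated (lower_triangular_algebra TYPE('k) n) M"
  shows "\<exists>M' :: ('k mat, 'k vec) module.
           left_module (lower_triangular_algebra TYPE('k) n) M' \<and>
           isomorphic (lower_triangular_algebra TYPE('k) n) M M'"
proof -
  let ?R = "lower_triangular_algebra TYPE('k) n"
  interpret left_module ?R M by fact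
  obtain S where S: "finite S" "S \<subseteq> carrier M"
      "\<And>N. submodule N ?R M \<Longrightarrow> S \<subseteq> N \<Longrightarrow> N = carrier M"
    using assms(2) unfolding finitely_generated_def by blast
  let ?f = "\<lambda>c. \<Oplus>\<^bsub>M\<^esub>x\<in>S. c x \<odot>\<^bsub>M\<^esub> x"
  have "{?f c | c. c \<in> S \<rightarrow>\<^sub>E carrier ?R} = carrier M"
    using S generated_submodule[OF S(1,2)] by blast
  then have "\<forall>m\<in>carrier M. \<exists>c. c \<in> S \<rightarrow>\<^sub>E carrier ?R \<and> m = ?f c"
    by blast
  from bchoice[OF this]
  obtain c where "\<forall>m\<in>carrier M. c m \<in> S \<rightarrow>\<^sub>E carrier ?R \<and> m = ?f (c m)" ..
  then have c: "\<And>m. m \<in> carrier M \<Longrightarrow> c m \<in> S \<rightarrow>\<^sub>E carrier ?R"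
      "\<And>m. m \<in> carrier M \<Longrightarrow> m = ?f (c m)"
    by blast+
  let ?I = "S \<times> {..<n} \<times> {..<n}"
  have "finite ?I" using S(1) by simp
  then obtain h where h: "bij_betw h {..<card ?I} ?I"
    using ex_bij_betw_nat_finite[of ?I] by (auto simp: atLeast0LessThan)
  define \<phi> where "\<phi> m = vec (card ?I) (\<lambda>l. case h l of (x, i, j) \<Rightarrow> c m x $$ (i, j))" for m
  have "inj_on \<phi> (carrier M)"
  proof (rule inj_onI)
    fix m m' assume m: "m \<in> carrier M" "m' \<in> carrier M" and eq: "\<phi> m = \<phi> m'"
    have entry: "c m x $$ (i, j) = c m' x $$ (i, j)" if x: "x \<in> S" "i < n" "j < n" for x i j
    proof -
      have "(x, i, j) \<in> h ` {..<card ?I}"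
        using x by (simp only: bij_betw_imp_surj_on[OF h]) simp
      then obtain l where l: "l < card ?I" "h l = (x, i, j)"
        by (elim imageE) simp
      have "\<phi> m $ l = \<phi> m' $ l" using eq by simp
      then show ?thesis using l by (simp add: \<phi>_def)
    qed
    have "c m x = c m' x" if "x \<in> S" for x
    proof (rule eq_matI)
      have *: "c m x \<in> carrier_mat n n" "c m' x \<in> carrier_mat n n"
        using c(1)[OF m(1)] c(1)[OF m(2)] that
        by (auto simp: lower_triangular_algebra_def PiE_def Pi_iff)
      then show "dim_row (c m x) = dim_row (c m' x)" "dim_col (c m x) = dim_col (c m' x)" by auto
      show "c m x $$ (i, j) = c m' x $$ (i, j)"
        if "i < dim_row (c m' x)" "j < dim_col (c m' x)" for i j
        using * that entry[OF \<open>x \<in> S\<close>] by auto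
    qed
    then have "c m = c m'" using c(1)[OF m(1)] c(1)[OF m(2)] by (intro PiE_ext)
    then show "m = m'" using c(2)[OF m(1)] c(2)[OF m(2)] by simp
  qed
  then show ?thesis using left_module_transport[OF assms(1)] by blast
qed


section \<open>The polynomial\<close>

text \<open>Integer polynomials in the variables \<open>x\<^sub>s\<close>, as finitely supported functions on exponents.\<close>

definition indet :: "nat \<Rightarrow> (nat \<Rightarrow>\<^sub>0 nat) \<Rightarrow>\<^sub>0 int" where
  "indet s = Poly_Mapping.single (Poly_Mapping.single s 1) 1"

definition h_poly :: "nat \<Rightarrow> (nat \<Rightarrow>\<^sub>0 nat) \<Rightarrow>\<^sub>0 int" where
  "h_poly n = (\<Prod>r=1..n. (\<Prod>s=1..r. 1 + indet s) - 1)"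

end

theory Submission
  imports Defs
begin

text \<open>
  Every indecomposable left module is an interval module: a vector in the first nonzero vertex space
  generates a uniserial submodule, and a hyperplane of the vertex space containing its socle pulls
  back to a complement.  Hence basic modules correspond to finite sets \<open>S\<close> of intervals, the
  multiplicities being recovered from the ranks of the path maps.  Comparing the matrix entries of
  an operator in the double centralizer along the homomorphisms between intervals shows that
  the module of \<open>S\<close> is faithfully balanced iff \<open>S\<close> contains the full interval, every other member
  of \<open>S\<close> is properly contained in a member with the same start or the same end, and for every
  vertex \<open>l\<close> except the first, some member of \<open>S\<close> starts at \<open>l\<close> or ends at \<open>l - 1\<close>.  Such sets are counted column by
  column, that is, by right end point, starting with the last column: if \<open>R\<close> is the set of rows
  already occupied, the columns \<open>< b\<close> contribute \<open>\<Prod>r<b. ((\<Prod>s\<le>r. 1 + x s) - [Suc r \<notin> R])\<close>.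
\<close>


section \<open>Left modules\<close>

text \<open>In the proof, vertices, rows and columns are numbered from \<open>0\<close>: the pair
  \<open>(i, j)\<close> stands for the module with top S[i+1] and socle S[j+1], and row
  \<open>i\<close> carries the variable \<open>indet (Suc i)\<close>. On the module side the
  obstacle is that \<open>basic\<close> and each \<open>has_summands_with_top\<close> may be
  witnessed by different decompositions. Ranks of path maps are invariants of the module and tie all
  of them together; they take the place of the Krull-Schmidt theorem. The conditions on
  \<open>S\<close> come from asking what can go wrong. Faithfulness forces the full interval, the
  only one on which the path from the first to the last vertex is nonzero. A member with no longer
  neighbour admits the operator that sends its top to its socle and kills all else. If nothing
  starts at \<open>l\<close> and nothing ends at \<open>l - 1\<close>, the arrow into
  \<open>l\<close> is invertible on the module. Both this operator and the inverse of the arrow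
  commute with all endomorphisms, but neither is multiplication by a lower triangular matrix. On the
  counting side, in a column only the entry with the least row lacks a member with the same end and
  an earlier start, so only that row must be occupied further right.\<close>

context left_module
begin

lemma zero_smult [simp]: "x \<in> carrier M \<Longrightarrow> \<zero> \<odot>\<^bsub>M\<^esub> x = \<zero>\<^bsub>M\<^esub>"
  using smult_l_distr[of \<zero> \<zero> x] smult_closed[of \<zero> x]
  by (simp add: M.add.l_cancel_one')

lemma smult_zero [simp]: "a \<in> carrier R \<Longrightarrow> a \<odot>\<^bsub>M\<^esub> \<zero>\<^bsub>M\<^esub> = \<zero>\<^bsub>M\<^esub>"
  using smult_r_distr[of a "\<zero>\<^bsub>M\<^esub>" "\<zero>\<^bsub>M\<^esub>"] smult_closed[of a "\<zero>\<^bsub>M\<^esub>"]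
  by (simp add: M.add.l_cancel_one')

lemma smult_l_minus:
  assumes "a \<in> carrier R" "x \<in> carrier M"
  shows "(\<ominus> a) \<odot>\<^bsub>M\<^esub> x = \<ominus>\<^bsub>M\<^esub> (a \<odot>\<^bsub>M\<^esub> x)"
proof -
  have "(\<ominus> a) \<odot>\<^bsub>M\<^esub> x \<oplus>\<^bsub>M\<^esub> a \<odot>\<^bsub>M\<^esub> x = \<zero>\<^bsub>M\<^esub>"
    using smult_l_distr[of "\<ominus> a" a x] assms by (simp add: R.l_neg)
  then show ?thesis using assms by (metis M.minus_equality R.a_inv_closed smult_closed)
qed

lemma smult_finsum:
  assumes "finite A" "a \<in> carrier R" "f \<in> A \<rightarrow> carrier M"
  shows "a \<odot>\<^bsub>M\<^esub> (\<Oplus>\<^bsub>M\<^esub>i\<in>A. f i) = (\<Oplus>\<^bsub>M\<^esub>i\<in>A. a \<odot>\<^bsub>M\<^esub> f i)"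
  using assms
proof (induction A rule: finite_induct)
  case (insert i A)
  have "(\<lambda>i. a \<odot>\<^bsub>M\<^esub> f i) \<in> A \<rightarrow> carrier M" using insert by (auto intro: smult_closed)
  then show ?case using insert by (auto simp: smult_r_distr smult_closed Pi_iff)
qed simp

lemma submoduleI:
  assumes "N \<subseteq> carrier M" "\<zero>\<^bsub>M\<^esub> \<in> N"
    and "\<And>x y. x \<in> N \<Longrightarrow> y \<in> N \<Longrightarrow> x \<oplus>\<^bsub>M\<^esub> y \<in> N"
    and sm: "\<And>a x. a \<in> carrier R \<Longrightarrow> x \<in> N \<Longrightarrow> a \<odot>\<^bsub>M\<^esub> x \<in> N"
  shows "submodule N R M"
proof
  fix x assume x: "x \<in> N"
  then have "(\<ominus> \<one>) \<odot>\<^bsub>M\<^esub> x = \<ominus>\<^bsub>M\<^esub> x" using assms(1) by (auto simp: smult_l_minus smult_one)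
  then show "inv\<^bsub>add_monoid M\<^esub> x \<in> N" using sm[of "\<ominus> \<one>" x] x by (simp add: a_inv_def)
qed (use assms in auto)

text \<open>The locale \<open>submodule\<close> phrases closure through the multiplicative record
  \<open>add_monoid M\<close>; this is its translation into additive notation.\<close>

lemma
  assumes "submodule N R M"
  shows submodule_subset: "N \<subseteq> carrier M"
    and submodule_zero: "\<zero>\<^bsub>M\<^esub> \<in> N"
    and submodule_add: "x \<in> N \<Longrightarrow> y \<in> N \<Longrightarrow> x \<oplus>\<^bsub>M\<^esub> y \<in> N"
    and submodule_smult: "a \<in> carrier R \<Longrightarrow> x \<in> N \<Longrightarrow> a \<odot>\<^bsub>M\<^esub> x \<in> N"
    and submodule_minus: "x \<in> N \<Longrightarrow> \<ominus>\<^bsub>M\<^esub> x \<in> N"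
proof -
  interpret N: submodule N R M by fact
  show "N \<subseteq> carrier M" "\<zero>\<^bsub>M\<^esub> \<in> N" using N.subset N.one_closed by auto
  show "x \<oplus>\<^bsub>M\<^esub> y \<in> N" if "x \<in> N" "y \<in> N" using N.m_closed that by simp
  show "a \<odot>\<^bsub>M\<^esub> x \<in> N" if "a \<in> carrier R" "x \<in> N" using that by (rule N.smult_closed)
  show "\<ominus>\<^bsub>M\<^esub> x \<in> N" if "x \<in> N" using N.m_inv_closed[of x] that by (simp add: a_inv_def)
qed

lemma submodule_carrier: "submodule (carrier M) R M"
  by (rule submoduleI) (auto intro: smult_closed)

end

lemma left_module_restrict_to:
  assumes "left_module R M" "submodule N R M"
  shows "left_module R (restrict_to M N)"
proof -
  interpret left_module R M by fact
  note sub = submodule_subset[OF assms(2)] and cl = submodule_zero[OF assms(2)]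
    submodule_add[OF assms(2)] submodule_smult[OF assms(2)] submodule_minus[OF assms(2)]
  have "abelian_group (restrict_to M N)"
  proof (rule abelian_groupI)
    fix x assume "x \<in> carrier (restrict_to M N)"
    then show "\<exists>y\<in>carrier (restrict_to M N). y \<oplus>\<^bsub>restrict_to M N\<^esub> x = \<zero>\<^bsub>restrict_to M N\<^esub>"
      using sub cl(4) by (auto intro!: bexI[of _ "\<ominus>\<^bsub>M\<^esub> x"] simp: M.l_neg)
  qed (use sub cl in \<open>auto simp: subset_iff M.a_ac\<close>)
  then interpret N: abelian_group "restrict_to M N" .
  show ?thesis
    by unfold_locales
      (use sub cl in \<open>auto simp: subset_iff smult_l_distr smult_r_distr smult_assoc smult_one\<close>)
qed



subsection \<open>Homomorphisms\<close>

text \<open>\<open>linear_maps\<close> demands extensional functions, so compositions and the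
  explicit maps below would have to be restricted at every step. This predicate drops the demand,
  and \<open>isomorphic_iff\<close> returns to it by restricting to the carrier.\<close>

definition lmod_hom ::
  "('r, 'q) ring_scheme \<Rightarrow> ('r, 'a) module \<Rightarrow> ('r, 'b) module \<Rightarrow> ('a \<Rightarrow> 'b) \<Rightarrow> bool" where
  "lmod_hom R M N f \<longleftrightarrow>
     f \<in> carrier M \<rightarrow> carrier N \<and>
     (\<forall>x\<in>carrier M. \<forall>y\<in>carrier M. f (x \<oplus>\<^bsub>M\<^esub> y) = f x \<oplus>\<^bsub>N\<^esub> f y) \<and>
     (\<forall>a\<in>carrier R. \<forall>x\<in>carrier M. f (a \<odot>\<^bsub>M\<^esub> x) = a \<odot>\<^bsub>N\<^esub> f x)"

definition lmod_iso ::
  "('r, 'q) ring_scheme \<Rightarrow> ('r, 'a) module \<Rightarrow> ('r, 'b) module \<Rightarrow> ('a \<Rightarrow> 'b) \<Rightarrow> bool" where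
  "lmod_iso R M N f \<longleftrightarrow> lmod_hom R M N f \<and> bij_betw f (carrier M) (carrier N)"

lemma lmod_homI:
  assumes "\<And>x. x \<in> carrier M \<Longrightarrow> f x \<in> carrier N"
    and "\<And>x y. x \<in> carrier M \<Longrightarrow> y \<in> carrier M \<Longrightarrow> f (x \<oplus>\<^bsub>M\<^esub> y) = f x \<oplus>\<^bsub>N\<^esub> f y"
    and "\<And>a x. a \<in> carrier R \<Longrightarrow> x \<in> carrier M \<Longrightarrow> f (a \<odot>\<^bsub>M\<^esub> x) = a \<odot>\<^bsub>N\<^esub> f x"
  shows "lmod_hom R M N f"
  using assms by (auto simp: lmod_hom_def)

lemma
  assumes "lmod_hom R M N f"
  shows lmod_hom_closed: "x \<in> carrier M \<Longrightarrow> f x \<in> carrier N"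
    and lmod_hom_add: "x \<in> carrier M \<Longrightarrow> y \<in> carrier M \<Longrightarrow> f (x \<oplus>\<^bsub>M\<^esub> y) = f x \<oplus>\<^bsub>N\<^esub> f y"
    and lmod_hom_smult: "a \<in> carrier R \<Longrightarrow> x \<in> carrier M \<Longrightarrow> f (a \<odot>\<^bsub>M\<^esub> x) = a \<odot>\<^bsub>N\<^esub> f x"
  using assms by (auto simp: lmod_hom_def)

lemma lmod_hom_zero:
  assumes "left_module R M" "left_module R N" "lmod_hom R M N f"
  shows "f \<zero>\<^bsub>M\<^esub> = \<zero>\<^bsub>N\<^esub>"
proof -
  interpret M: left_module R M by fact
  interpret N: left_module R N by fact
  show ?thesis
    using lmod_hom_add[OF assms(3), of "\<zero>\<^bsub>M\<^esub>" "\<zero>\<^bsub>M\<^esub>"] lmod_hom_closed[OF assms(3), of "\<zero>\<^bsub>M\<^esub>"]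
    by (simp add: N.M.add.l_cancel_one')
qed

lemma lmod_hom_finsum:
  assumes "left_module R M" "left_module R N" "lmod_hom R M N f"
    and "finite A" "g \<in> A \<rightarrow> carrier M"
  shows "f (\<Oplus>\<^bsub>M\<^esub>i\<in>A. g i) = (\<Oplus>\<^bsub>N\<^esub>i\<in>A. f (g i))"
proof -
  interpret M: left_module R M by fact
  interpret N: left_module R N by fact
  show ?thesis using assms(4,5)
  proof (induction A rule: finite_induct)
    case empty
    then show ?case by (simp add: lmod_hom_zero[OF assms(1-3)])
  next
    case (insert i A)
    have "(\<lambda>i. f (g i)) \<in> A \<rightarrow> carrier N"
      using insert lmod_hom_closed[OF assms(3)] by auto
    then show ?case using insert lmod_hom_closed[OF assms(3)]
      by (auto simp: Pi_iff lmod_hom_add[OF assms(3)] M.M.finsum_closed)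
  qed
qed

lemma lmod_hom_inj:
  assumes "left_module R M" "left_module R N" "lmod_hom R M N f"
    and ker: "\<And>x. x \<in> carrier M \<Longrightarrow> f x = \<zero>\<^bsub>N\<^esub> \<Longrightarrow> x = \<zero>\<^bsub>M\<^esub>"
  shows "inj_on f (carrier M)"
proof (rule inj_onI)
  interpret M: left_module R M by fact
  interpret N: left_module R N by fact
  fix x y assume xy: "x \<in> carrier M" "y \<in> carrier M" "f x = f y"
  have "f (x \<oplus>\<^bsub>M\<^esub> \<ominus>\<^bsub>M\<^esub> y) = f y \<oplus>\<^bsub>N\<^esub> f (\<ominus>\<^bsub>M\<^esub> y)"
    using xy by (simp add: lmod_hom_add[OF assms(3)])
  also have "\<dots> = f (y \<oplus>\<^bsub>M\<^esub> \<ominus>\<^bsub>M\<^esub> y)"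
    using xy by (simp add: lmod_hom_add[OF assms(3)] del: M.M.r_neg)
  also have "\<dots> = \<zero>\<^bsub>N\<^esub>" using xy lmod_hom_zero[OF assms(1-3)] by (simp add: M.M.r_neg)
  finally have "x \<oplus>\<^bsub>M\<^esub> \<ominus>\<^bsub>M\<^esub> y = \<zero>\<^bsub>M\<^esub>" using ker xy by simp
  then have "\<ominus>\<^bsub>M\<^esub> (\<ominus>\<^bsub>M\<^esub> y) = x" using xy by (intro M.M.minus_equality) auto
  then show "x = y" using xy by simp
qed

lemma lmod_hom_compose:
  "lmod_hom R L M f \<Longrightarrow> lmod_hom R M N g \<Longrightarrow> lmod_hom R L N (\<lambda>x. g (f x))"
  by (auto simp: lmod_hom_def Pi_iff)

lemma lmod_iso_trans:
  "lmod_iso R L M f \<Longrightarrow> lmod_iso R M N g \<Longrightarrow> lmod_iso R L N (\<lambda>x. g (f x))"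
  unfolding lmod_iso_def
  using bij_betw_trans[of f "carrier L" "carrier M" g "carrier N"]
  by (auto simp: comp_def intro: lmod_hom_compose)

lemma lmod_iso_sym:
  assumes "left_module R M" "lmod_iso R M N f"
  shows "lmod_iso R N M (the_inv_into (carrier M) f)"
proof -
  interpret left_module R M by fact
  let ?g = "the_inv_into (carrier M) f"
  have hom: "lmod_hom R M N f" and inj: "inj_on f (carrier M)" and im: "f ` carrier M = carrier N"
    using assms(2) by (auto simp: lmod_iso_def bij_betw_def)
  have g: "?g (f x) = x" if "x \<in> carrier M" for x using inj that by (rule the_inv_into_f_f)
  have "lmod_hom R N M ?g"
  proof (rule lmod_homI)
    fix x y a assume x: "x \<in> carrier N"
    then obtain x' where x': "x' \<in> carrier M" "x = f x'" using im by blast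
    then show "?g x \<in> carrier M" by (simp add: g)
    show "?g (x \<oplus>\<^bsub>N\<^esub> y) = ?g x \<oplus>\<^bsub>M\<^esub> ?g y" if y: "y \<in> carrier N"
    proof -
      from y obtain y' where y': "y' \<in> carrier M" "y = f y'" using im by blast
      show ?thesis using x' y' g[of "x' \<oplus>\<^bsub>M\<^esub> y'"] by (simp add: g lmod_hom_add[OF hom])
    qed
    show "?g (a \<odot>\<^bsub>N\<^esub> x) = a \<odot>\<^bsub>M\<^esub> ?g x" if "a \<in> carrier R"
      using x' that g[of "a \<odot>\<^bsub>M\<^esub> x'"] by (simp add: g lmod_hom_smult[OF hom] smult_closed)
  qed
  then show ?thesis using assms(2) by (auto simp: lmod_iso_def intro: bij_betw_the_inv_into)
qed

lemma isomorphic_iff: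
  assumes "left_module R M"
  shows "isomorphic R M N \<longleftrightarrow> (\<exists>f. lmod_iso R M N f)"
proof
  assume "isomorphic R M N"
  then obtain f where "f \<in> linear_maps R M N" "bij_betw f (carrier M) (carrier N)"
    unfolding isomorphic_def by blast
  then show "\<exists>f. lmod_iso R M N f"
    by (intro exI[of _ f]) (auto simp: linear_maps_def lmod_iso_def lmod_hom_def PiE_def)
next
  interpret left_module R M by fact
  assume "\<exists>f. lmod_iso R M N f"
  then obtain f where f: "lmod_iso R M N f" ..
  then have "restrict f (carrier M) \<in> linear_maps R M N"
    by (auto simp: linear_maps_def lmod_iso_def lmod_hom_def smult_closed)
  moreover have "bij_betw (restrict f (carrier M)) (carrier M) (carrier N)"
    using f by (auto simp: lmod_iso_def bij_betw_def inj_on_def)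
  ultimately show "isomorphic R M N" unfolding isomorphic_def by blast
qed

lemma isomorphic_refl: "left_module R M \<Longrightarrow> isomorphic R M M"
  by (subst isomorphic_iff) (auto simp: lmod_iso_def lmod_hom_def bij_betw_def inj_on_def
      intro!: exI[of _ "\<lambda>x. x"])

lemma isomorphic_sym:
  "left_module R M \<Longrightarrow> left_module R N \<Longrightarrow> isomorphic R M N \<Longrightarrow> isomorphic R N M"
  by (auto simp: isomorphic_iff dest: lmod_iso_sym)

lemma isomorphic_trans:
  "left_module R L \<Longrightarrow> left_module R M \<Longrightarrow> isomorphic R L M \<Longrightarrow> isomorphic R M N \<Longrightarrow> isomorphic R L N"
  by (auto simp: isomorphic_iff dest: lmod_iso_trans)

lemma lmod_hom_image_submodule:
  assumes "left_module R M" "left_module R N" "lmod_hom R M N f" "submodule A R M"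
  shows "submodule (f ` A) R N"
proof -
  interpret M: left_module R M by fact
  interpret N: left_module R N by fact
  note A = M.submodule_subset[OF assms(4)]
  show ?thesis
  proof (rule N.submoduleI)
    show "f ` A \<subseteq> carrier N" using A lmod_hom_closed[OF assms(3)] by blast
    show "\<zero>\<^bsub>N\<^esub> \<in> f ` A"
      using M.submodule_zero[OF assms(4)] lmod_hom_zero[OF assms(1-3)] by force
  next
    fix x y assume "x \<in> f ` A" "y \<in> f ` A"
    then obtain u v where "u \<in> A" "v \<in> A" "x = f u" "y = f v" by blast
    then show "x \<oplus>\<^bsub>N\<^esub> y \<in> f ` A"
      using A M.submodule_add[OF assms(4), of u v]
      by (auto simp: lmod_hom_add[OF assms(3), symmetric] subset_iff intro!: imageI)
  next
    fix a x assume "x \<in> f ` A" and a: "a \<in> carrier R"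
    then obtain u where "u \<in> A" "x = f u" by blast
    then show "a \<odot>\<^bsub>N\<^esub> x \<in> f ` A"
      using A a M.submodule_smult[OF assms(4), of a u]
      by (auto simp: lmod_hom_smult[OF assms(3), symmetric] subset_iff intro!: imageI)
  qed
qed

lemma finitely_generatedI:
  assumes "left_module R M" "finite S" "S \<subseteq> carrier M"
    and "\<And>N. submodule N R M \<Longrightarrow> S \<subseteq> N \<Longrightarrow> carrier M \<subseteq> N"
  shows "finitely_generated R M"
  unfolding finitely_generated_def
proof (intro exI[of _ S] conjI allI impI)
  fix N assume "submodule N R M \<and> S \<subseteq> N"
  then show "N = carrier M"
    using assms(4)[of N] left_module.submodule_subset[OF assms(1), of N] by auto
qed fact+


subsection \<open>The double centralizer\<close>

text \<open>Linearity over the endomorphism ring, which acts by evaluation, means commuting with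
  every endomorphism. These are thus the elements of End_E(M), again freed from
  extensionality.\<close>

definition bicommutant :: "('r, 'q) ring_scheme \<Rightarrow> ('r, 'a) module \<Rightarrow> ('a \<Rightarrow> 'a) \<Rightarrow> bool" where
  "bicommutant R M g \<longleftrightarrow>
     g \<in> carrier M \<rightarrow> carrier M \<and>
     (\<forall>x\<in>carrier M. \<forall>y\<in>carrier M. g (x \<oplus>\<^bsub>M\<^esub> y) = g x \<oplus>\<^bsub>M\<^esub> g y) \<and>
     (\<forall>f. lmod_hom R M M f \<longrightarrow> (\<forall>x\<in>carrier M. g (f x) = f (g x)))"

text \<open>Multiplications always lie in the double centralizer, so bijectivity reduces to
  faithfulness together with the inclusion of the double centralizer in the multiplications.\<close>

lemma faithfully_balanced_iff:
  assumes "left_module R M"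
  shows "faithfully_balanced R M \<longleftrightarrow>
    (\<forall>a\<in>carrier R. \<forall>b\<in>carrier R. (\<forall>x\<in>carrier M. a \<odot>\<^bsub>M\<^esub> x = b \<odot>\<^bsub>M\<^esub> x) \<longrightarrow> a = b) \<and>
    (\<forall>g. bicommutant R M g \<longrightarrow> (\<exists>a\<in>carrier R. \<forall>x\<in>carrier M. g x = a \<odot>\<^bsub>M\<^esub> x))"
proof -
  interpret left_module R M by fact
  have ext: "lmod_hom R M M f \<longleftrightarrow> restrict f (carrier M) \<in> linear_maps R M M" for f
    by (auto simp: lmod_hom_def linear_maps_def smult_closed)
  have lin: "f \<in> linear_maps R M M \<Longrightarrow> lmod_hom R M M f" for f
    by (auto simp: lmod_hom_def linear_maps_def PiE_def)
  define L where "L a = (\<lambda>x\<in>carrier M. a \<odot>\<^bsub>M\<^esub> x)" for a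
  define C where "C = carrier (endo_ring (endo_ring R M) (as_endo_module M))"
  have C: "g \<in> C \<longleftrightarrow> g \<in> extensional (carrier M) \<and> bicommutant R M g" for g
  proof
    assume g: "g \<in> C"
    have "g (f x) = f (g x)" if "lmod_hom R M M f" "x \<in> carrier M" for f x
    proof -
      have "restrict f (carrier M) \<in> linear_maps R M M" using ext that by blast
      \<comment> \<open>\<open>linear_maps_def\<close> is instantiated at a record of the shape of
        \<open>endo_ring R M\<close>, so that the membership of the restricted \<open>f\<close> in
        \<open>linear_maps R M M\<close>, over the original ring, stays folded.\<close>
      then have "g (restrict f (carrier M) x) = restrict f (carrier M) (g x)" "g x \<in> carrier M"
        using g that(2)
        by (auto simp: C_def endo_ring_def as_endo_module_def linear_maps_def[of "\<lparr>carrier = _, monoid.mult = _, one = _, zero = _, add = _\<rparr>"] simp del: restrict_apply)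
      then show ?thesis using that(2) by simp
    qed
    then show "g \<in> extensional (carrier M) \<and> bicommutant R M g"
      using g by (auto simp: C_def endo_ring_def as_endo_module_def linear_maps_def
          bicommutant_def PiE_def)
  next
    assume g: "g \<in> extensional (carrier M) \<and> bicommutant R M g"
    have "g (f x) = f (g x)" if "f \<in> linear_maps R M M" "x \<in> carrier M" for f x
      using g lin[OF that(1)] that(2) by (auto simp: bicommutant_def)
    then show "g \<in> C"
      using g by (auto simp: C_def endo_ring_def as_endo_module_def linear_maps_def
          bicommutant_def PiE_def)
  qed
  have LC: "L a \<in> C" if "a \<in> carrier R" for a
    unfolding C using that
    by (auto simp: L_def bicommutant_def smult_closed smult_r_distr lmod_hom_def Pi_iff)
  have inj: "inj_on L (carrier R) \<longleftrightarrow>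
    (\<forall>a\<in>carrier R. \<forall>b\<in>carrier R. (\<forall>x\<in>carrier M. a \<odot>\<^bsub>M\<^esub> x = b \<odot>\<^bsub>M\<^esub> x) \<longrightarrow> a = b)"
    by (auto simp: inj_on_def L_def fun_eq_iff restrict_def)
  have surj: "C \<subseteq> L ` carrier R \<longleftrightarrow>
    (\<forall>g. bicommutant R M g \<longrightarrow> (\<exists>a\<in>carrier R. \<forall>x\<in>carrier M. g x = a \<odot>\<^bsub>M\<^esub> x))"
  proof
    assume *: "C \<subseteq> L ` carrier R"
    show "\<forall>g. bicommutant R M g \<longrightarrow> (\<exists>a\<in>carrier R. \<forall>x\<in>carrier M. g x = a \<odot>\<^bsub>M\<^esub> x)"
    proof (intro allI impI)
      fix g assume g: "bicommutant R M g"
      then have "restrict g (carrier M) \<in> C"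
        by (auto simp: C bicommutant_def lmod_hom_closed)
      then obtain a where "a \<in> carrier R" "restrict g (carrier M) = L a" using * by blast
      then show "\<exists>a\<in>carrier R. \<forall>x\<in>carrier M. g x = a \<odot>\<^bsub>M\<^esub> x"
        by (intro bexI[of _ a]) (auto simp: L_def fun_eq_iff restrict_def split: if_splits)
    qed
  next
    assume *: "\<forall>g. bicommutant R M g \<longrightarrow> (\<exists>a\<in>carrier R. \<forall>x\<in>carrier M. g x = a \<odot>\<^bsub>M\<^esub> x)"
    show "C \<subseteq> L ` carrier R"
    proof
      fix g assume "g \<in> C"
      then have g: "g \<in> extensional (carrier M)" "bicommutant R M g" by (auto simp: C)
      then obtain a where "a \<in> carrier R" "\<forall>x\<in>carrier M. g x = a \<odot>\<^bsub>M\<^esub> x" using * by blast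
      moreover from this have "g = L a"
        using g(1) by (intro extensionalityI[of _ "carrier M"]) (auto simp: L_def)
      ultimately show "g \<in> L ` carrier R" by blast
    qed
  qed
  have "faithfully_balanced R M \<longleftrightarrow> inj_on L (carrier R) \<and> L ` carrier R = C"
    unfolding faithfully_balanced_def bij_betw_def L_def C_def ..
  also have "\<dots> \<longleftrightarrow> inj_on L (carrier R) \<and> C \<subseteq> L ` carrier R" using LC by blast
  finally show ?thesis unfolding inj surj .
qed

text \<open>Conjugation with the isomorphism carries over endomorphisms and operators of the double
  centralizer, and the conjugate of multiplication by \<open>a\<close> is multiplication by the same
  \<open>a\<close>.\<close>

lemma faithfully_balanced_isomorphic:
  assumes M: "left_module R M" and N: "left_module R N" and iso: "isomorphic R M N"
    and fb: "faithfully_balanced R M"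
  shows "faithfully_balanced R N"
proof -
  interpret M: left_module R M by fact
  interpret N: left_module R N by fact
  obtain \<phi> where \<phi>: "lmod_iso R M N \<phi>" using iso isomorphic_iff[OF M] by blast
  define \<psi> where "\<psi> = the_inv_into (carrier M) \<phi>"
  have \<psi>: "lmod_iso R N M \<psi>" unfolding \<psi>_def by (rule lmod_iso_sym[OF M \<phi>])
  have bij: "bij_betw \<phi> (carrier M) (carrier N)" using \<phi> by (simp add: lmod_iso_def)
  have \<psi>\<phi>: "\<psi> (\<phi> x) = x" if "x \<in> carrier M" for x
    using bij that by (simp add: \<psi>_def the_inv_into_f_f bij_betw_def)
  have \<phi>\<psi>: "\<phi> (\<psi> y) = y" if "y \<in> carrier N" for y
    using bij that by (simp add: \<psi>_def f_the_inv_into_f_bij_betw)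
  have homs: "lmod_hom R M N \<phi>" "lmod_hom R N M \<psi>"
    using \<phi> \<psi> by (auto simp: lmod_iso_def)
  note [simp] = lmod_hom_closed[OF homs(1)] lmod_hom_closed[OF homs(2)]
    lmod_hom_add[OF homs(1)] lmod_hom_add[OF homs(2)]
    lmod_hom_smult[OF homs(1)] lmod_hom_smult[OF homs(2)] \<psi>\<phi> \<phi>\<psi>
  note fb' = fb[unfolded faithfully_balanced_iff[OF M]]
  show ?thesis unfolding faithfully_balanced_iff[OF N]
  proof (intro conjI ballI allI impI)
    fix a b assume ab: "a \<in> carrier R" "b \<in> carrier R" "\<forall>y\<in>carrier N. a \<odot>\<^bsub>N\<^esub> y = b \<odot>\<^bsub>N\<^esub> y"
    have "a \<odot>\<^bsub>M\<^esub> x = b \<odot>\<^bsub>M\<^esub> x" if x: "x \<in> carrier M" for x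
    proof -
      have "\<phi> (a \<odot>\<^bsub>M\<^esub> x) = \<phi> (b \<odot>\<^bsub>M\<^esub> x)" using ab x by simp
      then have "\<psi> (\<phi> (a \<odot>\<^bsub>M\<^esub> x)) = \<psi> (\<phi> (b \<odot>\<^bsub>M\<^esub> x))" by simp
      then show ?thesis using ab x by (simp add: M.smult_closed del: lmod_hom_smult[OF homs(1)])
    qed
    then show "a = b" using fb' ab by blast
  next
    fix g assume g: "bicommutant R N g"
    have gc: "g y \<in> carrier N" if "y \<in> carrier N" for y
      using g that by (auto simp: bicommutant_def)
    have "bicommutant R M (\<lambda>x. \<psi> (g (\<phi> x)))"
      unfolding bicommutant_def
    proof (intro conjI ballI allI impI)
      show "(\<lambda>x. \<psi> (g (\<phi> x))) \<in> carrier M \<rightarrow> carrier M" by (auto simp: gc)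
      show "\<psi> (g (\<phi> (x \<oplus>\<^bsub>M\<^esub> y))) = \<psi> (g (\<phi> x)) \<oplus>\<^bsub>M\<^esub> \<psi> (g (\<phi> y))"
        if "x \<in> carrier M" "y \<in> carrier M" for x y
        using g that by (auto simp: bicommutant_def gc)
      fix f x assume f: "lmod_hom R M M f" and x: "x \<in> carrier M"
      let ?f = "\<lambda>y. \<phi> (f (\<psi> y))"
      have "lmod_hom R N N ?f"
        by (intro lmod_hom_compose[OF _ homs(1)] lmod_hom_compose[OF homs(2)] f)
      then have "\<forall>y\<in>carrier N. g (?f y) = ?f (g y)"
        using g unfolding bicommutant_def by (elim conjE allE[of _ ?f]) (rule mp)
      then have "g (?f (\<phi> x)) = ?f (g (\<phi> x))" using lmod_hom_closed[OF homs(1) x] by (rule bspec)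
      then show "\<psi> (g (\<phi> (f x))) = f (\<psi> (g (\<phi> x)))"
        using x gc[of "\<phi> x"] lmod_hom_closed[OF f] by simp
    qed
    then obtain a where a: "a \<in> carrier R" "\<And>x. x \<in> carrier M \<Longrightarrow> \<psi> (g (\<phi> x)) = a \<odot>\<^bsub>M\<^esub> x"
      using fb' by blast
    have "g y = a \<odot>\<^bsub>N\<^esub> y" if y: "y \<in> carrier N" for y
    proof -
      have "\<phi> (\<psi> (g (\<phi> (\<psi> y)))) = \<phi> (a \<odot>\<^bsub>M\<^esub> \<psi> y)" using a(2)[of "\<psi> y"] y by simp
      then show ?thesis using y a gc by simp
    qed
    then show "\<exists>a\<in>carrier R. \<forall>y\<in>carrier N. g y = a \<odot>\<^bsub>N\<^esub> y" using a(1) by blast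
  qed
qed


section \<open>Modules over the lower triangular matrices\<close>

abbreviation LT :: "nat \<Rightarrow> 'k::field mat ring" where
  "LT n \<equiv> lower_triangular_algebra TYPE('k) n"

lemma LT_simps [simp]:
  "\<zero>\<^bsub>LT n\<^esub> = 0\<^sub>m n n" "\<one>\<^bsub>LT n\<^esub> = 1\<^sub>m n"
  "A \<oplus>\<^bsub>LT n\<^esub> B = A + B" "A \<otimes>\<^bsub>LT n\<^esub> B = A * B"
  by (simp_all add: lower_triangular_algebra_def ring_mat_def)

lemma LT_carrier_iff:
  "A \<in> carrier (LT n) \<longleftrightarrow> A \<in> carrier_mat n n \<and> (\<forall>k l. k < l \<longrightarrow> l < n \<longrightarrow> A $$ (k, l) = 0)"
  by (auto simp: lower_triangular_algebra_def)

lemma LT_index_0: "A \<in> carrier (LT n) \<Longrightarrow> k < l \<Longrightarrow> l < n \<Longrightarrow> A $$ (k, l) = 0"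
  by (simp add: LT_carrier_iff)

lemma LT_carrier_mat [simp, dest]: "A \<in> carrier (LT n) \<Longrightarrow> A \<in> carrier_mat n n"
  by (simp add: LT_carrier_iff)

lemma LT_index_add [simp]:
  "A \<in> carrier (LT n) \<Longrightarrow> B \<in> carrier (LT n) \<Longrightarrow> k < n \<Longrightarrow> l < n \<Longrightarrow>
    (A + B) $$ (k, l) = A $$ (k, l) + B $$ (k, l)"
  by (auto simp: LT_carrier_iff)

lemma LT_index_mult:
  "A \<in> carrier (LT n) \<Longrightarrow> B \<in> carrier (LT n) \<Longrightarrow> k < n \<Longrightarrow> l < n \<Longrightarrow>
    (A * B) $$ (k, l) = (\<Sum>m<n. A $$ (k, m) * B $$ (m, l))"
  by (auto simp: LT_carrier_iff scalar_prod_def atLeast0LessThan)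

section \<open>Matrix units\<close>

definition unit_mat :: "nat \<Rightarrow> nat \<Rightarrow> nat \<Rightarrow> 'k::field \<Rightarrow> 'k mat" where
  "unit_mat n k l c = mat n n (\<lambda>(r, s). if r = k \<and> s = l then c else 0)"

lemma unit_mat_index [simp]:
  "r < n \<Longrightarrow> s < n \<Longrightarrow> unit_mat n k l c $$ (r, s) = (if r = k \<and> s = l then c else 0)"
  by (simp add: unit_mat_def)

lemma unit_mat_LT [simp]: "l \<le> k \<Longrightarrow> unit_mat n k l c \<in> carrier (LT n)"
  by (auto simp: LT_carrier_iff unit_mat_def)

lemma unit_mat_0 [simp]: "unit_mat n k l 0 = 0\<^sub>m n n"
  by (rule eq_matI) (auto simp: unit_mat_def)

lemma unit_mat_mult:
  assumes "l < n"
  shows "unit_mat n k l c * unit_mat n p q d = (if l = p then unit_mat n k q (c * d) else 0\<^sub>m n n)"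
  using assms
  by (intro eq_matI)
    (auto simp: unit_mat_def scalar_prod_def if_distrib[of "\<lambda>x. x * _"] sum.delta cong: if_cong)

text \<open>A lower triangular matrix is the sum of its entries times matrix units. The case
  \<open>unit\<close> keeps the actual entries of \<open>A\<close> instead of arbitrary scalars,
  because \<open>kill\<close> in \<open>indecomposable_imp_interval\<close> must know which of them
  vanish.\<close>

lemma LT_induct [consumes 1, case_names zero add unit]:
  assumes A: "A \<in> carrier (LT n)"
    and zero: "P (0\<^sub>m n n)"
    and add: "\<And>X Y. X \<in> carrier (LT n) \<Longrightarrow> Y \<in> carrier (LT n) \<Longrightarrow> P X \<Longrightarrow> P Y \<Longrightarrow> P (X + Y)"
    and unit: "\<And>k l. l \<le> k \<Longrightarrow> k < n \<Longrightarrow> P (unit_mat n k l (A $$ (k, l)))"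
  shows "P A"
proof -
  define part where "part F = mat n n (\<lambda>p. if p \<in> F then A $$ p else 0)" for F
  let ?T = "{(k, l). l \<le> k \<and> k < n}"
  have fin: "finite ?T" by (rule finite_subset[of _ "{..<n} \<times> {..<n}"]) auto
  have "part F \<in> carrier (LT n) \<and> P (part F)" if "F \<subseteq> ?T" for F
    using finite_subset[OF that fin] that
  proof (induction F rule: finite_induct)
    case empty
    have "part {} = 0\<^sub>m n n" by (rule eq_matI) (auto simp: part_def)
    then show ?case using zero by (auto simp: LT_carrier_iff)
  next
    case (insert p F)
    obtain k l where p: "p = (k, l)" by (cases p)
    then have kl: "l \<le> k" "k < n" using insert.prems by auto
    have "part (insert p F) = part F + unit_mat n k l (A $$ (k, l))"
      using insert.hyps(2) by (intro eq_matI) (auto simp: part_def p unit_mat_def)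
    moreover have "part (insert p F) \<in> carrier (LT n)"
      using A by (auto simp: part_def LT_carrier_iff)
    ultimately show ?case using insert add[of "part F" "unit_mat n k l (A $$ (k, l))"] kl unit by auto
  qed
  moreover have "part ?T = A"
    using A by (intro eq_matI) (auto simp: part_def LT_carrier_iff)
  ultimately show ?thesis by (metis subset_refl)
qed


subsection \<open>Interval modules and their direct sums\<close>

definition interval_module :: "nat \<Rightarrow> nat \<Rightarrow> ('k::field mat, nat \<Rightarrow> 'k) module" where
  "interval_module i j =
     \<lparr>carrier = {v. \<forall>k. v k \<noteq> 0 \<longrightarrow> i \<le> k \<and> k \<le> j}, monoid.mult = undefined, one = undefined,
      zero = (\<lambda>_. 0), add = (\<lambda>v w k. v k + w k),
      smult = (\<lambda>A v k. if i \<le> k \<and> k \<le> j then \<Sum>l=i..j. A $$ (k, l) * v l else 0)\<rparr>"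

lemma interval_module_simps [simp]:
  "v \<in> carrier (interval_module i j) \<longleftrightarrow> (\<forall>k. v k \<noteq> 0 \<longrightarrow> i \<le> k \<and> k \<le> j)"
  "\<zero>\<^bsub>interval_module i j\<^esub> = (\<lambda>_. 0)"
  "v \<oplus>\<^bsub>interval_module i j\<^esub> w = (\<lambda>k. v k + w k)"
  "A \<odot>\<^bsub>interval_module i j\<^esub> v =
    (\<lambda>k. if i \<le> k \<and> k \<le> j then \<Sum>l=i..j. A $$ (k, l) * v l else 0)"
  by (simp_all add: interval_module_def)

text \<open>The action is by the diagonal block with indices \<open>i\<close> to \<open>j\<close>.
  Cutting out such a block is multiplicative on lower triangular matrices: for \<open>k\<close> and
  \<open>l\<close> in the block and \<open>m\<close> outside it, \<open>k < m\<close> or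
  \<open>m < l\<close>, so one of the factors at \<open>(k, m)\<close> and \<open>(m, l)\<close> is
  zero.\<close>

lemma left_module_interval_module:
  assumes "j < n"
  shows "left_module (LT n) (interval_module i j :: ('k::field mat, _) module)"
proof -
  let ?M = "interval_module i j :: ('k mat, _) module"
  interpret R: ring "LT n :: 'k mat ring" by (rule ring_lower_triangular_algebra)
  have "abelian_group ?M"
  proof (rule abelian_groupI)
    fix v assume "v \<in> carrier ?M"
    then show "\<exists>w\<in>carrier ?M. w \<oplus>\<^bsub>?M\<^esub> v = \<zero>\<^bsub>?M\<^esub>"
      by (intro bexI[of _ "\<lambda>k. - v k"]) auto
  next
    fix v w assume "v \<in> carrier ?M" "w \<in> carrier ?M"
    then show "v \<oplus>\<^bsub>?M\<^esub> w \<in> carrier ?M" by (simp; metis add.left_neutral)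
  qed (auto simp: fun_eq_iff algebra_simps)
  then interpret M: abelian_group ?M .
  show ?thesis
  proof unfold_locales
    fix A B :: "'k mat" and v w :: "nat \<Rightarrow> 'k"
    assume A: "A \<in> carrier (LT n)"
    show "A \<odot>\<^bsub>?M\<^esub> v \<in> carrier ?M" by simp
    show "A \<odot>\<^bsub>?M\<^esub> (v \<oplus>\<^bsub>?M\<^esub> w) = A \<odot>\<^bsub>?M\<^esub> v \<oplus>\<^bsub>?M\<^esub> A \<odot>\<^bsub>?M\<^esub> w"
      by (auto simp: fun_eq_iff algebra_simps sum.distrib)
    assume B: "B \<in> carrier (LT n)"
    show "(A \<oplus>\<^bsub>LT n\<^esub> B) \<odot>\<^bsub>?M\<^esub> v = A \<odot>\<^bsub>?M\<^esub> v \<oplus>\<^bsub>?M\<^esub> B \<odot>\<^bsub>?M\<^esub> v"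
      using A B assms
      by (auto simp: fun_eq_iff algebra_simps sum.distrib[symmetric] intro!: sum.cong)
    have mult: "(A * B) $$ (k, l) = (\<Sum>m=i..j. A $$ (k, m) * B $$ (m, l))"
      if "k \<in> {i..j}" "l \<in> {i..j}" for k l
    proof -
      have "(A * B) $$ (k, l) = (\<Sum>m<n. A $$ (k, m) * B $$ (m, l))"
        using A B that assms by (intro LT_index_mult) auto
      also have "\<dots> = (\<Sum>m=i..j. A $$ (k, m) * B $$ (m, l))"
      proof (rule sum.mono_neutral_right)
        show "\<forall>m\<in>{..<n} - {i..j}. A $$ (k, m) * B $$ (m, l) = 0"
        proof
          fix m assume m: "m \<in> {..<n} - {i..j}"
          then have "k < m \<or> m < l" using that by auto
          then show "A $$ (k, m) * B $$ (m, l) = 0"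
            using m that assms LT_index_0[OF A, of k m] LT_index_0[OF B, of m l] by auto
        qed
      qed (use assms in auto)
      finally show ?thesis .
    qed
    show "(A \<otimes>\<^bsub>LT n\<^esub> B) \<odot>\<^bsub>?M\<^esub> v = A \<odot>\<^bsub>?M\<^esub> (B \<odot>\<^bsub>?M\<^esub> v)"
    proof
      fix k
      have "(\<Sum>l=i..j. (\<Sum>m=i..j. A $$ (k, m) * B $$ (m, l)) * v l)
          = (\<Sum>m=i..j. A $$ (k, m) * (\<Sum>l=i..j. B $$ (m, l) * v l))"
        unfolding sum_distrib_left sum_distrib_right
        by (subst sum.swap) (simp add: mult.assoc)
      then show "((A \<otimes>\<^bsub>LT n\<^esub> B) \<odot>\<^bsub>?M\<^esub> v) k = (A \<odot>\<^bsub>?M\<^esub> (B \<odot>\<^bsub>?M\<^esub> v)) k"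
        by (simp add: mult)
    qed
  next
    fix v assume v: "v \<in> carrier ?M"
    show "\<one>\<^bsub>LT n\<^esub> \<odot>\<^bsub>?M\<^esub> v = v"
    proof
      fix k show "(\<one>\<^bsub>LT n\<^esub> \<odot>\<^bsub>?M\<^esub> v) k = v k"
      proof (cases "i \<le> k \<and> k \<le> j")
        case True
        then have "(\<Sum>l=i..j. 1\<^sub>m n $$ (k, l) * v l) = (\<Sum>l=i..j. if l = k then v l else 0)"
          using assms by (intro sum.cong) auto
        then show ?thesis using True by simp
      qed (use v in auto)
    qed
  qed
qed

definition std_vec :: "nat \<Rightarrow> nat \<Rightarrow> 'k::field" where
  "std_vec k = (\<lambda>l. if l = k then 1 else 0)"

text \<open>Only the upper end is tested on the right: for \<open>k < i\<close> also
  \<open>l < i\<close>, and \<open>v l\<close> is zero anyway.\<close>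

lemma unit_mat_smult_interval:
  assumes "v \<in> carrier (interval_module i j)" "j < n" "l \<le> k"
  shows "unit_mat n k l c \<odot>\<^bsub>interval_module i j\<^esub> v = (\<lambda>m. if m = k \<and> k \<le> j then c * v l else 0)"
proof
  fix m
  have "(\<Sum>l'=i..j. unit_mat n k l c $$ (m, l') * v l') = (\<Sum>l'=i..j. if l' = l \<and> m = k then c * v l else 0)"
    if "m \<le> j"
    using that assms(2) by (intro sum.cong) auto
  then show "(unit_mat n k l c \<odot>\<^bsub>interval_module i j\<^esub> v) m
      = (if m = k \<and> k \<le> j then c * v l else 0)"
    using assms by (cases "m = k") (auto simp: sum.delta)
qed

definition interval_sum ::
  "'i set \<Rightarrow> ('i \<Rightarrow> nat \<times> nat) \<Rightarrow> ('k::field mat, 'i \<Rightarrow> nat \<Rightarrow> 'k) module" where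
  "interval_sum I iv =
     \<lparr>carrier = {y. \<forall>s k. y s k \<noteq> 0 \<longrightarrow> s \<in> I \<and> fst (iv s) \<le> k \<and> k \<le> snd (iv s)},
      monoid.mult = undefined, one = undefined,
      zero = (\<lambda>_ _. 0), add = (\<lambda>y z s k. y s k + z s k),
      smult = (\<lambda>A y s. A \<odot>\<^bsub>interval_module (fst (iv s)) (snd (iv s))\<^esub> y s)\<rparr>"

lemma interval_sum_simps [simp]:
  "y \<in> carrier (interval_sum I iv) \<longleftrightarrow>
    (\<forall>s k. y s k \<noteq> 0 \<longrightarrow> s \<in> I \<and> fst (iv s) \<le> k \<and> k \<le> snd (iv s))"
  "\<zero>\<^bsub>interval_sum I iv\<^esub> = (\<lambda>_ _. 0)"
  "y \<oplus>\<^bsub>interval_sum I iv\<^esub> z = (\<lambda>s k. y s k + z s k)"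
  "A \<odot>\<^bsub>interval_sum I iv\<^esub> y = (\<lambda>s. A \<odot>\<^bsub>interval_module (fst (iv s)) (snd (iv s))\<^esub> y s)"
  by (simp_all add: interval_sum_def)

lemma left_module_interval_sum:
  assumes iv: "\<And>s. s \<in> I \<Longrightarrow> snd (iv s) < n"
  shows "left_module (LT n) (interval_sum I iv :: ('k::field mat, _) module)"
proof -
  let ?M = "interval_sum I iv :: ('k mat, _) module"
  let ?N = "\<lambda>s. interval_module (fst (iv s)) (snd (iv s)) :: ('k mat, _) module"
  interpret R: ring "LT n :: 'k mat ring" by (rule ring_lower_triangular_algebra)
  have N: "left_module (LT n) (?N s)" if "s \<in> I" for s
    by (rule left_module_interval_module[OF iv[OF that]])
  have "abelian_group ?M"
  proof (rule abelian_groupI)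
    fix y assume "y \<in> carrier ?M"
    then show "\<exists>z\<in>carrier ?M. z \<oplus>\<^bsub>?M\<^esub> y = \<zero>\<^bsub>?M\<^esub>"
      by (intro bexI[of _ "\<lambda>s k. - y s k"]) auto
  next
    fix y z assume "y \<in> carrier ?M" "z \<in> carrier ?M"
    then show "y \<oplus>\<^bsub>?M\<^esub> z \<in> carrier ?M" by (simp; metis add.left_neutral)
  qed (auto simp: fun_eq_iff algebra_simps)
  then interpret M: abelian_group ?M .
  have mem: "y s \<in> carrier (?N s)" if "y \<in> carrier ?M" for y s using that by auto
  have out: "y s = (\<lambda>_. 0)" if "y \<in> carrier ?M" "s \<notin> I" for y s using that by (auto simp: fun_eq_iff)
  show ?thesis
  proof unfold_locales
    fix A B :: "'k mat" and y z
    assume A: "A \<in> carrier (LT n)" and y: "y \<in> carrier ?M"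
    show "A \<odot>\<^bsub>?M\<^esub> y \<in> carrier ?M"
      using out[OF y] by (auto simp: fun_eq_iff intro: ccontr)
    show "A \<odot>\<^bsub>?M\<^esub> (y \<oplus>\<^bsub>?M\<^esub> z) = A \<odot>\<^bsub>?M\<^esub> y \<oplus>\<^bsub>?M\<^esub> A \<odot>\<^bsub>?M\<^esub> z"
      by (auto simp: fun_eq_iff algebra_simps sum.distrib)
    assume B: "B \<in> carrier (LT n)"
    show "(A \<oplus>\<^bsub>LT n\<^esub> B) \<odot>\<^bsub>?M\<^esub> y = A \<odot>\<^bsub>?M\<^esub> y \<oplus>\<^bsub>?M\<^esub> B \<odot>\<^bsub>?M\<^esub> y"
    proof
      fix s
      show "((A \<oplus>\<^bsub>LT n\<^esub> B) \<odot>\<^bsub>?M\<^esub> y) s = (A \<odot>\<^bsub>?M\<^esub> y \<oplus>\<^bsub>?M\<^esub> B \<odot>\<^bsub>?M\<^esub> y) s"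
      proof (cases "s \<in> I")
        case True
        show ?thesis using left_module.smult_l_distr[OF N[OF True] A B mem[OF y]]
          by (simp only: interval_sum_simps interval_module_simps(3))
      next
        case False
        have "y s l = 0" for l using out[OF y False] by simp
        then show ?thesis by (auto simp: fun_eq_iff)
      qed
    qed
    show "(A \<otimes>\<^bsub>LT n\<^esub> B) \<odot>\<^bsub>?M\<^esub> y = A \<odot>\<^bsub>?M\<^esub> (B \<odot>\<^bsub>?M\<^esub> y)"
    proof
      fix s
      show "((A \<otimes>\<^bsub>LT n\<^esub> B) \<odot>\<^bsub>?M\<^esub> y) s = (A \<odot>\<^bsub>?M\<^esub> (B \<odot>\<^bsub>?M\<^esub> y)) s"
      proof (cases "s \<in> I")
        case True
        show ?thesis using left_module.smult_assoc[OF N[OF True] A B mem[OF y]]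
          by (simp only: interval_sum_simps interval_module_simps(3))
      next
        case False
        have "y s l = 0" for l using out[OF y False] by simp
        then show ?thesis by (auto simp: fun_eq_iff)
      qed
    qed
  next
    fix y assume y: "y \<in> carrier ?M"
    show "\<one>\<^bsub>LT n\<^esub> \<odot>\<^bsub>?M\<^esub> y = y"
    proof
      fix s
      show "(\<one>\<^bsub>LT n\<^esub> \<odot>\<^bsub>?M\<^esub> y) s = y s"
      proof (cases "s \<in> I")
        case True
        show ?thesis using left_module.smult_one[OF N[OF True] mem[OF y]]
          by (simp only: interval_sum_simps interval_module_simps(3))
      next
        case False
        have "y s l = 0" for l using out[OF y False] by simp
        then show ?thesis by (auto simp: fun_eq_iff)
      qed
    qed
  qed
qed

lemma unit_mat_smult_sum:
  assumes "y \<in> carrier (interval_sum I iv)" "\<And>s. s \<in> I \<Longrightarrow> snd (iv s) < n" "l \<le> k"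
  shows "unit_mat n k l c \<odot>\<^bsub>interval_sum I iv\<^esub> y =
    (\<lambda>s m. if m = k \<and> k \<le> snd (iv s) then c * y s l else 0)"
proof
  fix s
  show "(unit_mat n k l c \<odot>\<^bsub>interval_sum I iv\<^esub> y) s =
    (\<lambda>m. if m = k \<and> k \<le> snd (iv s) then c * y s l else 0)"
  proof (cases "s \<in> I")
    case True
    have "y s \<in> carrier (interval_module (fst (iv s)) (snd (iv s)))" using assms(1) by auto
    from unit_mat_smult_interval[OF this assms(2)[OF True] assms(3)] show ?thesis
      by (simp only: interval_sum_simps)
  next
    case False
    then have "y s = (\<lambda>_. 0)" using assms(1) by (auto simp: fun_eq_iff)
    then show ?thesis by (simp add: fun_eq_iff)
  qed
qed


subsection \<open>Indecomposable modules\<close>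

locale LT_module = left_module "LT n" M for n and M :: "('k::field mat, 'a) module" (structure)
begin

abbreviation unit_act :: "nat \<Rightarrow> nat \<Rightarrow> 'k \<Rightarrow> 'a \<Rightarrow> 'a" where
  "unit_act k l c x \<equiv> unit_mat n k l c \<odot> x"

abbreviation scalar :: "'k \<Rightarrow> 'a \<Rightarrow> 'a" where
  "scalar c x \<equiv> (c \<cdot>\<^sub>m 1\<^sub>m n) \<odot> x"

lemma scalar_mat_LT [simp]: "c \<cdot>\<^sub>m 1\<^sub>m n \<in> carrier (LT n)"
  by (auto simp: LT_carrier_iff)

lemma mult_scalar_mat:
  fixes A :: "'k mat"
  assumes "A \<in> carrier_mat n n"
  shows "A * (c \<cdot>\<^sub>m 1\<^sub>m n) = c \<cdot>\<^sub>m A" "(c \<cdot>\<^sub>m 1\<^sub>m n) * A = c \<cdot>\<^sub>m A"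
  using assms mult_smult_distrib[of A n n "1\<^sub>m n" n c] mult_smult_assoc_mat[of "1\<^sub>m n" n n A n c]
  by simp_all

lemma scalar_closed: "x \<in> carrier M \<Longrightarrow> scalar c x \<in> carrier M"
  by (rule smult_closed) auto

lemma scalar_scalar: "x \<in> carrier M \<Longrightarrow> scalar c (scalar d x) = scalar (c * d) x"
proof -
  assume x: "x \<in> carrier M"
  have "(c \<cdot>\<^sub>m 1\<^sub>m n) * (d \<cdot>\<^sub>m 1\<^sub>m n) = ((c * d) \<cdot>\<^sub>m 1\<^sub>m n :: 'k mat)"
    using mult_scalar_mat(2)[of "d \<cdot>\<^sub>m 1\<^sub>m n" c] by (auto intro!: eq_matI)
  then show ?thesis using x smult_assoc[of "c \<cdot>\<^sub>m 1\<^sub>m n" "d \<cdot>\<^sub>m 1\<^sub>m n" x] by simp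
qed

lemma scalar_add: "x \<in> carrier M \<Longrightarrow> scalar c x \<oplus> scalar d x = scalar (c + d) x"
  using smult_l_distr[of "c \<cdot>\<^sub>m 1\<^sub>m n" "d \<cdot>\<^sub>m 1\<^sub>m n" x] by (simp add: add_smult_distrib_right_mat[of _ n n])

lemma scalar_0: "x \<in> carrier M \<Longrightarrow> scalar 0 x = \<zero>"
proof -
  have "0 \<cdot>\<^sub>m 1\<^sub>m n = (0\<^sub>m n n :: 'k mat)" by (rule eq_matI) auto
  then show "x \<in> carrier M \<Longrightarrow> scalar 0 x = \<zero>" using zero_smult[of x] by simp
qed

lemma scalar_1: "x \<in> carrier M \<Longrightarrow> scalar 1 x = x"
proof -
  have "1 \<cdot>\<^sub>m 1\<^sub>m n = (1\<^sub>m n :: 'k mat)" by (rule eq_matI) auto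
  then show "x \<in> carrier M \<Longrightarrow> scalar 1 x = x" using smult_one[of x] by simp
qed

lemma zero_mat_smult: "x \<in> carrier M \<Longrightarrow> 0\<^sub>m n n \<odot> x = \<zero>"
  using zero_smult by simp

lemma unit_act_closed: "l \<le> k \<Longrightarrow> x \<in> carrier M \<Longrightarrow> unit_act k l c x \<in> carrier M"
  by (rule smult_closed) auto

lemma unit_act_unit_act:
  assumes "x \<in> carrier M" "l \<le> k" "q \<le> p" "l < n"
  shows "unit_act k l c (unit_act p q d x) = (if l = p then unit_act k q (c * d) x else \<zero>)"
  using smult_assoc[of "unit_mat n k l c" "unit_mat n p q d" x] assms
  by (auto simp: unit_mat_mult zero_mat_smult)

lemma unit_act_smult:
  assumes "A \<in> carrier (LT n)" "x \<in> carrier M" "l \<le> k"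
  shows "unit_act k l c (A \<odot> x) = (unit_mat n k l c * A) \<odot> x"
  using smult_assoc[of "unit_mat n k l c" A x] assms by simp

text \<open>A complement of the line through \<open>z\<close> is a subspace maximal among those
  avoiding \<open>z\<close>. Zorn's lemma provides it, since the module is arbitrary and may have
  infinite dimension.\<close>

lemma hyperplane_exists:
  assumes z: "z \<in> carrier M" "z \<noteq> \<zero>"
  obtains H where "H \<subseteq> carrier M" "\<zero> \<in> H"
    "\<And>x y. x \<in> H \<Longrightarrow> y \<in> H \<Longrightarrow> x \<oplus> y \<in> H"
    "\<And>c x. x \<in> H \<Longrightarrow> scalar c x \<in> H"
    "\<And>c. scalar c z \<in> H \<Longrightarrow> c = 0"
    "\<And>w. w \<in> carrier M \<Longrightarrow> \<exists>c. w \<oplus> scalar c z \<in> H"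
proof -
  define subspace where "subspace H \<longleftrightarrow> H \<subseteq> carrier M \<and> \<zero> \<in> H \<and>
    (\<forall>x\<in>H. \<forall>y\<in>H. x \<oplus> y \<in> H) \<and> (\<forall>x\<in>H. \<forall>c. scalar c x \<in> H)" for H
  let ?F = "{H. subspace H \<and> z \<notin> H}"
  have "\<exists>H\<in>?F. \<forall>X\<in>?F. H \<subseteq> X \<longrightarrow> X = H"
  proof (rule subset_Zorn_nonempty)
    have "subspace {\<zero>}" by (auto simp: subspace_def)
    then show "?F \<noteq> {}" using z(2) by blast
  next
    fix C assume ne: "C \<noteq> {}" and chain: "subset.chain ?F C"
    have CF: "subspace H" "z \<notin> H" if "H \<in> C" for H
      using chain that by (auto simp: subset.chain_def)
    have "x \<oplus> y \<in> \<Union>C" if xy: "x \<in> \<Union>C" "y \<in> \<Union>C" for x y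
    proof -
      obtain X Y where XY: "X \<in> C" "x \<in> X" "Y \<in> C" "y \<in> Y" using xy by blast
      then have "X \<subseteq> Y \<or> Y \<subseteq> X" using chain by (auto simp: subset.chain_def)
      then show ?thesis using XY CF(1)[of X] CF(1)[of Y] unfolding subspace_def by blast
    qed
    then have "subspace (\<Union>C)"
      using ne CF(1) unfolding subspace_def by blast
    then show "\<Union>C \<in> ?F" using CF(2) by blast
  qed
  then obtain H where H: "subspace H" "z \<notin> H"
    and max: "\<And>X. subspace X \<Longrightarrow> z \<notin> X \<Longrightarrow> H \<subseteq> X \<Longrightarrow> X = H"
    by blast
  have sub: "H \<subseteq> carrier M" and zero: "\<zero> \<in> H"
    and add: "\<And>x y. x \<in> H \<Longrightarrow> y \<in> H \<Longrightarrow> x \<oplus> y \<in> H"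
    and sc: "\<And>c x. x \<in> H \<Longrightarrow> scalar c x \<in> H"
    using H(1) by (auto simp: subspace_def)
  show thesis
  proof (rule that[OF sub zero add sc])
    fix c assume c: "scalar c z \<in> H"
    show "c = 0"
    proof (rule ccontr)
      assume "c \<noteq> 0"
      then have "scalar (1 / c) (scalar c z) = z" using z by (simp add: scalar_scalar scalar_1)
      then show False using sc[OF c, of "1 / c"] H(2) by simp
    qed
  next
    fix w assume w: "w \<in> carrier M"
    show "\<exists>c. w \<oplus> scalar c z \<in> H"
    proof (cases "w \<in> H")
      case True
      then show ?thesis using w z scalar_0[of z] by (intro exI[of _ 0]) simp
    next
      case False
      let ?X = "{h \<oplus> scalar c w | h c. h \<in> H}"
      have X: "h \<oplus> scalar c w \<in> ?X" if "h \<in> H" for h c using that by blast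
      have "subspace ?X"
        unfolding subspace_def
      proof (intro conjI ballI allI)
        show "?X \<subseteq> carrier M" using sub w by (auto simp: scalar_closed)
        show "\<zero> \<in> ?X" using X[OF zero, of 0] w by (simp add: scalar_0)
      next
        fix x y assume "x \<in> ?X" "y \<in> ?X"
        then obtain h c h' c' where *: "x = h \<oplus> scalar c w" "y = h' \<oplus> scalar c' w" "h \<in> H" "h' \<in> H"
          by blast
        then have hc: "h \<in> carrier M" "h' \<in> carrier M" using sub by auto
        have "x \<oplus> y = (h \<oplus> h') \<oplus> (scalar c w \<oplus> scalar c' w)"
          using * hc w by (simp add: M.a_ac scalar_closed)
        then show "x \<oplus> y \<in> ?X" using X[OF add[OF *(3,4)]] w by (simp add: scalar_add)
      next
        fix x d assume "x \<in> ?X"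
        then obtain h c where *: "x = h \<oplus> scalar c w" "h \<in> H" by blast
        then have hc: "h \<in> carrier M" using sub by auto
        have "scalar d x = scalar d h \<oplus> scalar (d * c) w"
          using * hc w by (simp add: smult_r_distr scalar_closed scalar_scalar)
        then show "scalar d x \<in> ?X" using X[OF sc[OF *(2)]] by simp
      qed
      moreover have "H \<subseteq> ?X"
      proof
        fix h assume h: "h \<in> H"
        then have "h \<oplus> scalar 0 w = h" using w sub by (auto simp: scalar_0)
        then show "h \<in> ?X" using X[OF h, of 0] by simp
      qed
      moreover have "w \<in> ?X" using X[OF zero, of 1] w by (simp add: scalar_1)
      \<comment> \<open>By maximality the span of \<open>H\<close> and \<open>w\<close> contains
        \<open>z\<close>. Solving \<open>z = h + c w\<close> for \<open>w\<close> yields the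
        coefficient \<open>- 1 / c\<close>.\<close>
      ultimately have "z \<in> ?X" using max[of ?X] False by blast
      then obtain h c where hc: "z = h \<oplus> scalar c w" "h \<in> H" by blast
      have h: "h \<in> carrier M" using hc sub by auto
      have c: "c \<noteq> 0" using hc H(2) w h by (auto simp: scalar_0)
      have "scalar (- 1 / c) z = scalar (- 1 / c) h \<oplus> scalar (-1) w"
        using hc h w c by (simp add: smult_r_distr scalar_closed scalar_scalar)
      then have "w \<oplus> scalar (- 1 / c) z = scalar (- 1 / c) h \<oplus> (w \<oplus> scalar (-1) w)"
        using h w by (simp add: M.a_ac scalar_closed)
      also have "w \<oplus> scalar (-1) w = \<zero>"
        using w scalar_add[of w 1 "-1"] by (simp add: scalar_1 scalar_0)
      finally show ?thesis using sc[OF hc(2)] h by (metis M.r_zero scalar_closed)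
    qed
  qed
qed

text \<open>A matrix unit with column \<open>l\<close> factors through the idempotent of vertex
  \<open>l\<close>. A vector killed by all these idempotents is therefore killed by every matrix,
  the identity included.\<close>

lemma vertex_exists:
  assumes "carrier M \<noteq> {\<zero>}"
  shows "\<exists>i<n. \<exists>x\<in>carrier M. unit_act i i 1 x \<noteq> \<zero>"
proof (rule ccontr)
  assume *: "\<not> ?thesis"
  obtain x where x: "x \<in> carrier M" "x \<noteq> \<zero>" using assms M.zero_closed by blast
  have "A \<odot> x = \<zero>" if "A \<in> carrier (LT n)" for A
    using that
  proof (induction rule: LT_induct)
    case (unit k l)
    have "unit_act k l (A $$ (k, l)) x = unit_act k l (A $$ (k, l)) (unit_act l l 1 x)"
      using x unit by (simp add: unit_act_unit_act)
    also have "unit_act l l 1 x = \<zero>" using * x unit by simp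
    finally show ?case using unit by simp
  qed (use x in \<open>auto simp: zero_mat_smult smult_l_distr[simplified]\<close>)
  from this[of "1\<^sub>m n"] show False using x smult_one[of x] R.one_closed by simp
qed

text \<open>The uniserial submodule splits off for the following reason: by the minimality of
  \<open>i\<close> the module lives on the vertices from \<open>i\<close> on, and over the algebra
  of these vertices the interval from the first vertex \<open>i\<close> to \<open>j\<close> is
  injective. The submodule \<open>B\<close> is the kernel of the retraction that corresponds to the
  functional with kernel \<open>H\<close>.\<close>

lemma indecomposable_imp_interval:
  assumes ind: "indecomposable (LT n) M"
  shows "\<exists>i j. i \<le> j \<and> j < n \<and> (\<exists>\<phi>. lmod_iso (LT n) (interval_module i j) M \<phi>)"
proof -
  let ?V = "\<lambda>i. i < n \<and> (\<exists>x\<in>carrier M. unit_act i i 1 x \<noteq> \<zero>)"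
  define i where "i = (LEAST i. ?V i)"
  have "\<exists>i. ?V i" using vertex_exists ind by (auto simp: indecomposable_def)
  then have "?V i" unfolding i_def by (rule LeastI_ex)
  then obtain x0 where x0: "x0 \<in> carrier M" "unit_act i i 1 x0 \<noteq> \<zero>" and i: "i < n" by blast
  have low: "unit_act l l 1 x = \<zero>" if "l < i" "x \<in> carrier M" for l x
    using not_less_Least[of l ?V] that i unfolding i_def[symmetric] by auto
  define x where "x = unit_act i i 1 x0"
  have x: "x \<in> carrier M" "x \<noteq> \<zero>" "unit_act i i 1 x = x"
    using x0 i by (auto simp: x_def unit_act_closed unit_act_unit_act)
  let ?J = "{k. i \<le> k \<and> k < n \<and> unit_act k i 1 x \<noteq> \<zero>}"
  define j where "j = Max ?J"
  have fJ: "finite ?J" by simp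
  have "i \<in> ?J" using i x by simp
  then have "j \<in> ?J" unfolding j_def using fJ by (intro Max_in) auto
  then have j: "i \<le> j" "j < n" "unit_act j i 1 x \<noteq> \<zero>" by auto
  have high: "unit_act k i c x = \<zero>" if "j < k" "k < n" for k c
  proof -
    have "unit_act k i 1 x = \<zero>" using Max_ge[OF fJ, of k] that j(1) unfolding j_def[symmetric] by force
    then have "unit_act k k c (unit_act k i 1 x) = \<zero>" by simp
    then show ?thesis using that j x by (simp add: unit_act_unit_act)
  qed
  \<comment> \<open>Since \<open>x\<close> sits at vertex \<open>i\<close>, a matrix acts on it
    through its column \<open>i\<close>, and rows beyond \<open>j\<close> give zero by
    \<open>high\<close>.\<close>
  have kill: "A \<odot> x = \<zero>" if A: "A \<in> carrier (LT n)"
    and A0: "\<And>k. i \<le> k \<Longrightarrow> k \<le> j \<Longrightarrow> A $$ (k, i) = 0" for A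
    using A
  proof (induction rule: LT_induct)
    case (unit k l)
    have "unit_act k l (A $$ (k, l)) x = unit_act k l (A $$ (k, l)) (unit_act i i 1 x)" by (simp only: x)
    also have "\<dots> = (if l = i then unit_act k i (A $$ (k, i)) x else \<zero>)"
      using x unit i by (subst unit_act_unit_act) auto
    also have "\<dots> = \<zero>"
      using high[of k] A0[of k] unit x(1) by (cases "k \<le> j") (auto simp: zero_mat_smult)
    finally show ?case .
  qed (use x in \<open>auto simp: zero_mat_smult smult_l_distr[simplified]\<close>)
  have agree: "A \<odot> x = B \<odot> x" if AB: "A \<in> carrier (LT n)" "B \<in> carrier (LT n)"
    and eq: "\<And>k. i \<le> k \<Longrightarrow> k \<le> j \<Longrightarrow> A $$ (k, i) = B $$ (k, i)" for A B
  proof -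
    have D: "A - B \<in> carrier (LT n)" using AB by (auto simp: LT_carrier_iff)
    have "A = B + (A - B)" using AB by (intro eq_matI) (auto simp: LT_carrier_iff)
    then have "A \<odot> x = B \<odot> x \<oplus> (A - B) \<odot> x"
      using smult_l_distr[OF AB(2) D x(1)] by simp
    also have "(A - B) \<odot> x = \<zero>"
      using AB eq i j by (intro kill D) (auto simp: LT_carrier_iff)
    finally show ?thesis using AB x by (simp add: smult_closed)
  qed
  \<comment> \<open>\<open>col v\<close> carries \<open>v\<close> in its column \<open>i\<close>, so
    it sends \<open>x\<close> to the combination of the path images of \<open>x\<close> with
    coefficients \<open>v\<close>.\<close>
  define col where "col v = mat n n (\<lambda>(r, c). if c = i \<and> i \<le> r then v r else (0::'k))" for v
  have col: "col v \<in> carrier (LT n)" for v by (auto simp: col_def LT_carrier_iff)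
  have col_index: "col v $$ (k, i) = v k" if "i \<le> k" "k \<le> j" for v k
    using that i j by (simp add: col_def)
  define \<phi> where "\<phi> v = col v \<odot> x" for v
  have \<phi>c: "\<phi> v \<in> carrier M" for v unfolding \<phi>_def using col x by (simp add: smult_closed)
  let ?N = "interval_module i j :: ('k mat, _) module"
  have hom: "lmod_hom (LT n) ?N M \<phi>"
  proof (rule lmod_homI)
    show "\<phi> v \<in> carrier M" for v by (rule \<phi>c)
    fix v w :: "nat \<Rightarrow> 'k" and A :: "'k mat"
    assume v: "v \<in> carrier ?N"
    have "(col v + col w) \<odot> x = \<phi> (v \<oplus>\<^bsub>?N\<^esub> w)"
      unfolding \<phi>_def
    proof (rule agree)
      show "col v + col w \<in> carrier (LT n)" using R.add.m_closed[OF col col, of v w] by simp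
      show "(col v + col w) $$ (k, i) = col (v \<oplus>\<^bsub>?N\<^esub> w) $$ (k, i)" if "i \<le> k" "k \<le> j" for k
        using that i j by (simp add: col_def)
    qed (rule col)
    then show "\<phi> (v \<oplus>\<^bsub>?N\<^esub> w) = \<phi> v \<oplus> \<phi> w"
      unfolding \<phi>_def using smult_l_distr[OF col col x(1), of v w] by simp
    assume A: "A \<in> carrier (LT n)"
    have Acol: "A * col v \<in> carrier (LT n)" using R.m_closed[OF A col, of v] by simp
    have "(A * col v) \<odot> x = \<phi> (A \<odot>\<^bsub>?N\<^esub> v)"
      unfolding \<phi>_def
    proof (rule agree[OF Acol col])
      fix k assume k: "i \<le> k" "k \<le> j"
      have "(A * col v) $$ (k, i) = (\<Sum>m<n. A $$ (k, m) * col v $$ (m, i))"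
        using k i j by (intro LT_index_mult A col) auto
      also have "\<dots> = (\<Sum>m=i..j. A $$ (k, m) * v m)"
        by (rule sum.mono_neutral_cong_right) (use v i j in \<open>auto simp: col_def\<close>)
      finally show "(A * col v) $$ (k, i) = col (A \<odot>\<^bsub>?N\<^esub> v) $$ (k, i)"
        using k by (simp add: col_index)
    qed
    then show "\<phi> (A \<odot>\<^bsub>?N\<^esub> v) = A \<odot> \<phi> v"
      unfolding \<phi>_def using smult_assoc[OF A col x(1), of v] by simp
  qed
  have left: "left_module (LT n) ?N" "left_module (LT n) M"
    by (rule left_module_interval_module[OF j(2)]) (rule left_module_axioms)
  define z where "z = unit_act j i 1 x"
  have z: "z \<in> carrier M" "z \<noteq> \<zero>" using j x by (auto simp: z_def unit_act_closed)
  \<comment> \<open>The path from \<open>k\<close> to \<open>j\<close> isolates coordinate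
    \<open>k\<close> as a multiple of the socle vector \<open>z\<close>, so that every coordinate
    can be tested against the single hyperplane \<open>H\<close>.\<close>
  have entry: "unit_act j k 1 (\<phi> v) = scalar (v k) z" if "i \<le> k" "k \<le> j" for k v
  proof -
    have U: "unit_mat n j k 1 * col v \<in> carrier (LT n)"
      using R.m_closed[of "unit_mat n j k 1" "col v"] col that by simp
    have "unit_act j k 1 (\<phi> v) = (unit_mat n j k 1 * col v) \<odot> x"
      unfolding \<phi>_def using col x that by (intro unit_act_smult) auto
    also have "\<dots> = unit_act j i (v k) x"
    proof (rule agree[OF U])
      fix m assume m: "i \<le> m" "m \<le> j"
      have "(unit_mat n j k 1 * col v) $$ (m, i) = (\<Sum>r<n. unit_mat n j k 1 $$ (m, r) * col v $$ (r, i))"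
        using m i j that col by (intro LT_index_mult) auto
      also have "\<dots> = (\<Sum>r<n. if r = k then (if m = j then v k else 0) else 0)"
        using m i j that by (intro sum.cong) (auto simp: col_def)
      also have "\<dots> = unit_mat n j i (v k) $$ (m, i)" using that m i j by simp
      finally show "(unit_mat n j k 1 * col v) $$ (m, i) = unit_mat n j i (v k) $$ (m, i)" .
    qed (use j in simp)
    also have "\<dots> = scalar (v k) z"
    proof -
      have "(v k \<cdot>\<^sub>m 1\<^sub>m n) * unit_mat n j i 1 = unit_mat n j i (v k)"
        using mult_scalar_mat(2)[of "unit_mat n j i 1" "v k"] j
        by (auto simp: unit_mat_def intro!: eq_matI)
      then show ?thesis
        unfolding z_def using smult_assoc[of "v k \<cdot>\<^sub>m 1\<^sub>m n" "unit_mat n j i 1" x] j x by simp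
    qed
    finally show ?thesis .
  qed
  obtain H where H: "H \<subseteq> carrier M" "\<zero> \<in> H"
    "\<And>x y. x \<in> H \<Longrightarrow> y \<in> H \<Longrightarrow> x \<oplus> y \<in> H"
    "\<And>c x. x \<in> H \<Longrightarrow> scalar c x \<in> H"
    "\<And>c. scalar c z \<in> H \<Longrightarrow> c = 0"
    "\<And>w. w \<in> carrier M \<Longrightarrow> \<exists>c. w \<oplus> scalar c z \<in> H"
    using hyperplane_exists[OF z] by blast
  have ext0: "v = (\<lambda>_. 0)" if v: "v \<in> carrier ?N" and "\<And>k. i \<le> k \<Longrightarrow> k \<le> j \<Longrightarrow> scalar (v k) z \<in> H" for v
  proof
    fix k show "v k = 0" using that H(5)[of "v k"] by (cases "i \<le> k \<and> k \<le> j") auto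
  qed
  have inj: "inj_on \<phi> (carrier ?N)"
  proof (rule lmod_hom_inj[OF left hom])
    fix v assume v: "v \<in> carrier ?N" "\<phi> v = \<zero>"
    show "v = \<zero>\<^bsub>?N\<^esub>"
      unfolding interval_module_simps
    proof (rule ext0[OF v(1)])
      fix k assume k: "i \<le> k" "k \<le> j"
      have "unit_act j k 1 (\<phi> v) = \<zero>" using v k by simp
      then show "scalar (v k) z \<in> H" using entry[OF k, of v] H(2) by simp
    qed
  qed
  define A where "A = \<phi> ` carrier ?N"
  \<comment> \<open>By \<open>entry\<close>, a member of \<open>A\<close> lies in \<open>B\<close>
    only if all its coordinates vanish. Conversely any vector can be moved into \<open>B\<close> by
    a correction in each coordinate, because \<open>H\<close> complements the line of
    \<open>z\<close>.\<close>
  define B where "B = {y \<in> carrier M. \<forall>k. i \<le> k \<and> k \<le> j \<longrightarrow> unit_act j k 1 y \<in> H}"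
  have A: "submodule A (LT n) M"
    unfolding A_def using left_module.submodule_carrier[OF left(1)]
    by (rule lmod_hom_image_submodule[OF left hom])
  have B: "submodule B (LT n) M"
  proof (rule submoduleI)
    show "B \<subseteq> carrier M" by (auto simp: B_def)
    show "\<zero> \<in> B" using H(2) by (auto simp: B_def)
    show add: "u \<oplus> v \<in> B" if "u \<in> B" "v \<in> B" for u v
      using that H(3) by (auto simp: B_def smult_r_distr)
    fix a :: "'k mat" and y assume a: "a \<in> carrier (LT n)" and y: "y \<in> B"
    have yM: "y \<in> carrier M" using y by (simp add: B_def)
    show "a \<odot> y \<in> B" using a
    proof (induction rule: LT_induct)
      case zero
      then show ?case using \<open>\<zero> \<in> B\<close> yM by (simp add: zero_mat_smult)
    next
      case (add X Y)
      then show ?case using \<open>\<And>v u. u \<in> B \<Longrightarrow> v \<in> B \<Longrightarrow> u \<oplus> v \<in> B\<close> yM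
        by (simp add: smult_l_distr[simplified])
    next
      case (unit r m)
      have "unit_act j k 1 (unit_act r m (a $$ (r, m)) y) \<in> H" if k: "i \<le> k" "k \<le> j" for k
      proof (cases "k = r")
        case True
        then have "unit_act j k 1 (unit_act r m (a $$ (r, m)) y) = unit_act j m (a $$ (r, m)) y"
          using k unit yM j by (subst unit_act_unit_act) auto
        also have "\<dots> = scalar (a $$ (r, m)) (unit_act j m 1 y)"
        proof -
          have "(a $$ (r, m) \<cdot>\<^sub>m 1\<^sub>m n) * unit_mat n j m 1 = unit_mat n j m (a $$ (r, m))"
            using mult_scalar_mat(2)[of "unit_mat n j m 1" "a $$ (r, m)"] unit True k
            by (auto simp: unit_mat_def intro!: eq_matI)
          then show ?thesis
            using smult_assoc[of "a $$ (r, m) \<cdot>\<^sub>m 1\<^sub>m n" "unit_mat n j m 1" y] unit True k yM by simp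
        qed
        also have "\<dots> \<in> H"
        proof (rule H(4), cases "i \<le> m")
          case True
          then show "unit_act j m 1 y \<in> H" using y unit \<open>k = r\<close> k by (auto simp: B_def)
        next
          case False
          have "unit_act j m 1 y = unit_act j m 1 (unit_act m m 1 y)"
            using yM unit \<open>k = r\<close> k by (simp add: unit_act_unit_act)
          \<comment> \<open>Here the minimality of \<open>i\<close> makes \<open>B\<close> closed
            under the action: paths that start below \<open>i\<close> contribute nothing.\<close>
          also have "unit_act m m 1 y = \<zero>" using False yM by (intro low) auto
          finally show "unit_act j m 1 y \<in> H" using H(2) unit \<open>k = r\<close> k by simp
        qed
        finally show ?thesis .
      next
        case False
        then show ?thesis using k unit yM j H(2) by (simp add: unit_act_unit_act)
      qed
      then show ?case using unit yM by (auto simp: B_def unit_act_closed)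
    qed
  qed
  have decomp: "\<exists>v\<in>carrier ?N. \<exists>b\<in>B. y = \<phi> v \<oplus> b" if y: "y \<in> carrier M" for y
  proof -
    have "\<exists>c. unit_act j k 1 y \<oplus> scalar c z \<in> H" if "i \<le> k" "k \<le> j" for k
      using H(6)[of "unit_act j k 1 y"] y that by (auto simp: unit_act_closed)
    then obtain c where c: "\<And>k. i \<le> k \<Longrightarrow> k \<le> j \<Longrightarrow> unit_act j k 1 y \<oplus> scalar (c k) z \<in> H"
      by metis
    define v where "v k = (if i \<le> k \<and> k \<le> j then c k else 0)" for k
    have v: "v \<in> carrier ?N" "(\<lambda>k. - v k) \<in> carrier ?N" by (auto simp: v_def)
    have "y \<oplus> \<phi> v \<in> B"
      unfolding B_def using c y \<phi>c entry[of _ v] by (auto simp: smult_r_distr v_def)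
    moreover have "\<phi> (\<lambda>k. - v k) \<oplus> \<phi> v = \<zero>"
      using lmod_hom_add[OF hom v(2) v(1)] lmod_hom_zero[OF left hom] by simp
    then have "y = \<phi> (\<lambda>k. - v k) \<oplus> (y \<oplus> \<phi> v)"
      using y \<phi>c by (metis M.a_assoc M.a_comm M.l_zero M.add.m_closed)
    ultimately show ?thesis using v(2) by blast
  qed
  have "A <+> B = carrier M"
  proof
    show "A <+> B \<subseteq> carrier M"
      using submodule_subset[OF A] submodule_subset[OF B] by (auto simp: set_add_def')
    show "carrier M \<subseteq> A <+> B"
      using decomp by (fastforce simp: set_add_def' A_def)
  qed
  moreover have "A \<inter> B = {\<zero>}"
  proof
    show "A \<inter> B \<subseteq> {\<zero>}"
    proof
      fix y assume "y \<in> A \<inter> B"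
      then obtain v where v: "v \<in> carrier ?N" "y = \<phi> v" "y \<in> B" by (auto simp: A_def)
      have "v = (\<lambda>_. 0)"
        using v entry[of _ v] by (intro ext0) (auto simp: B_def)
      then show "y \<in> {\<zero>}" using v lmod_hom_zero[OF left hom] by simp
    qed
    show "{\<zero>} \<subseteq> A \<inter> B" using submodule_zero[OF A] submodule_zero[OF B] by simp
  qed
  moreover have "A \<noteq> {\<zero>}"
  proof
    assume A0: "A = {\<zero>}"
    have v: "std_vec j \<in> carrier ?N" using j by (auto simp: std_vec_def)
    then have "\<phi> (std_vec j) = \<phi> (\<lambda>_. 0)"
      using A0 lmod_hom_zero[OF left hom] unfolding A_def by auto
    then have "std_vec j = (\<lambda>_. 0 :: 'k)" using inj v by (auto simp: inj_on_def)
    then show False by (auto simp: std_vec_def dest: fun_cong[of _ _ j])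
  qed
  ultimately have "B = {\<zero>}" using ind A B unfolding indecomposable_def by blast
  then have "carrier M \<subseteq> \<phi> ` carrier ?N" using decomp \<phi>c by fastforce
  then have "bij_betw \<phi> (carrier ?N) (carrier M)"
    using inj \<phi>c by (auto simp: bij_betw_def)
  then show ?thesis using hom j unfolding lmod_iso_def by blast
qed

end


subsection \<open>Decompositions\<close>

text \<open>The isomorphisms of the summands are added up; uniqueness of components in
  \<open>D\<close> gives injectivity, their existence surjectivity. \<open>D\<close> itself is the
  index set, so isomorphic summands stay apart.\<close>

lemma decomposition_imp_interval_sum:
  fixes M :: "('k::field mat, 'a) module"
  assumes M: "left_module (LT n) M" and D: "indecomposable_decomposition (LT n) M D"
  obtains iv \<phi> where
    "\<And>N. N \<in> D \<Longrightarrow> fst (iv N) \<le> snd (iv N) \<and> snd (iv N) < n"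
    "\<And>N. N \<in> D \<Longrightarrow> isomorphic (LT n) (interval_module (fst (iv N)) (snd (iv N))) (restrict_to M N)"
    "lmod_iso (LT n) (interval_sum D iv) M \<phi>"
proof -
  interpret left_module "LT n" M by fact
  have fin: "finite D"
    and sub: "\<And>N. N \<in> D \<Longrightarrow> submodule N (LT n) M"
    and ind: "\<And>N. N \<in> D \<Longrightarrow> indecomposable (LT n) (restrict_to M N)"
    and uniq: "\<And>x. x \<in> carrier M \<Longrightarrow> \<exists>!f. f \<in> (\<Pi>\<^sub>E N\<in>D. N) \<and> x = (\<Oplus>\<^bsub>M\<^esub>N\<in>D. f N)"
    using D unfolding indecomposable_decomposition_def by blast+
  have "\<exists>p \<psi>. fst p \<le> snd p \<and> snd p < n \<and>
      lmod_iso (LT n) (interval_module (fst p) (snd p)) (restrict_to M N) \<psi>" if N: "N \<in> D" for N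
  proof -
    interpret N: left_module "LT n" "restrict_to M N"
      by (rule left_module_restrict_to[OF M sub[OF N]])
    interpret N: LT_module n "restrict_to M N" ..
    from N.indecomposable_imp_interval[OF ind[OF N]] show ?thesis by (metis fst_conv snd_conv)
  qed
  then obtain iv \<psi> where iv: "\<And>N. N \<in> D \<Longrightarrow> fst (iv N) \<le> snd (iv N) \<and> snd (iv N) < n"
    and \<psi>: "\<And>N. N \<in> D \<Longrightarrow>
      lmod_iso (LT n) (interval_module (fst (iv N)) (snd (iv N))) (restrict_to M N) (\<psi> N)"
    by metis
  let ?I = "\<lambda>N. interval_module (fst (iv N)) (snd (iv N)) :: ('k mat, _) module"
  let ?S = "interval_sum D iv :: ('k mat, _) module"
  have hom: "lmod_hom (LT n) (?I N) (restrict_to M N) (\<psi> N)"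
    and bij: "bij_betw (\<psi> N) (carrier (?I N)) N" if "N \<in> D" for N
    using \<psi>[OF that] by (auto simp: lmod_iso_def)
  have comp: "y N \<in> carrier (?I N)" if "y \<in> carrier ?S" for y N using that by auto
  have \<psi>N: "\<psi> N (y N) \<in> N" if "y \<in> carrier ?S" "N \<in> D" for y N
    using lmod_hom_closed[OF hom[OF that(2)] comp[OF that(1)]] by simp
  have \<psi>c: "\<psi> N (y N) \<in> carrier M" if "y \<in> carrier ?S" "N \<in> D" for y N
    using \<psi>N[OF that] submodule_subset[OF sub[OF that(2)]] by blast
  define \<phi> where "\<phi> y = (\<Oplus>\<^bsub>M\<^esub>N\<in>D. \<psi> N (y N))" for y
  have "lmod_hom (LT n) ?S M \<phi>"
  proof (rule lmod_homI)
    show "\<phi> y \<in> carrier M" if "y \<in> carrier ?S" for y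
      unfolding \<phi>_def using \<psi>c[OF that] by (intro M.finsum_closed) auto
    show "\<phi> (y \<oplus>\<^bsub>?S\<^esub> z) = \<phi> y \<oplus>\<^bsub>M\<^esub> \<phi> z" if "y \<in> carrier ?S" "z \<in> carrier ?S" for y z
    proof -
      have "\<psi> N ((y \<oplus>\<^bsub>?S\<^esub> z) N) = \<psi> N (y N) \<oplus>\<^bsub>M\<^esub> \<psi> N (z N)" if N: "N \<in> D" for N
        using lmod_hom_add[OF hom[OF N] comp[of y N] comp[of z N]] \<open>y \<in> carrier ?S\<close> \<open>z \<in> carrier ?S\<close>
        by simp
      then have "\<phi> (y \<oplus>\<^bsub>?S\<^esub> z) = (\<Oplus>\<^bsub>M\<^esub>N\<in>D. \<psi> N (y N) \<oplus>\<^bsub>M\<^esub> \<psi> N (z N))"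
        unfolding \<phi>_def using \<psi>c that by (intro M.finsum_cong') auto
      then show ?thesis
        unfolding \<phi>_def using \<psi>c that by (subst M.finsum_addf[symmetric]) auto
    qed
    show "\<phi> (A \<odot>\<^bsub>?S\<^esub> y) = A \<odot>\<^bsub>M\<^esub> \<phi> y" if "A \<in> carrier (LT n)" "y \<in> carrier ?S" for A y
    proof -
      have "\<psi> N ((A \<odot>\<^bsub>?S\<^esub> y) N) = A \<odot>\<^bsub>M\<^esub> \<psi> N (y N)" if N: "N \<in> D" for N
        using lmod_hom_smult[OF hom[OF N] _ comp[of y N], of A] \<open>A \<in> carrier (LT n)\<close> \<open>y \<in> carrier ?S\<close>
        by simp
      then have "\<phi> (A \<odot>\<^bsub>?S\<^esub> y) = (\<Oplus>\<^bsub>M\<^esub>N\<in>D. A \<odot>\<^bsub>M\<^esub> \<psi> N (y N))"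
        unfolding \<phi>_def using \<psi>c that by (intro M.finsum_cong') (auto intro: smult_closed)
      then show ?thesis
        unfolding \<phi>_def using \<psi>c that by (subst smult_finsum) (auto simp: fin)
    qed
  qed
  moreover have "inj_on \<phi> (carrier ?S)"
  proof (rule inj_onI)
    fix y z assume yz: "y \<in> carrier ?S" "z \<in> carrier ?S" "\<phi> y = \<phi> z"
    have fam: "(\<lambda>N\<in>D. \<psi> N (y N)) \<in> (\<Pi>\<^sub>E N\<in>D. N) \<and> \<phi> y = (\<Oplus>\<^bsub>M\<^esub>N\<in>D. (\<lambda>N\<in>D. \<psi> N (y N)) N)"
      if "y \<in> carrier ?S" for y
      unfolding \<phi>_def using \<psi>N[OF that] \<psi>c[OF that] by (auto intro!: M.finsum_cong')
    have "\<phi> y \<in> carrier M"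
      unfolding \<phi>_def using \<psi>c[OF yz(1)] by (intro M.finsum_closed) auto
    from ex1_implies_ex[OF uniq[OF this]] uniq[OF this]
    have eq: "(\<lambda>N\<in>D. \<psi> N (y N)) = (\<lambda>N\<in>D. \<psi> N (z N))"
      using fam[OF yz(1)] fam[OF yz(2)] yz(3) by (metis (no_types, lifting))
    show "y = z"
    proof
      fix N show "y N = z N"
      proof (cases "N \<in> D")
        case True
        then have "\<psi> N (y N) = \<psi> N (z N)" using fun_cong[OF eq, of N] by simp
        then show ?thesis using bij[OF True] comp[OF yz(1), of N] comp[OF yz(2), of N]
          by (auto simp only: bij_betw_def inj_on_def)
      next
        case False
        then have "y N k = 0" "z N k = 0" for k using yz(1,2) by auto
        then show ?thesis by (simp add: fun_eq_iff)
      qed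
    qed
  qed
  moreover have "x \<in> \<phi> ` carrier ?S" if x: "x \<in> carrier M" for x
  proof -
    obtain f where f: "f \<in> (\<Pi>\<^sub>E N\<in>D. N)" "x = (\<Oplus>\<^bsub>M\<^esub>N\<in>D. f N)" using uniq[OF x] by blast
    have "\<exists>v\<in>carrier (?I N). f N = \<psi> N v" if N: "N \<in> D" for N
    proof -
      have "f N \<in> N" using PiE_mem[OF f(1) N] .
      then have "f N \<in> \<psi> N ` carrier (?I N)" using bij[OF N] unfolding bij_betw_def by (simp only:)
      then show ?thesis by blast
    qed
    then obtain v where v: "\<And>N. N \<in> D \<Longrightarrow> v N \<in> carrier (?I N)" "\<And>N. N \<in> D \<Longrightarrow> f N = \<psi> N (v N)"
      by metis
    define y where "y N = (if N \<in> D then v N else (\<lambda>_. 0))" for N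
    have "y \<in> carrier ?S" using v(1) by (auto simp: y_def split: if_splits)
    moreover have "x = \<phi> y"
      unfolding f(2) \<phi>_def using \<psi>c[OF \<open>y \<in> carrier ?S\<close>] v(2)
      by (intro M.finsum_cong') (auto simp: y_def)
    ultimately show ?thesis by blast
  qed
  ultimately have "lmod_iso (LT n) ?S M \<phi>"
    by (auto simp: lmod_iso_def bij_betw_def lmod_hom_closed)
  moreover have "isomorphic (LT n) (?I N) (restrict_to M N)" if "N \<in> D" for N
    using isomorphic_iff[OF left_module_interval_module] iv[OF that] \<psi>[OF that] by blast
  ultimately show thesis using that iv by blast
qed

text \<open>The socle is simple: a path to \<open>j\<close>, suitably scaled, sends any nonzero
  vector to the basis vector at \<open>j\<close>. Hence two nonzero submodules always meet.\<close>

lemma indecomposable_if_interval: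
  fixes N :: "('k::field mat, 'a) module"
  assumes N: "left_module (LT n) N" and ij: "i \<le> j" "j < n"
    and \<psi>: "lmod_iso (LT n) (interval_module i j) N \<psi>"
  shows "indecomposable (LT n) N"
proof -
  interpret left_module "LT n" N by fact
  let ?I = "interval_module i j :: ('k mat, _) module"
  have I: "left_module (LT n) ?I" by (rule left_module_interval_module[OF ij(2)])
  have hom: "lmod_hom (LT n) ?I N \<psi>" and bij: "bij_betw \<psi> (carrier ?I) (carrier N)"
    using \<psi> by (auto simp: lmod_iso_def)
  have e: "std_vec j \<in> carrier ?I" using ij by (auto simp: std_vec_def)
  have ne: "\<psi> (std_vec j) \<noteq> \<zero>\<^bsub>N\<^esub>"
  proof
    assume "\<psi> (std_vec j) = \<zero>\<^bsub>N\<^esub>"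
    then have "\<psi> (std_vec j) = \<psi> \<zero>\<^bsub>?I\<^esub>" using lmod_hom_zero[OF I N hom] by simp
    then have "std_vec j = (\<lambda>_. 0 :: 'k)"
      using bij e by (auto simp: bij_betw_def inj_on_def)
    then show False by (auto simp: std_vec_def dest: fun_cong[of _ _ j])
  qed
  have socle: "\<psi> (std_vec j) \<in> A" if A: "submodule A (LT n) N" "A \<noteq> {\<zero>\<^bsub>N\<^esub>}" for A
  proof -
    obtain x where x: "x \<in> A" "x \<noteq> \<zero>\<^bsub>N\<^esub>" using A submodule_zero[OF A(1)] by blast
    then have "x \<in> \<psi> ` carrier ?I" using submodule_subset[OF A(1)] bij unfolding bij_betw_def by blast
    then obtain v where v: "v \<in> carrier ?I" "x = \<psi> v" by blast
    have "v \<noteq> (\<lambda>_. 0)" using v(2) x(2) lmod_hom_zero[OF I N hom] by auto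
    then obtain l where l: "v l \<noteq> 0" by (auto simp: fun_eq_iff)
    then have li: "i \<le> l" "l \<le> j" using v(1) by auto
    have "unit_mat n j l (1 / v l) \<odot>\<^bsub>?I\<^esub> v = std_vec j"
      unfolding unit_mat_smult_interval[OF v(1) ij(2) li(2)] using l by (auto simp: std_vec_def)
    moreover have "unit_mat n j l (1 / v l) \<odot>\<^bsub>N\<^esub> x \<in> A"
      using A(1) x li by (intro submodule_smult) auto
    ultimately show ?thesis
      using lmod_hom_smult[OF hom _ v(1), of "unit_mat n j l (1 / v l)"] v(2) li by simp
  qed
  show ?thesis unfolding indecomposable_def
  proof (intro conjI allI impI)
    show "carrier N \<noteq> {\<zero>\<^bsub>N\<^esub>}" using ne lmod_hom_closed[OF hom e] by blast
    show "A = {\<zero>\<^bsub>N\<^esub>} \<or> B = {\<zero>\<^bsub>N\<^esub>}"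
      if "submodule A (LT n) N \<and> submodule B (LT n) N \<and> A <+>\<^bsub>N\<^esub> B = carrier N \<and> A \<inter> B = {\<zero>\<^bsub>N\<^esub>}" for A B
      using socle[of A] socle[of B] ne that by blast
  qed
qed

lemma interval_sum_finsum:
  assumes I: "\<And>s. s \<in> I \<Longrightarrow> snd (iv s) < n" and "finite A"
    and "f \<in> A \<rightarrow> carrier (interval_sum I iv :: ('k::field mat, _) module)"
  shows "finsum (interval_sum I iv :: ('k mat, _) module) f A = (\<lambda>s k. \<Sum>a\<in>A. f a s k)"
proof -
  let ?S = "interval_sum I iv :: ('k mat, _) module"
  interpret left_module "LT n" ?S by (rule left_module_interval_sum[OF I])
  show ?thesis using assms(2,3)
  proof (induction A rule: finite_induct)
    case empty
    then show ?case by (simp only: M.finsum_empty) (simp add: fun_eq_iff)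
  next
    case (insert a A)
    then have "f \<in> A \<rightarrow> carrier ?S" "f a \<in> carrier ?S" by auto
    then have "finsum ?S f (insert a A) = f a \<oplus>\<^bsub>?S\<^esub> finsum ?S f A"
      using insert.hyps by (rule M.finsum_insert[rotated 2])
    also have "finsum ?S f A = (\<lambda>s k. \<Sum>a\<in>A. f a s k)" using insert by blast
    finally show ?case using insert.hyps by (simp add: fun_eq_iff)
  qed
qed

text \<open>A decomposition is a set of submodules, so indices with equal intervals must still yield
  different submodules. This is the injectivity of \<open>X\<close>; it holds because a nonzero
  vector concentrated at one index determines that index.\<close>

lemma interval_sum_decomposition:
  fixes M :: "('k::field mat, 'a) module" and I :: "'i set"
  assumes M: "left_module (LT n) M" and fin: "finite I"
    and iv: "\<And>s. s \<in> I \<Longrightarrow> fst (iv s) \<le> snd (iv s) \<and> snd (iv s) < n"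
    and \<phi>: "lmod_iso (LT n) (interval_sum I iv) M \<phi>"
  obtains X where "inj_on X I" "indecomposable_decomposition (LT n) M (X ` I)"
    "\<And>s. s \<in> I \<Longrightarrow> isomorphic (LT n) (interval_module (fst (iv s)) (snd (iv s))) (restrict_to M (X s))"
proof -
  interpret left_module "LT n" M by fact
  let ?S = "interval_sum I iv :: ('k mat, _) module"
  let ?I = "\<lambda>s. interval_module (fst (iv s)) (snd (iv s)) :: ('k mat, _) module"
  have S: "left_module (LT n) ?S" using iv by (intro left_module_interval_sum) auto
  have Im: "left_module (LT n) (?I s)" if "s \<in> I" for s
    using iv[OF that] by (intro left_module_interval_module) auto
  have hom: "lmod_hom (LT n) ?S M \<phi>" and bij: "bij_betw \<phi> (carrier ?S) (carrier M)"
    using \<phi> by (auto simp: lmod_iso_def)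
  define emb where "emb s v = (\<lambda>t. if t = s then v else (\<lambda>_. 0 :: 'k))" for s :: 'i and v :: "nat \<Rightarrow> 'k"
  have emb: "emb s v \<in> carrier ?S" if "s \<in> I" "v \<in> carrier (?I s)" for s v
    using that by (auto simp: emb_def split: if_splits)
  have emb_hom: "lmod_hom (LT n) (?I s) ?S (emb s)" if "s \<in> I" for s
  proof (rule lmod_homI)
    show "emb s (v \<oplus>\<^bsub>?I s\<^esub> w) = emb s v \<oplus>\<^bsub>?S\<^esub> emb s w" for v w
      by (auto simp: emb_def fun_eq_iff)
    show "emb s (A \<odot>\<^bsub>?I s\<^esub> v) = A \<odot>\<^bsub>?S\<^esub> emb s v" for A v
      by (auto simp: emb_def fun_eq_iff)
  qed (rule emb[OF that])
  define \<epsilon> where "\<epsilon> s v = \<phi> (emb s v)" for s v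
  have \<epsilon>: "lmod_hom (LT n) (?I s) M (\<epsilon> s)" if "s \<in> I" for s
    unfolding \<epsilon>_def by (rule lmod_hom_compose[OF emb_hom[OF that] hom])
  have \<epsilon>_eq: "v = w \<and> (s = t \<or> v = (\<lambda>_. 0))" if st: "s \<in> I" "t \<in> I" "v \<in> carrier (?I s)" "w \<in> carrier (?I t)"
    and eq: "\<epsilon> s v = \<epsilon> t w" "s = t \<or> v \<noteq> (\<lambda>_. 0)" for s t v w
  proof -
    have "emb s v = emb t w"
      using bij emb[OF st(1,3)] emb[OF st(2,4)] eq(1)
      unfolding \<epsilon>_def by (auto simp only: bij_betw_def inj_on_def)
    from fun_cong[OF this, of s] fun_cong[OF this, of t] show ?thesis
      using eq(2) by (auto simp: emb_def split: if_splits)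
  qed
  have \<epsilon>c: "\<epsilon> s v \<in> carrier M" if "s \<in> I" "v \<in> carrier (?I s)" for s v
    by (rule lmod_hom_closed[OF \<epsilon>[OF that(1)] that(2)])
  define X where "X s = \<epsilon> s ` carrier (?I s)" for s
  have X: "submodule (X s) (LT n) M" if "s \<in> I" for s
    unfolding X_def using left_module.submodule_carrier[OF Im[OF that]]
    by (rule lmod_hom_image_submodule[OF Im[OF that] M \<epsilon>[OF that]])
  have iso: "lmod_iso (LT n) (?I s) (restrict_to M (X s)) (\<epsilon> s)" if s: "s \<in> I" for s
  proof -
    have "inj_on (\<epsilon> s) (carrier (?I s))" using \<epsilon>_eq[OF s s] by (auto intro!: inj_onI)
    then show ?thesis
      using \<epsilon>[OF s] by (auto simp: lmod_iso_def X_def bij_betw_def lmod_hom_def)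
  qed
  have inj: "inj_on X I"
  proof (rule inj_onI)
    fix s t assume st: "s \<in> I" "t \<in> I" "X s = X t"
    let ?v = "std_vec (fst (iv s)) :: nat \<Rightarrow> 'k"
    have v: "?v \<in> carrier (?I s)" using iv[OF st(1)] by (auto simp: std_vec_def)
    then have "\<epsilon> s ?v \<in> X t" using st by (auto simp only: X_def)
    then obtain w where w: "w \<in> carrier (?I t)" "\<epsilon> s ?v = \<epsilon> t w" by (auto simp only: X_def)
    have "?v \<noteq> (\<lambda>_. 0)" by (auto simp: std_vec_def dest: fun_cong[of _ _ "fst (iv s)"])
    then show "s = t" using \<epsilon>_eq[OF st(1,2) v w(1,2)] by blast
  qed
  have sum: "(\<Oplus>\<^bsub>M\<^esub>s\<in>I. \<epsilon> s (y s)) = \<phi> y" if y: "y \<in> carrier ?S" for y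
  proof -
    have ys: "y s \<in> carrier (?I s)" for s using y by auto
    have "\<phi> (finsum ?S (\<lambda>s. emb s (y s)) I) = (\<Oplus>\<^bsub>M\<^esub>s\<in>I. \<epsilon> s (y s))"
      unfolding \<epsilon>_def using emb ys by (intro lmod_hom_finsum[OF S M hom fin]) blast
    moreover have "finsum ?S (\<lambda>s. emb s (y s)) I = (\<lambda>t k. \<Sum>s\<in>I. emb s (y s) t k)"
      using emb ys fin iv by (intro interval_sum_finsum[where n = n]) blast+
    moreover have "(\<Sum>s\<in>I. emb s (y s) t k) = y t k" for t k
    proof -
      have "(\<Sum>s\<in>I. emb s (y s) t k) = (\<Sum>s\<in>I. if s = t then y t k else 0)"
        by (intro sum.cong) (auto simp: emb_def)
      then show ?thesis using fin y by auto
    qed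
    ultimately show ?thesis by simp
  qed
  have decomp: "\<exists>!f. f \<in> (\<Pi>\<^sub>E N\<in>X ` I. N) \<and> x = (\<Oplus>\<^bsub>M\<^esub>N\<in>X ` I. f N)" if x: "x \<in> carrier M" for x
  proof -
    obtain y where y: "y \<in> carrier ?S" "x = \<phi> y" using bij x by (auto simp only: bij_betw_def)
    have ys: "y s \<in> carrier (?I s)" for s using y(1) by auto
    have XM: "X s \<subseteq> carrier M" if "s \<in> I" for s by (rule submodule_subset[OF X[OF that]])
    have reidx: "(\<Oplus>\<^bsub>M\<^esub>N\<in>X ` I. f N) = (\<Oplus>\<^bsub>M\<^esub>s\<in>I. f (X s))" if "f \<in> (\<Pi>\<^sub>E N\<in>X ` I. N)" for f
    proof (rule M.finsum_reindex[OF _ inj])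
      show "f \<in> X ` I \<rightarrow> carrier M"
      proof
        fix N assume N: "N \<in> X ` I"
        then show "f N \<in> carrier M" using PiE_mem[OF that N] XM by blast
      qed
    qed
    define f where "f = (\<lambda>N\<in>X ` I. \<epsilon> (the_inv_into I X N) (y (the_inv_into I X N)))"
    have fX: "f (X s) = \<epsilon> s (y s)" if "s \<in> I" for s
      using that by (simp add: f_def the_inv_into_f_f[OF inj])
    show ?thesis
    proof (rule ex1I[of _ f])
      have f: "f \<in> (\<Pi>\<^sub>E N\<in>X ` I. N)"
      proof (rule PiE_I)
        fix N assume "N \<in> X ` I"
        then obtain s where s: "s \<in> I" "N = X s" by blast
        have "\<epsilon> s (y s) \<in> X s" unfolding X_def using ys by (rule imageI)
        then show "f N \<in> N" using fX s by simp
      qed (auto simp: f_def)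
      have "(\<Oplus>\<^bsub>M\<^esub>s\<in>I. f (X s)) = (\<Oplus>\<^bsub>M\<^esub>s\<in>I. \<epsilon> s (y s))"
        using fX \<epsilon>c ys by (intro M.finsum_cong') blast+
      then show "f \<in> (\<Pi>\<^sub>E N\<in>X ` I. N) \<and> x = (\<Oplus>\<^bsub>M\<^esub>N\<in>X ` I. f N)"
        using f reidx[OF f] sum[OF y(1)] y(2) by simp
    next
      fix g assume g: "g \<in> (\<Pi>\<^sub>E N\<in>X ` I. N) \<and> x = (\<Oplus>\<^bsub>M\<^esub>N\<in>X ` I. g N)"
      have "\<exists>w. w \<in> carrier (?I s) \<and> g (X s) = \<epsilon> s w" if "s \<in> I" for s
      proof -
        have "g (X s) \<in> X s" using PiE_mem[of g "X ` I" "\<lambda>N. N" "X s"] g that by blast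
        then show ?thesis by (auto simp only: X_def)
      qed
      then obtain w where w: "\<And>s. s \<in> I \<Longrightarrow> w s \<in> carrier (?I s)" "\<And>s. s \<in> I \<Longrightarrow> g (X s) = \<epsilon> s (w s)"
        by metis
      define z where "z s = (if s \<in> I then w s else (\<lambda>_. 0))" for s
      have z: "z \<in> carrier ?S" using w(1) by (auto simp: z_def split: if_splits)
      have zI: "z s \<in> carrier (?I s)" for s using z by auto
      have "(\<Oplus>\<^bsub>M\<^esub>s\<in>I. g (X s)) = (\<Oplus>\<^bsub>M\<^esub>s\<in>I. \<epsilon> s (z s))"
      proof (rule M.finsum_cong'[OF refl])
        show "(\<lambda>s. \<epsilon> s (z s)) \<in> I \<rightarrow> carrier M" using \<epsilon>c zI by blast
      qed (simp add: w(2) z_def)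
      then have "\<phi> y = \<phi> z" using g reidx[of g] sum[OF z] y(2) by simp
      then have "y = z" using bij y(1) z by (auto simp only: bij_betw_def inj_on_def)
      then have "g (X s) = f (X s)" if "s \<in> I" for s using w(2) fX that by (simp add: z_def)
      then show "g = f" using g by (intro extensionalityI[of g "X ` I" f]) (auto simp: PiE_def f_def)
    qed
  qed
  show thesis
  proof (rule that[OF inj])
    show "isomorphic (LT n) (?I s) (restrict_to M (X s))" if "s \<in> I" for s
      using isomorphic_iff[OF Im[OF that]] iso[OF that] by blast
    show "indecomposable_decomposition (LT n) M (X ` I)"
      unfolding indecomposable_decomposition_def
    proof (intro conjI ballI)
      fix N assume "N \<in> X ` I"
      then obtain s where s: "s \<in> I" "N = X s" by blast
      show "submodule N (LT n) M" using X s by blast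
      show "indecomposable (LT n) (restrict_to M N)"
        unfolding s(2)
        by (rule indecomposable_if_interval[OF left_module_restrict_to[OF M X[OF s(1)]] _ _ iso[OF s(1)]])
          (use iv[OF s(1)] in auto)
    qed (use fin decomp in auto)
  qed
qed


subsection \<open>Uniqueness of the multiplicities\<close>

text \<open>Gaussian elimination: a pivot \<open>p\<close> with nonzero coordinate \<open>t\<close>
  clears this coordinate from the other vectors, which leaves one vector and one coordinate
  fewer.\<close>

lemma dependent_if_card_less:
  fixes u :: "'i \<Rightarrow> 'j \<Rightarrow> 'k::field"
  assumes "finite Y" "finite X" "card Y < card X"
  shows "\<exists>c. (\<exists>s\<in>X. c s \<noteq> 0) \<and> (\<forall>t\<in>Y. (\<Sum>s\<in>X. c s * u s t) = 0)"
  using assms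
proof (induction Y arbitrary: X u rule: finite_induct)
  case empty
  then have "X \<noteq> {}" by auto
  then show ?case by (intro exI[of _ "\<lambda>_. 1"]) auto
next
  case (insert t Y)
  show ?case
  proof (cases "\<forall>s\<in>X. u s t = 0")
    case True
    have "card Y < card X" using insert by simp
    from insert.IH[OF insert.prems(1) this, of u] True show ?thesis by auto
  next
    case False
    then obtain p where p: "p \<in> X" "u p t \<noteq> 0" by blast
    define u' where "u' s r = u s r - u s t / u p t * u p r" for s r
    have "finite (X - {p})" "card Y < card (X - {p})" using insert p by auto
    from insert.IH[OF this, of u'] obtain c where
      c: "\<exists>s\<in>X - {p}. c s \<noteq> 0" "\<forall>r\<in>Y. (\<Sum>s\<in>X - {p}. c s * u' s r) = 0" by blast
    \<comment> \<open>The coefficient of the pivot collects the multiples of it that were subtracted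
      in \<open>u'\<close>, so the combination of the \<open>u'\<close> becomes one of the original
      vectors.\<close>
    let ?b = "- (\<Sum>s\<in>X - {p}. c s * (u s t / u p t))"
    define d where "d = c(p := ?b)"
    have d: "(\<Sum>s\<in>X. d s * u s r) = (\<Sum>s\<in>X - {p}. c s * u' s r)" for r
    proof -
      have "(\<Sum>s\<in>X. d s * u s r) = ?b * u p r + (\<Sum>s\<in>X - {p}. c s * u s r)"
        using insert.prems(1) p(1) by (subst sum.remove[of _ p]) (auto simp: d_def intro!: sum.cong)
      also have "\<dots> = (\<Sum>s\<in>X - {p}. c s * u' s r)"
        by (simp add: u'_def algebra_simps sum_subtractf sum_distrib_left sum_distrib_right)
      finally show ?thesis .
    qed
    have "(\<Sum>s\<in>X. d s * u s r) = 0" if "r \<in> insert t Y" for r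
    proof (cases "r = t")
      case True
      then show ?thesis unfolding d using p(2) by (simp add: u'_def)
    next
      case False
      then show ?thesis unfolding d using that c(2) by simp
    qed
    moreover have "\<exists>s\<in>X. d s \<noteq> 0" using c(1) by (auto simp: d_def)
    ultimately show ?thesis by blast
  qed
qed

text \<open>The number counted here is the rank of the map from vertex \<open>i\<close> to vertex \<open>j\<close>.\<close>

definition path_rank :: "'i set \<Rightarrow> ('i \<Rightarrow> nat \<times> nat) \<Rightarrow> nat \<Rightarrow> nat \<Rightarrow> nat" where
  "path_rank I iv i j = card {s \<in> I. fst (iv s) \<le> i \<and> j \<le> snd (iv s)}"

text \<open>The path from \<open>i\<close> to \<open>j\<close> has rank \<open>card ?X\<close> on
  the source, and its image on the target is supported on the \<open>card ?Y\<close> intervals of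
  \<open>?Y\<close>. If \<open>?X\<close> were larger, a nontrivial combination of path images would
  be killed by the injective \<open>F\<close>.\<close>

lemma path_rank_le:
  fixes I :: "'i set" and J :: "'j set"
  assumes fin: "finite I" "finite J"
    and iv: "\<And>s. s \<in> I \<Longrightarrow> snd (iv s) < n" and jv: "\<And>s. s \<in> J \<Longrightarrow> snd (jv s) < n"
    and F: "lmod_iso (LT n) (interval_sum I iv :: ('k::field mat, _) module) (interval_sum J jv) F"
    and ij: "i \<le> j" "j < n"
  shows "path_rank I iv i j \<le> path_rank J jv i j"
proof (rule ccontr)
  let ?S = "interval_sum I iv :: ('k mat, _) module" and ?T = "interval_sum J jv :: ('k mat, _) module"
  let ?X = "{s \<in> I. fst (iv s) \<le> i \<and> j \<le> snd (iv s)}"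
  let ?Y = "{s \<in> J. fst (jv s) \<le> i \<and> j \<le> snd (jv s)}"
  have S: "left_module (LT n) ?S" and T: "left_module (LT n) ?T"
    using iv jv by (auto intro!: left_module_interval_sum)
  interpret S: left_module "LT n" ?S by fact
  interpret T: left_module "LT n" ?T by fact
  have hom: "lmod_hom (LT n) ?S ?T F" and inj: "inj_on F (carrier ?S)"
    using F by (auto simp: lmod_iso_def bij_betw_def)
  define e where "e k s = (\<lambda>t l. if t = s \<and> l = k then 1 else 0 :: 'k)" for k :: nat and s :: 'i
  have e: "e k s \<in> carrier ?S" if "s \<in> I" "fst (iv s) \<le> k" "k \<le> snd (iv s)" for k s
    using that by (auto simp: e_def)
  have US: "unit_mat n k l c \<odot>\<^bsub>?S\<^esub> y = (\<lambda>s m. if m = k \<and> k \<le> snd (iv s) then c * y s l else 0)"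
    if "y \<in> carrier ?S" "l \<le> k" for k l c y
    using that(1) iv that(2) by (rule unit_mat_smult_sum)
  have UT: "unit_mat n k l c \<odot>\<^bsub>?T\<^esub> y = (\<lambda>s m. if m = k \<and> k \<le> snd (jv s) then c * y s l else 0)"
    if "y \<in> carrier ?T" "l \<le> k" for k l c y
    using that(1) jv that(2) by (rule unit_mat_smult_sum)
  assume "\<not> ?thesis"
  then have "card ?Y < card ?X" by (simp add: path_rank_def)
  then obtain c where c: "\<exists>s\<in>?X. c s \<noteq> 0"
    "\<forall>t\<in>?Y. (\<Sum>s\<in>?X. c s * F (e j s) t j) = 0"
    using dependent_if_card_less[of ?Y ?X "\<lambda>s t. F (e j s) t j"] fin by auto
  have fX: "finite ?X" using fin by simp
  \<comment> \<open>Each \<open>w s\<close> is both a path image from vertex \<open>i\<close> and a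
    vector at vertex \<open>j\<close>. The first description shows that \<open>F (w s)\<close>
    vanishes on intervals starting after \<open>i\<close>; the second expresses its other
    coordinates through those in the linear dependency.\<close>
  define w where "w = (\<lambda>s. unit_mat n j i (c s) \<odot>\<^bsub>?S\<^esub> e i s)"
  have w_eq: "w s = (\<lambda>t l. if t = s \<and> l = j then c s else 0)"
    and w_eq': "w s = unit_mat n j j (c s) \<odot>\<^bsub>?S\<^esub> e j s" if "s \<in> ?X" for s
  proof -
    have s: "e i s \<in> carrier ?S" "e j s \<in> carrier ?S"
      by (rule e; use that ij in auto)+
    show "w s = (\<lambda>t l. if t = s \<and> l = j then c s else 0)"
      unfolding w_def US[OF s(1) ij(1)] using that
      by (auto simp: e_def fun_eq_iff)
    then show "w s = unit_mat n j j (c s) \<odot>\<^bsub>?S\<^esub> e j s"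
      unfolding US[OF s(2) order_refl] using that
      by (auto simp: e_def fun_eq_iff)
  qed
  have wc: "w s \<in> carrier ?S" if "s \<in> ?X" for s
    unfolding w_eq[OF that] using that ij by auto
  have Fw: "F (w s) = (\<lambda>t l. if l = j \<and> j \<le> snd (jv t) then c s * F (e j s) t j else 0)"
    and Fw': "F (w s) = (\<lambda>t l. if l = j \<and> j \<le> snd (jv t) then c s * F (e i s) t i else 0)"
    if "s \<in> ?X" for s
  proof -
    have s: "e i s \<in> carrier ?S" "e j s \<in> carrier ?S"
      by (rule e; use that ij in auto)+
    have "F (w s) = unit_mat n j j (c s) \<odot>\<^bsub>?T\<^esub> F (e j s)"
      unfolding w_eq'[OF that] using s by (intro lmod_hom_smult[OF hom]) auto
    then show "F (w s) = (\<lambda>t l. if l = j \<and> j \<le> snd (jv t) then c s * F (e j s) t j else 0)"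
      unfolding UT[OF lmod_hom_closed[OF hom s(2)] order_refl] .
    have "F (w s) = unit_mat n j i (c s) \<odot>\<^bsub>?T\<^esub> F (e i s)"
      unfolding w_def using s ij by (intro lmod_hom_smult[OF hom]) auto
    then show "F (w s) = (\<lambda>t l. if l = j \<and> j \<le> snd (jv t) then c s * F (e i s) t i else 0)"
      unfolding UT[OF lmod_hom_closed[OF hom s(1)] ij(1)] .
  qed
  have "(\<Sum>s\<in>?X. F (w s) t l) = 0" for t l
  proof (cases "l = j \<and> t \<in> ?Y")
    case True
    then have "(\<Sum>s\<in>?X. F (w s) t l) = (\<Sum>s\<in>?X. c s * F (e j s) t j)"
      using Fw by (intro sum.cong) auto
    then show ?thesis using c(2) True by simp
  next
    case False
    have "F (w s) t l = 0" if s: "s \<in> ?X" for s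
    proof -
      have "F (e i s) \<in> carrier ?T" using s ij by (intro lmod_hom_closed[OF hom] e) auto
      then have "t \<in> J \<and> fst (jv t) \<le> i" if "F (e i s) t i \<noteq> 0" using that by auto
      then show ?thesis unfolding Fw'[OF s] using False by auto
    qed
    then show ?thesis by simp
  qed
  then have "(\<lambda>t l. \<Sum>s\<in>?X. F (w s) t l) = \<zero>\<^bsub>?T\<^esub>" by simp
  moreover have "finsum ?T (\<lambda>s. F (w s)) ?X = (\<lambda>t l. \<Sum>s\<in>?X. F (w s) t l)"
    using wc lmod_hom_closed[OF hom] by (intro interval_sum_finsum[OF jv fX]) blast+
  moreover have "F (finsum ?S w ?X) = finsum ?T (\<lambda>s. F (w s)) ?X"
    using wc by (intro lmod_hom_finsum[OF S T hom fX]) blast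
  ultimately have "F (finsum ?S w ?X) = F \<zero>\<^bsub>?S\<^esub>"
    using lmod_hom_zero[OF S T hom] by simp
  moreover have "finsum ?S w ?X \<in> carrier ?S" using wc by (intro S.M.finsum_closed) blast
  ultimately have "finsum ?S w ?X = \<zero>\<^bsub>?S\<^esub>"
    using inj S.M.zero_closed unfolding inj_on_def by blast
  moreover have "finsum ?S w ?X = (\<lambda>t l. \<Sum>s\<in>?X. w s t l)"
    using wc by (intro interval_sum_finsum[OF iv fX]) blast+
  ultimately have *: "(\<Sum>s\<in>?X. w s t j) = 0" for t by (auto simp: fun_eq_iff)
  have "c t = 0" if t: "t \<in> ?X" for t
  proof -
    have "(\<Sum>s\<in>?X. w s t j) = (\<Sum>s\<in>?X. if s = t then c t else 0)"
      using w_eq by (intro sum.cong) auto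
    also have "\<dots> = c t" using t fX by simp
    finally show ?thesis using * by simp
  qed
  then show False using c(1) by blast
qed

lemma path_rank_eq:
  fixes I :: "'i set" and J :: "'j set"
  assumes fin: "finite I" "finite J"
    and iv: "\<And>s. s \<in> I \<Longrightarrow> snd (iv s) < n" and jv: "\<And>s. s \<in> J \<Longrightarrow> snd (jv s) < n"
    and iso: "isomorphic (LT n) (interval_sum I iv :: ('k::field mat, _) module) (interval_sum J jv)"
    and ij: "i \<le> j" "j < n"
  shows "path_rank I iv i j = path_rank J jv i j"
proof -
  have S: "left_module (LT n) (interval_sum I iv :: ('k mat, _) module)"
    by (rule left_module_interval_sum[OF iv])
  obtain F where F: "lmod_iso (LT n) (interval_sum I iv :: ('k mat, _) module) (interval_sum J jv) F"
    using iso isomorphic_iff[OF S] by blast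
  show ?thesis
    using path_rank_le[OF fin iv jv F ij] path_rank_le[OF fin(2,1) jv iv lmod_iso_sym[OF S F] ij]
    by (rule antisym)
qed

text \<open>Among the intervals through \<open>i\<close>, those that start earlier are exactly the
  ones that also contain \<open>i - 1\<close>. The case \<open>i = 0\<close> stands apart because
  there \<open>i - 1\<close> is again \<open>0\<close> and the difference would always be
  zero.\<close>

lemma card_fst_eq_path_rank:
  assumes "finite I" "\<And>s. s \<in> I \<Longrightarrow> fst (iv s) \<le> snd (iv s)"
  shows "card {s \<in> I. fst (iv s) = i} =
    path_rank I iv i i - (if i = 0 then 0 else path_rank I iv (i - 1) i)"
proof (cases "i = 0")
  case True
  then show ?thesis by (simp add: path_rank_def)
next
  case False
  have "{s \<in> I. fst (iv s) = i}
    = {s \<in> I. fst (iv s) \<le> i \<and> i \<le> snd (iv s)} - {s \<in> I. fst (iv s) \<le> i - 1 \<and> i \<le> snd (iv s)}"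
    using assms(2) False by fastforce
  moreover have "{s \<in> I. fst (iv s) \<le> i - 1 \<and> i \<le> snd (iv s)} \<subseteq> {s \<in> I. fst (iv s) \<le> i \<and> i \<le> snd (iv s)}"
    by auto
  ultimately show ?thesis using False assms(1) by (simp add: path_rank_def card_Diff_subset)
qed

text \<open>Inclusion-exclusion recovers a set of intervals from its ranks.\<close>

lemma mem_iff_path_rank:
  assumes S: "finite S" "S \<subseteq> {(i, j). i \<le> j \<and> j < n}" and ab: "a \<le> b" "b < n"
  shows "of_bool ((a, b) \<in> S) = int (path_rank S id a b) - (if a = 0 then 0 else int (path_rank S id (a - 1) b))
    - (if b = n - 1 then 0 else int (path_rank S id a (b + 1)))
    + (if a = 0 \<or> b = n - 1 then 0 else int (path_rank S id (a - 1) (b + 1)))"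
proof -
  have *: "int (path_rank S id i j) = (\<Sum>s\<in>S. of_bool (fst s \<le> i \<and> j \<le> snd s))" for i j
    using S(1) by (simp add: path_rank_def of_bool_def sum.inter_filter[symmetric])
  have "of_bool ((a, b) \<in> S) = (\<Sum>s\<in>S. if s = (a, b) then 1 else (0::int))"
    using S(1) by simp
  also have "\<dots> = (\<Sum>s\<in>S. of_bool (fst s \<le> a \<and> b \<le> snd s)
      - (if a = 0 then 0 else of_bool (fst s \<le> a - 1 \<and> b \<le> snd s))
      - (if b = n - 1 then 0 else of_bool (fst s \<le> a \<and> b + 1 \<le> snd s))
      + (if a = 0 \<or> b = n - 1 then 0 else of_bool (fst s \<le> a - 1 \<and> b + 1 \<le> snd s)))"
  proof (rule sum.cong[OF refl])
    fix s assume "s \<in> S"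
    then obtain i j where s: "s = (i, j)" "i \<le> j" "j < n" using S(2) by auto
    show "(if s = (a, b) then 1 else (0::int)) = of_bool (fst s \<le> a \<and> b \<le> snd s)
      - (if a = 0 then 0 else of_bool (fst s \<le> a - 1 \<and> b \<le> snd s))
      - (if b = n - 1 then 0 else of_bool (fst s \<le> a \<and> b + 1 \<le> snd s))
      + (if a = 0 \<or> b = n - 1 then 0 else of_bool (fst s \<le> a - 1 \<and> b + 1 \<le> snd s))"
    proof -
      \<comment> \<open>The indicator of one end point is a difference of two threshold indicators;
        multiplying the differences for both ends gives the four terms. At the borders a term is
        absent because its threshold cannot be met.\<close>
      have "of_bool (i = a) = of_bool (i \<le> a) - (if a = 0 then 0 else of_bool (i \<le> a - 1) :: int)"
        by (cases "a = 0") (auto simp: of_bool_def)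
      moreover have "of_bool (j = b) = of_bool (b \<le> j) - (if b = n - 1 then 0 else of_bool (b + 1 \<le> j) :: int)"
        using s ab by (cases "b = n - 1") (auto simp: of_bool_def)
      moreover have "(if s = (a, b) then 1 else (0::int)) = of_bool (i = a) * of_bool (j = b)"
        using s by simp
      ultimately show ?thesis
        using s by (cases "a = 0"; cases "b = n - 1") (simp_all only: fst_conv snd_conv of_bool_conj if_True if_False disj_not1 simp_thms, simp_all add: algebra_simps)
    qed
  qed
  also have "\<dots> = (\<Sum>s\<in>S. of_bool (fst s \<le> a \<and> b \<le> snd s))
      - (if a = 0 then 0 else (\<Sum>s\<in>S. of_bool (fst s \<le> a - 1 \<and> b \<le> snd s)))
      - (if b = n - 1 then 0 else (\<Sum>s\<in>S. of_bool (fst s \<le> a \<and> b + 1 \<le> snd s)))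
      + (if a = 0 \<or> b = n - 1 then 0 else (\<Sum>s\<in>S. of_bool (fst s \<le> a - 1 \<and> b + 1 \<le> snd s)))"
    by (simp only: sum.distrib sum_subtractf) (auto simp del: of_bool_conj)
  finally show ?thesis unfolding * .
qed

lemma intervals_unique:
  assumes S: "finite S" "S \<subseteq> {(i, j). i \<le> j \<and> j < n}" and T: "finite T" "T \<subseteq> {(i, j). i \<le> j \<and> j < n}"
    and iso: "isomorphic (LT n) (interval_sum S id :: ('k::field mat, _) module) (interval_sum T id)"
  shows "S = T"
proof -
  have rank: "path_rank S id i j = path_rank T id i j" if "i \<le> j" "j < n" for i j
    using S(2) T(2) by (intro path_rank_eq[OF S(1) T(1) _ _ iso that]) auto
  have mem: "(a, b) \<in> S \<longleftrightarrow> (a, b) \<in> T" if ab: "a \<le> b" "b < n" for a b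
  proof -
    have "of_bool ((a, b) \<in> S) = (of_bool ((a, b) \<in> T) :: int)"
      unfolding mem_iff_path_rank[OF S ab] mem_iff_path_rank[OF T ab]
      using ab by (auto simp: rank)
    then show ?thesis by (simp add: of_bool_eq_iff)
  qed
  show ?thesis using mem S(2) T(2) by auto
qed


subsection \<open>Tops\<close>

lemma interval_module_generated:
  assumes ij: "i \<le> j" "j < n" and v: "v \<in> carrier (interval_module i j)" "v i \<noteq> 0"
    and w: "w \<in> carrier (interval_module i j)"
  shows "\<exists>A\<in>carrier (LT n). A \<odot>\<^bsub>interval_module i j\<^esub> v = (w :: nat \<Rightarrow> 'k::field)"
proof -
  \<comment> \<open>Only column \<open>i\<close> is filled, so the other components of
    \<open>v\<close> do not interfere.\<close>
  define A where "A = mat n n (\<lambda>(r, c). if c = i \<and> i \<le> r then w r / v i else 0)"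
  have "A \<in> carrier (LT n)" by (auto simp: A_def LT_carrier_iff)
  moreover have "A \<odot>\<^bsub>interval_module i j\<^esub> v = w"
  proof
    fix k
    show "(A \<odot>\<^bsub>interval_module i j\<^esub> v) k = w k"
    proof (cases "i \<le> k \<and> k \<le> j")
      case True
      then have "(\<Sum>l=i..j. A $$ (k, l) * v l) = (\<Sum>l=i..j. if l = i then w k else 0)"
        using ij v(2) by (intro sum.cong) (auto simp: A_def)
      then show ?thesis using True ij by simp
    next
      case False
      then show ?thesis using w by auto
    qed
  qed
  ultimately show ?thesis by blast
qed

lemma simple_module_simps [simp]:
  "carrier (simple_module i) = UNIV" "x \<oplus>\<^bsub>simple_module i\<^esub> y = x + y"
  "A \<odot>\<^bsub>simple_module i\<^esub> x = A $$ (i - 1, i - 1) * x" "\<zero>\<^bsub>simple_module i\<^esub> = 0"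
  by (simp_all add: simple_module_def)

text \<open>Cosets of a kernel are fibres of the map, hence the operations of the quotient can be
  computed on representatives. A scalar multiple of a fibre may be smaller than a fibre; adding
  \<open>K\<close> fills it up.\<close>

lemma quotient_module_fibres:
  assumes M: "left_module R M" and S: "left_module R S" and \<pi>: "lmod_hom R M S \<pi>"
  defines "fib \<equiv> \<lambda>x. {y \<in> carrier M. \<pi> y = \<pi> x}"
  defines "K \<equiv> {y \<in> carrier M. \<pi> y = \<zero>\<^bsub>S\<^esub>}"
  shows "carrier (quotient_module M K) = fib ` carrier M"
    and "x \<in> carrier M \<Longrightarrow> y \<in> carrier M \<Longrightarrow>
      fib x \<oplus>\<^bsub>quotient_module M K\<^esub> fib y = fib (x \<oplus>\<^bsub>M\<^esub> y)"
    and "a \<in> carrier R \<Longrightarrow> x \<in> carrier M \<Longrightarrow> a \<odot>\<^bsub>quotient_module M K\<^esub> fib x = fib (a \<odot>\<^bsub>M\<^esub> x)"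
proof -
  interpret M: left_module R M by fact
  interpret S: left_module R S by fact
  note hom = lmod_hom_closed[OF \<pi>] lmod_hom_add[OF \<pi>] lmod_hom_smult[OF \<pi>]
  have minus: "\<pi> (\<ominus>\<^bsub>M\<^esub> x) = \<ominus>\<^bsub>S\<^esub> \<pi> x" if "x \<in> carrier M" for x
  proof -
    have "\<pi> (\<ominus>\<^bsub>M\<^esub> x) \<oplus>\<^bsub>S\<^esub> \<pi> x = \<zero>\<^bsub>S\<^esub>"
      using that hom(2)[of "\<ominus>\<^bsub>M\<^esub> x" x] lmod_hom_zero[OF M S \<pi>] by (simp add: M.M.l_neg)
    then show ?thesis using that hom(1) by (metis M.M.a_inv_closed S.M.minus_equality)
  qed
  have split: "z = (z \<oplus>\<^bsub>M\<^esub> \<ominus>\<^bsub>M\<^esub> x) \<oplus>\<^bsub>M\<^esub> x" if "x \<in> carrier M" "z \<in> carrier M" for x z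
    using that by (simp add: M.M.a_assoc M.M.l_neg)
  have diff: "\<pi> (z \<oplus>\<^bsub>M\<^esub> \<ominus>\<^bsub>M\<^esub> x) = c"
    if "x \<in> carrier M" "z \<in> carrier M" "c \<in> carrier S" "\<pi> z = c \<oplus>\<^bsub>S\<^esub> \<pi> x" for x z c
    using that hom by (simp add: minus S.M.a_assoc S.M.r_neg)
  have set_addI: "z \<in> A <+>\<^bsub>M\<^esub> B" if "z = u \<oplus>\<^bsub>M\<^esub> v" "u \<in> A" "v \<in> B" for z u v A B
    using that by (auto simp: set_add_def')
  have coset: "K +>\<^bsub>M\<^esub> x = fib x" if x: "x \<in> carrier M" for x
  proof
    show "K +>\<^bsub>M\<^esub> x \<subseteq> fib x"
      using x hom by (auto simp: a_r_coset_def r_coset_def K_def fib_def)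
    show "fib x \<subseteq> K +>\<^bsub>M\<^esub> x"
    proof
      fix z assume z: "z \<in> fib x"
      then have "z \<oplus>\<^bsub>M\<^esub> \<ominus>\<^bsub>M\<^esub> x \<in> K"
        using x hom diff[of x z "\<zero>\<^bsub>S\<^esub>"] by (auto simp: K_def fib_def)
      then show "z \<in> K +>\<^bsub>M\<^esub> x"
        using split[of x z] x z by (auto simp: a_r_coset_def r_coset_def fib_def)
    qed
  qed
  show "carrier (quotient_module M K) = fib ` carrier M"
    using coset by (auto simp: quotient_module_def A_RCOSETS_def RCOSETS_def a_r_coset_def)
  show "fib x \<oplus>\<^bsub>quotient_module M K\<^esub> fib y = fib (x \<oplus>\<^bsub>M\<^esub> y)"
    if x: "x \<in> carrier M" and y: "y \<in> carrier M"
  proof -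
    have "fib x <+>\<^bsub>M\<^esub> fib y = fib (x \<oplus>\<^bsub>M\<^esub> y)"
    proof
      show "fib x <+>\<^bsub>M\<^esub> fib y \<subseteq> fib (x \<oplus>\<^bsub>M\<^esub> y)"
        using x y hom by (auto simp: set_add_def' fib_def)
      show "fib (x \<oplus>\<^bsub>M\<^esub> y) \<subseteq> fib x <+>\<^bsub>M\<^esub> fib y"
      proof
        fix z assume z: "z \<in> fib (x \<oplus>\<^bsub>M\<^esub> y)"
        then have "z \<oplus>\<^bsub>M\<^esub> \<ominus>\<^bsub>M\<^esub> y \<in> fib x"
          using x y hom diff[of y z "\<pi> x"] by (auto simp: fib_def)
        moreover have "y \<in> fib y" using y by (simp add: fib_def)
        ultimately show "z \<in> fib x <+>\<^bsub>M\<^esub> fib y"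
          using split[of y z] y z by (intro set_addI[of z "z \<oplus>\<^bsub>M\<^esub> \<ominus>\<^bsub>M\<^esub> y" y]) (auto simp: fib_def)
      qed
    qed
    then show ?thesis by (simp add: quotient_module_def)
  qed
  show "a \<odot>\<^bsub>quotient_module M K\<^esub> fib x = fib (a \<odot>\<^bsub>M\<^esub> x)"
    if a: "a \<in> carrier R" and x: "x \<in> carrier M"
  proof -
    have ax: "a \<odot>\<^bsub>M\<^esub> x \<in> carrier M" using a x by (rule M.smult_closed)
    have "K <+>\<^bsub>M\<^esub> ((\<lambda>x. a \<odot>\<^bsub>M\<^esub> x) ` fib x) = fib (a \<odot>\<^bsub>M\<^esub> x)"
    proof
      show "K <+>\<^bsub>M\<^esub> ((\<lambda>x. a \<odot>\<^bsub>M\<^esub> x) ` fib x) \<subseteq> fib (a \<odot>\<^bsub>M\<^esub> x)"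
        using a x hom M.smult_closed by (auto simp: set_add_def' fib_def K_def S.smult_closed)
      show "fib (a \<odot>\<^bsub>M\<^esub> x) \<subseteq> K <+>\<^bsub>M\<^esub> ((\<lambda>x. a \<odot>\<^bsub>M\<^esub> x) ` fib x)"
      proof
        fix z assume z: "z \<in> fib (a \<odot>\<^bsub>M\<^esub> x)"
        then have "z \<oplus>\<^bsub>M\<^esub> \<ominus>\<^bsub>M\<^esub> (a \<odot>\<^bsub>M\<^esub> x) \<in> K"
          using ax hom(1) diff[of "a \<odot>\<^bsub>M\<^esub> x" z "\<zero>\<^bsub>S\<^esub>"] by (auto simp: fib_def K_def)
        moreover have "a \<odot>\<^bsub>M\<^esub> x \<in> (\<lambda>x. a \<odot>\<^bsub>M\<^esub> x) ` fib x" using x by (auto simp: fib_def)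
        ultimately show "z \<in> K <+>\<^bsub>M\<^esub> ((\<lambda>x. a \<odot>\<^bsub>M\<^esub> x) ` fib x)"
          using split[OF ax, of z] z by (intro set_addI[of z "z \<oplus>\<^bsub>M\<^esub> \<ominus>\<^bsub>M\<^esub> (a \<odot>\<^bsub>M\<^esub> x)" "a \<odot>\<^bsub>M\<^esub> x"])
            (auto simp: fib_def)
      qed
    qed
    then show ?thesis by (simp add: quotient_module_def)
  qed
qed

text \<open>A vector with nonzero component at \<open>i\<close> generates everything, so the kernel
  of that component is the only maximal submodule and hence the radical. The quotient is one copy of
  \<open>K\<close> on which a matrix acts by its diagonal entry at \<open>i\<close>.\<close>

lemma top_of_interval:
  fixes N :: "('k::field mat, 'a) module"
  assumes N: "left_module (LT n) N" and ij: "i \<le> j" "j < n"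
    and iso: "isomorphic (LT n) (interval_module i j) N" and i': "i' < n"
  shows "isomorphic (LT n) (top_of (LT n) N) (simple_module (Suc i')) \<longleftrightarrow> i = i'"
proof -
  interpret left_module "LT n" N by fact
  let ?I = "interval_module i j :: ('k mat, _) module"
  let ?S = "simple_module (Suc i) :: ('k mat, 'k) module"
  have I: "left_module (LT n) ?I" by (rule left_module_interval_module[OF ij(2)])
  have S: "left_module (LT n) ?S" using ij by (intro left_module_simple_module) auto
  obtain \<psi> where \<psi>: "lmod_iso (LT n) ?I N \<psi>" using iso isomorphic_iff[OF I] by blast
  then have hom: "lmod_hom (LT n) ?I N \<psi>" and bij: "bij_betw \<psi> (carrier ?I) (carrier N)"
    by (auto simp: lmod_iso_def)
  define \<chi> where "\<chi> = the_inv_into (carrier ?I) \<psi>"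
  have \<chi>: "lmod_hom (LT n) N ?I \<chi>"
    using lmod_iso_sym[OF I \<psi>] by (simp add: lmod_iso_def \<chi>_def)
  have \<chi>\<psi>: "\<chi> (\<psi> v) = v" if "v \<in> carrier ?I" for v
    using bij that by (simp only: \<chi>_def the_inv_into_f_f bij_betw_def)
  have \<psi>\<chi>: "\<psi> (\<chi> x) = x" if "x \<in> carrier N" for x
    using bij that by (simp only: \<chi>_def f_the_inv_into_f_bij_betw)
  define \<pi> where "\<pi> x = \<chi> x i" for x
  have \<pi>: "lmod_hom (LT n) N ?S \<pi>"
  proof (rule lmod_homI)
    show "\<pi> (x \<oplus>\<^bsub>N\<^esub> y) = \<pi> x \<oplus>\<^bsub>?S\<^esub> \<pi> y" if "x \<in> carrier N" "y \<in> carrier N" for x y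
      using lmod_hom_add[OF \<chi> that] by (simp add: \<pi>_def)
    show "\<pi> (A \<odot>\<^bsub>N\<^esub> x) = A \<odot>\<^bsub>?S\<^esub> \<pi> x" if A: "A \<in> carrier (LT n)" and x: "x \<in> carrier N" for A x
    proof -
      have "(\<Sum>l=i..j. A $$ (i, l) * \<chi> x l) = (\<Sum>l=i..j. if l = i then A $$ (i, i) * \<chi> x i else 0)"
        using LT_index_0[OF A] ij by (intro sum.cong) auto
      then show ?thesis using lmod_hom_smult[OF \<chi> A x] ij by (simp add: \<pi>_def)
    qed
  qed simp
  have unit: "std_vec i \<in> carrier ?I" using ij by (auto simp: std_vec_def)
  have surj: "\<exists>x\<in>carrier N. \<pi> x = c" for c
  proof -
    have "(\<lambda>k. c * std_vec i k) \<in> carrier ?I" using ij by (auto simp: std_vec_def)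
    then show ?thesis
      using lmod_hom_closed[OF hom] by (intro bexI[of _ "\<psi> (\<lambda>k. c * std_vec i k)"])
        (simp_all only: \<pi>_def \<chi>\<psi>, simp add: std_vec_def)
  qed
  let ?K = "{x \<in> carrier N. \<pi> x = \<zero>\<^bsub>?S\<^esub>}"
  have K: "submodule ?K (LT n) N"
    by (rule submoduleI)
      (use lmod_hom_zero[OF N S \<pi>] lmod_hom_add[OF \<pi>] lmod_hom_smult[OF \<pi>] smult_closed in auto)
  have K_ne: "?K \<noteq> carrier N"
  proof -
    obtain x where "x \<in> carrier N" "\<pi> x = 1" using surj by blast
    then have "x \<notin> ?K" by simp
    then show ?thesis using \<open>x \<in> carrier N\<close> by blast
  qed
  have all: "L = carrier N" if L: "submodule L (LT n) N" and x: "x \<in> L" "x \<notin> ?K" for L x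
  proof
    show "L \<subseteq> carrier N" using submodule_subset[OF L] .
    then have xN: "x \<in> carrier N" using x by blast
    show "carrier N \<subseteq> L"
    proof
      fix y assume y: "y \<in> carrier N"
      have "\<chi> x i \<noteq> 0" using x xN by (simp add: \<pi>_def)
      then obtain A where A: "A \<in> carrier (LT n)" "A \<odot>\<^bsub>?I\<^esub> \<chi> x = \<chi> y"
        using interval_module_generated[OF ij lmod_hom_closed[OF \<chi> xN] _ lmod_hom_closed[OF \<chi> y]] by blast
      have "\<chi> (A \<odot>\<^bsub>N\<^esub> x) = \<chi> y" using lmod_hom_smult[OF \<chi> A(1) xN] A(2) by simp
      then have "\<psi> (\<chi> (A \<odot>\<^bsub>N\<^esub> x)) = \<psi> (\<chi> y)" by simp
      then have "A \<odot>\<^bsub>N\<^esub> x = y" using \<psi>\<chi> xN y A(1) smult_closed by simp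
      then show "y \<in> L" using submodule_smult[OF L A(1) x(1)] by simp
    qed
  qed
  have "maximal_submodule L (LT n) N \<longleftrightarrow> L = ?K" for L
  proof
    assume L: "maximal_submodule L (LT n) N"
    then have Ls: "submodule L (LT n) N" "L \<noteq> carrier N" by (auto simp: maximal_submodule_def)
    then have "L \<subseteq> ?K" using all by blast
    then show "L = ?K" using L K K_ne unfolding maximal_submodule_def by blast
  next
    assume "L = ?K"
    then show "maximal_submodule L (LT n) N"
      using K K_ne all unfolding maximal_submodule_def by blast
  qed
  then have "{L. maximal_submodule L (LT n) N} = {?K}" by blast
  then have "radical (LT n) N = ?K" unfolding radical_def by auto
  then have top: "top_of (LT n) N = quotient_module N ?K" by (simp add: top_of_def)
  let ?Q = "quotient_module N ?K"
  define fib where "fib x = {y \<in> carrier N. \<pi> y = \<pi> x}" for x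
  note fibres = quotient_module_fibres[OF N S \<pi>, folded fib_def]
  define g where "g X = the_elem (\<pi> ` X)" for X
  have g: "g (fib x) = \<pi> x" if "x \<in> carrier N" for x
  proof -
    have "\<pi> ` fib x = {\<pi> x}" using that by (auto simp: fib_def)
    then show ?thesis by (simp add: g_def)
  qed
  define h where "h = restrict g (carrier ?Q)"
  have hfib: "h (fib x) = \<pi> x" if "x \<in> carrier N" for x
    using that fibres(1) by (simp add: h_def g)
  have h: "h \<in> linear_maps (LT n) ?Q ?S"
    unfolding linear_maps_def
  proof (intro CollectI conjI ballI)
    show "h \<in> carrier ?Q \<rightarrow>\<^sub>E carrier ?S" by (auto simp: h_def)
    fix X assume "X \<in> carrier ?Q"
    then obtain x where x: "x \<in> carrier N" "X = fib x" using fibres(1) by blast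
    show "h (X \<oplus>\<^bsub>?Q\<^esub> Y) = h X \<oplus>\<^bsub>?S\<^esub> h Y" if "Y \<in> carrier ?Q" for Y
    proof -
      obtain y where y: "y \<in> carrier N" "Y = fib y" using fibres(1) \<open>Y \<in> carrier ?Q\<close> by blast
      have "h (X \<oplus>\<^bsub>?Q\<^esub> Y) = \<pi> (x \<oplus>\<^bsub>N\<^esub> y)"
        unfolding x(2) y(2) fibres(2)[OF x(1) y(1)] using x y by (simp add: hfib)
      then show ?thesis using x y lmod_hom_add[OF \<pi>] by (simp add: hfib)
    qed
    show "h (A \<odot>\<^bsub>?Q\<^esub> X) = A \<odot>\<^bsub>?S\<^esub> h X" if A: "A \<in> carrier (LT n)" for A
    proof -
      have "h (A \<odot>\<^bsub>?Q\<^esub> X) = \<pi> (A \<odot>\<^bsub>N\<^esub> x)"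
        unfolding x(2) fibres(3)[OF A x(1)] using x A by (simp add: hfib smult_closed)
      then show ?thesis using x A lmod_hom_smult[OF \<pi>] by (simp add: hfib)
    qed
  qed
  have "bij_betw h (carrier ?Q) (carrier ?S)"
    unfolding bij_betw_def
  proof
    show "inj_on h (carrier ?Q)"
      unfolding fibres(1)
    proof (rule inj_onI, elim imageE)
      fix X Y x y assume *: "h X = h Y" "X = fib x" "x \<in> carrier N" "Y = fib y" "y \<in> carrier N"
      then have "\<pi> x = \<pi> y" by (simp add: hfib)
      then show "X = Y" using * by (simp add: fib_def)
    qed
    show "h ` carrier ?Q = carrier ?S"
    proof
      show "carrier ?S \<subseteq> h ` carrier ?Q"
      proof
        fix c :: 'k
        obtain x where "x \<in> carrier N" "\<pi> x = c" using surj by blast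
        then show "c \<in> h ` carrier ?Q" unfolding fibres(1) by (intro image_eqI[of _ _ "fib x"]) (auto simp: hfib)
      qed
    qed simp
  qed
  then have iso_S: "isomorphic (LT n) ?Q ?S" using h unfolding isomorphic_def by blast
  \<comment> \<open>The idempotent of vertex \<open>i\<close> is the identity on the top but zero on
    the simple module of any other vertex.\<close>
  have "i = i'" if iso': "isomorphic (LT n) ?Q (simple_module (Suc i') :: ('k mat, 'k) module)"
  proof (rule ccontr)
    assume ne: "i \<noteq> i'"
    obtain f where f: "f \<in> linear_maps (LT n) ?Q (simple_module (Suc i') :: ('k mat, 'k) module)"
      "bij_betw f (carrier ?Q) (carrier (simple_module (Suc i') :: ('k mat, 'k) module))"
      using iso' unfolding isomorphic_def by blast
    let ?E = "unit_mat n i i 1 :: 'k mat"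
    have E: "?E \<in> carrier (LT n)" by simp
    have "f (fib x) = 0" if x: "x \<in> carrier N" for x
    proof -
      have "\<pi> (?E \<odot>\<^bsub>N\<^esub> x) = \<pi> x" using lmod_hom_smult[OF \<pi> E x] ij by simp
      then have "?E \<odot>\<^bsub>?Q\<^esub> fib x = fib x" unfolding fibres(3)[OF E x] by (simp add: fib_def)
      moreover have "f (?E \<odot>\<^bsub>?Q\<^esub> fib x) = ?E $$ (i', i') * f (fib x)"
        using f(1) E x fibres(1) unfolding linear_maps_def by auto
      ultimately show ?thesis using ne i' by simp
    qed
    moreover have "1 \<in> f ` carrier ?Q" using f(2) by (auto simp: bij_betw_def)
    ultimately show False unfolding fibres(1) by auto
  qed
  then show ?thesis using iso_S unfolding top by blast
qed

text \<open>Under an injective homomorphism the path from the start to the end of the source stays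
  nonzero, so the target contains both of these vertices. This is applied in both
  directions.\<close>

lemma interval_module_isomorphic_unique:
  assumes ij: "i \<le> j" "j < n" and ij': "i' \<le> j'" "j' < n"
    and iso: "isomorphic (LT n) (interval_module i j :: ('k::field mat, _) module) (interval_module i' j')"
  shows "i = i' \<and> j = j'"
proof -
  have le: "c \<le> a \<and> b \<le> d" if ab: "a \<le> b" "b < n" and cd: "d < n"
    and iso: "isomorphic (LT n) (interval_module a b :: ('k mat, _) module) (interval_module c d)" for a b c d
  proof -
    let ?I = "interval_module a b :: ('k mat, _) module" and ?J = "interval_module c d :: ('k mat, _) module"
    have I: "left_module (LT n) ?I" and J: "left_module (LT n) ?J"
      by (rule left_module_interval_module; fact)+
    obtain F where F: "lmod_hom (LT n) ?I ?J F" "inj_on F (carrier ?I)"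
      using iso isomorphic_iff[OF I, of ?J] unfolding lmod_iso_def bij_betw_def by blast
    have e: "std_vec a \<in> carrier ?I" "std_vec b \<in> carrier ?I" using ab by (auto simp: std_vec_def)
    have "unit_mat n b a 1 \<odot>\<^bsub>?I\<^esub> std_vec a = std_vec b"
      unfolding unit_mat_smult_interval[OF e(1) ab(2,1)] by (auto simp: std_vec_def)
    then have "F (std_vec b) = unit_mat n b a 1 \<odot>\<^bsub>?J\<^esub> F (std_vec a)"
      using lmod_hom_smult[OF F(1) _ e(1), of "unit_mat n b a 1"] ab by simp
    also have "\<dots> = (\<lambda>m. if m = b \<and> b \<le> d then 1 * F (std_vec a) a else 0)"
      by (rule unit_mat_smult_interval[OF lmod_hom_closed[OF F(1) e(1)] cd ab(1)])
    finally have eq: "F (std_vec b) = \<dots>" .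
    have "F (std_vec b) \<noteq> F \<zero>\<^bsub>?I\<^esub>"
    proof
      assume "F (std_vec b) = F \<zero>\<^bsub>?I\<^esub>"
      then have "std_vec b = (\<lambda>_. 0 :: 'k)" using F(2) e(2) by (auto simp: inj_on_def)
      then show False by (auto simp: std_vec_def dest: fun_cong[of _ _ b])
    qed
    then have "F (std_vec b) \<noteq> (\<lambda>_. 0)" using lmod_hom_zero[OF I J F(1)] by simp
    then have "b \<le> d" "F (std_vec a) a \<noteq> 0" unfolding eq by (auto simp: fun_eq_iff split: if_splits)
    then show ?thesis using lmod_hom_closed[OF F(1) e(1)] by auto
  qed
  have "isomorphic (LT n) (interval_module i' j' :: ('k mat, _) module) (interval_module i j)"
    using isomorphic_sym[OF left_module_interval_module left_module_interval_module iso] ij ij' by blast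
  then show ?thesis using le[OF ij ij'(2) iso] le[OF ij' ij(2)] by force
qed


section \<open>Counting sets of intervals\<close>

definition balanced_set :: "nat \<Rightarrow> (nat \<times> nat) set \<Rightarrow> bool" where
  "balanced_set n S \<longleftrightarrow>
     S \<subseteq> {(i, j). i \<le> j \<and> j < n} \<and> (0, n - 1) \<in> S \<and>
     (\<forall>i j. (i, j) \<in> S \<longrightarrow> (i, j) = (0, n - 1) \<or> (\<exists>c<i. (c, j) \<in> S) \<or> (\<exists>d>j. (i, d) \<in> S)) \<and>
     (\<forall>l. 0 < l \<and> l < n \<longrightarrow> (\<exists>d. (l, d) \<in> S) \<or> (\<exists>c. (c, l - 1) \<in> S))"

text \<open>
  The columns are built from right to left; \<open>R\<close> is the set of rows which already
  contain an interval in one of the columns \<open>\<ge> b\<close>.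
\<close>

definition extendable :: "nat \<Rightarrow> nat set \<Rightarrow> (nat \<times> nat) set \<Rightarrow> bool" where
  "extendable b R S \<longleftrightarrow>
     S \<subseteq> {(i, j). i \<le> j \<and> j < b} \<and>
     (\<forall>i j. (i, j) \<in> S \<longrightarrow> (\<exists>c<i. (c, j) \<in> S) \<or> (\<exists>d>j. (i, d) \<in> S) \<or> i \<in> R) \<and>
     (\<forall>j<b. (\<exists>c. (c, j) \<in> S) \<or> (\<exists>d. (Suc j, d) \<in> S) \<or> Suc j \<in> R)"

text \<open>Counting row \<open>0\<close> as occupied replaces the special role of the full
  interval. Nothing starts at \<open>n\<close>, so the last condition makes column
  \<open>n - 1\<close> nonempty; its least row has nothing earlier and nothing further right, so it
  is row \<open>0\<close>.\<close>

lemma balanced_set_iff_extendable: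
  assumes "1 \<le> n"
  shows "balanced_set n S \<longleftrightarrow> extendable n {0} S"
proof
  assume S: "balanced_set n S"
  have 1: "(\<exists>c<i. (c, j) \<in> S) \<or> (\<exists>d>j. (i, d) \<in> S) \<or> i \<in> {0}" if "(i, j) \<in> S" for i j
  proof -
    have "(i, j) = (0, n - 1) \<or> (\<exists>c<i. (c, j) \<in> S) \<or> (\<exists>d>j. (i, d) \<in> S)"
      using S that unfolding balanced_set_def by blast
    then show ?thesis by blast
  qed
  have 2: "(\<exists>c. (c, j) \<in> S) \<or> (\<exists>d. (Suc j, d) \<in> S)" if "j < n" for j
  proof (cases "Suc j < n")
    case True
    then have "(\<exists>d. (Suc j, d) \<in> S) \<or> (\<exists>c. (c, Suc j - 1) \<in> S)"
      using S unfolding balanced_set_def by blast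
    then show ?thesis by auto
  next
    case False
    then have "j = n - 1" using that by simp
    then show ?thesis using S unfolding balanced_set_def by blast
  qed
  show "extendable n {0} S"
    using S 1 2 unfolding extendable_def balanced_set_def by blast
next
  assume S: "extendable n {0} S"
  have sub: "i \<le> j \<and> j < n" if "(i, j) \<in> S" for i j using S that unfolding extendable_def by auto
  have ext: "(\<exists>c<i. (c, j) \<in> S) \<or> (\<exists>d>j. (i, d) \<in> S) \<or> i = 0" if "(i, j) \<in> S" for i j
    using S that unfolding extendable_def by blast
  have "\<exists>c. (c, n - 1) \<in> S"
  proof -
    have "n - 1 < n" using assms by simp
    then have "(\<exists>c. (c, n - 1) \<in> S) \<or> (\<exists>d. (Suc (n - 1), d) \<in> S)"
      using S unfolding extendable_def by blast
    then show ?thesis using sub[of "Suc (n - 1)"] by fastforce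
  qed
  define c where "c = (LEAST c. (c, n - 1) \<in> S)"
  have c: "(c, n - 1) \<in> S" unfolding c_def by (rule LeastI_ex) fact
  have "(c', n - 1) \<notin> S" if "c' < c" for c'
    using not_less_Least that unfolding c_def by blast
  moreover have "(c, d) \<notin> S" if "d > n - 1" for d using sub[of c d] that by linarith
  ultimately have "c = 0" using ext[OF c] by blast
  then have P: "(0, n - 1) \<in> S" using c by simp
  show "balanced_set n S"
    unfolding balanced_set_def
  proof (intro conjI P allI impI)
    show "S \<subseteq> {(i, j). i \<le> j \<and> j < n}" using sub by auto
    show "(i, j) = (0, n - 1) \<or> (\<exists>c<i. (c, j) \<in> S) \<or> (\<exists>d>j. (i, d) \<in> S)"
      if ij: "(i, j) \<in> S" for i j
    proof (cases "i = 0")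
      case True
      have "j = n - 1 \<or> n - 1 > j" using sub[OF ij] by linarith
      then show ?thesis using True P by blast
    qed (use ext[OF ij] in blast)
    show "(\<exists>d. (l, d) \<in> S) \<or> (\<exists>c. (c, l - 1) \<in> S)" if l: "0 < l \<and> l < n" for l
    proof -
      obtain j where j: "l = Suc j" "j < n" using l by (cases l) auto
      then show ?thesis using S unfolding extendable_def by auto
    qed
  qed
qed

section \<open>Summation over the columns\<close>

lemma sum_Pow_insert:
  assumes "finite A" "a \<notin> A"
  shows "sum f (Pow (insert a A)) = sum f (Pow A) + (\<Sum>C\<in>Pow A. f (insert a C))"
proof -
  have "inj_on (insert a) (Pow A)" using assms(2) by (auto simp: inj_on_def)
  moreover have "Pow A \<inter> insert a ` Pow A = {}" using assms(2) by auto
  ultimately show ?thesis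
    using assms(1) by (simp add: Pow_insert sum.union_disjoint sum.reindex)
qed

context
  fixes x :: "nat \<Rightarrow> 'a::comm_ring_1"
begin

definition row_prod :: "nat \<Rightarrow> 'a" where
  "row_prod r = (\<Prod>s\<le>r. 1 + x s)"

definition column_prod :: "nat \<Rightarrow> nat set \<Rightarrow> 'a" where
  "column_prod b R = (\<Prod>r<b. row_prod r - of_bool (Suc r \<notin> R))"

text \<open>A nonempty column is constrained only through its least row, by
  \<open>extendable_Suc\<close>. An empty column obeys the different condition
  \<open>Suc b \<in> R\<close> and is added separately in \<open>sum_extendable\<close>.\<close>

definition admissible :: "nat set \<Rightarrow> nat set \<Rightarrow> 'a" where
  "admissible R C = of_bool (C \<noteq> {} \<and> Min C \<in> R)"

lemma column_prod_cong: "R \<inter> {..b} = R' \<inter> {..b} \<Longrightarrow> column_prod b R = column_prod b R'"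
proof -
  assume *: "R \<inter> {..b} = R' \<inter> {..b}"
  have "Suc r \<in> R \<longleftrightarrow> Suc r \<in> R'" if "r < b" for r
    using * that by (metis Int_iff Suc_leI atMost_iff)
  then show ?thesis by (auto simp: column_prod_def intro!: prod.cong)
qed

text \<open>The choice of \<open>C\<close> changes the factors of all columns further left, yet the
  sum is again a product. As \<open>b\<close> bounds both the rows of \<open>C\<close> and the
  factors, each induction step adds one possible row \<open>Suc b\<close> and one factor, and these
  two interact only with each other: the new factor depends on \<open>C\<close> just through the
  presence of \<open>Suc b\<close>.\<close>

lemma sum_admissible:
  assumes "0 \<in> R"
  shows "(\<Sum>C\<in>Pow {..b}. admissible R C * prod x C * column_prod b (R \<union> C))
    = column_prod b R * (row_prod b - 1)"
proof (induction b)
  case 0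
  then show ?case
    using assms by (simp add: column_prod_def row_prod_def admissible_def Pow_insert atMost_0)
next
  case (Suc b)
  let ?F = "\<lambda>C. admissible R C * prod x C * column_prod b (R \<union> C)"
  let ?i = "of_bool (Suc b \<in> R) :: 'a"
  have P: "row_prod (Suc b) = row_prod b * (1 + x (Suc b))" by (simp add: row_prod_def mult.commute)
  \<comment> \<open>Without row \<open>Suc b\<close> in \<open>C\<close> the new factor is
    determined by \<open>R\<close> alone.\<close>
  have 1: "admissible R C * prod x C * column_prod (Suc b) (R \<union> C)
      = ?F C * (row_prod b - of_bool (Suc b \<notin> R))" if "C \<in> Pow {..b}" for C
  proof -
    have "Suc b \<notin> C" using that by auto
    then show ?thesis by (simp add: column_prod_def)
  qed
  \<comment> \<open>With row \<open>Suc b\<close> the new factor is \<open>row_prod b\<close>. This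
    row is the largest, so the minimum changes only if \<open>C\<close> was empty; then
    \<open>Suc b\<close> itself must lie in \<open>R\<close>, which is the extra term.\<close>
  have 2: "admissible R (insert (Suc b) C) * prod x (insert (Suc b) C)
        * column_prod (Suc b) (R \<union> insert (Suc b) C)
      = (?F C + of_bool (C = {}) * ?i * column_prod b R) * (x (Suc b) * row_prod b)"
    if "C \<in> Pow {..b}" for C
  proof -
    have C: "finite C" "Suc b \<notin> C" "\<And>c. c \<in> C \<Longrightarrow> c \<le> b"
      using that finite_subset[of C "{..b}"] by auto
    have "column_prod (Suc b) (R \<union> insert (Suc b) C) = column_prod b (R \<union> C) * row_prod b"
      using column_prod_cong[of "R \<union> insert (Suc b) C" b "R \<union> C"]
      by (auto simp: column_prod_def)
    moreover have "min (Suc b) (Min C) = Min C" if "C \<noteq> {}"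
      using C that Min_in[of C] by (simp add: min_absorb2 le_SucI)
    then have "admissible R (insert (Suc b) C) = admissible R C + of_bool (C = {}) * ?i"
      using C by (cases "C = {}") (auto simp: admissible_def)
    ultimately show ?thesis using C
      by (cases "C = {}") (simp_all add: admissible_def algebra_simps)
  qed
  have "(\<Sum>C\<in>Pow {..Suc b}. admissible R C * prod x C * column_prod (Suc b) (R \<union> C))
     = (\<Sum>C\<in>Pow {..b}. ?F C * (row_prod b - of_bool (Suc b \<notin> R)))
     + (\<Sum>C\<in>Pow {..b}. (?F C + of_bool (C = {}) * ?i * column_prod b R) * (x (Suc b) * row_prod b))"
    unfolding atMost_Suc using 1 2 by (subst sum_Pow_insert) (auto intro!: arg_cong2[where f = "(+)"] sum.cong)
  also have "\<dots> = column_prod b R * (row_prod b - 1) * (row_prod b - of_bool (Suc b \<notin> R))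
     + (column_prod b R * (row_prod b - 1) + ?i * column_prod b R) * (x (Suc b) * row_prod b)"
  proof -
    have "(\<Sum>C\<in>Pow {..b}. of_bool (C = {}) * ?i * column_prod b R) = ?i * column_prod b R"
      by (subst sum.remove[of _ "{}"]) (auto intro!: sum.neutral)
    then show ?thesis using Suc.IH by (simp only: sum_distrib_right[symmetric] sum.distrib)
  qed
  also have "\<dots> = column_prod (Suc b) R * (row_prod (Suc b) - 1)"
    by (cases "Suc b \<in> R") (simp_all add: column_prod_def P algebra_simps)
  finally show ?case .
qed

lemma finite_extendable: "finite {S. extendable b R S}"
proof (rule finite_subset)
  show "{S. extendable b R S} \<subseteq> Pow ({..<b} \<times> {..<b})"
    by (auto simp: extendable_def)
qed simp

text \<open>Nothing lies to the right of column \<open>b\<close>, and every row of \<open>C\<close>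
  but the least has an earlier start in the same column; so only \<open>Min C\<close> must be in
  \<open>R\<close>. For the columns further left all of \<open>C\<close> counts as occupied. No
  interval starts at \<open>Suc b\<close>, which leaves \<open>Suc b \<in> R\<close> as the only way
  to permit an empty column.\<close>

lemma extendable_Suc:
  assumes C: "C \<subseteq> {..b}" and S: "S \<subseteq> {(i, j). i \<le> j \<and> j < b}"
  shows "extendable (Suc b) R (S \<union> C \<times> {b}) \<longleftrightarrow>
    extendable b (R \<union> C) S \<and> (if C = {} then Suc b \<in> R else Min C \<in> R)"
proof -
  have fin: "finite C" using C finite_subset by blast
  have S': "i \<le> j" "j < b" if "(i, j) \<in> S" for i j using S that by auto
  let ?T = "S \<union> C \<times> {b}"
  have col: "(\<forall>i\<in>C. (\<exists>c<i. c \<in> C) \<or> i \<in> R) \<longleftrightarrow> C = {} \<or> Min C \<in> R"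
  proof (cases "C = {}")
    case False
    show ?thesis
    proof
      assume *: "\<forall>i\<in>C. (\<exists>c<i. c \<in> C) \<or> i \<in> R"
      have "\<not> (\<exists>c<Min C. c \<in> C)" using fin Min_le by (metis leD)
      then show "C = {} \<or> Min C \<in> R" using * fin False by (metis Min_in)
    next
      assume "C = {} \<or> Min C \<in> R"
      then show "\<forall>i\<in>C. (\<exists>c<i. c \<in> C) \<or> i \<in> R"
        using fin False by (metis Min_in Min_le le_neq_implies_less)
    qed
  qed simp
  have T: "(i, j) \<in> ?T \<longleftrightarrow> (i, j) \<in> S \<or> i \<in> C \<and> j = b" for i j by auto
  have "(\<forall>i j. (i, j) \<in> ?T \<longrightarrow> (\<exists>c<i. (c, j) \<in> ?T) \<or> (\<exists>d>j. (i, d) \<in> ?T) \<or> i \<in> R) \<longleftrightarrow>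
    (\<forall>i j. (i, j) \<in> S \<longrightarrow> (\<exists>c<i. (c, j) \<in> S) \<or> (\<exists>d>j. (i, d) \<in> S) \<or> i \<in> R \<union> C) \<and>
    (\<forall>i\<in>C. (\<exists>c<i. c \<in> C) \<or> i \<in> R)" (is "?L \<longleftrightarrow> ?A \<and> ?B")
  proof (intro iffI conjI allI impI ballI)
    assume L: ?L
    show "(\<exists>c<i. (c, j) \<in> S) \<or> (\<exists>d>j. (i, d) \<in> S) \<or> i \<in> R \<union> C" if "(i, j) \<in> S" for i j
      using L that S'[OF that] by (auto simp: T)
    show "(\<exists>c<i. c \<in> C) \<or> i \<in> R" if "i \<in> C" for i
    proof -
      have "(\<exists>c<i. (c, b) \<in> ?T) \<or> (\<exists>d>b. (i, d) \<in> ?T) \<or> i \<in> R" using L that by blast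
      then show ?thesis using S' by (force simp: T)
    qed
  next
    assume AB: "?A \<and> ?B"
    show "(\<exists>c<i. (c, j) \<in> ?T) \<or> (\<exists>d>j. (i, d) \<in> ?T) \<or> i \<in> R" if ij: "(i, j) \<in> ?T" for i j
      proof (cases "(i, j) \<in> S")
        case True
        then show ?thesis using AB S'[OF True] unfolding T by blast
      next
        case False
        then show ?thesis using AB ij by (auto simp: T)
      qed
  qed
  moreover have "(\<forall>j<Suc b. (\<exists>c. (c, j) \<in> ?T) \<or> (\<exists>d. (Suc j, d) \<in> ?T) \<or> Suc j \<in> R) \<longleftrightarrow>
    (\<forall>j<b. (\<exists>c. (c, j) \<in> S) \<or> (\<exists>d. (Suc j, d) \<in> S) \<or> Suc j \<in> R \<union> C) \<and> (C \<noteq> {} \<or> Suc b \<in> R)"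
  proof -
    have "(Suc b, d) \<notin> ?T" for d using S'[of "Suc b" d] C by (auto simp: T)
    moreover have "(\<exists>c. (c, b) \<in> ?T) \<longleftrightarrow> C \<noteq> {}" using S' by (fastforce simp: T)
    moreover have "(\<exists>c. (c, j) \<in> ?T) \<longleftrightarrow> (\<exists>c. (c, j) \<in> S)" if "j < b" for j
      using that by (auto simp: T)
    moreover have "(\<exists>d. (Suc j, d) \<in> ?T) \<longleftrightarrow> (\<exists>d. (Suc j, d) \<in> S) \<or> Suc j \<in> C" for j
      by (auto simp: T)
    ultimately show ?thesis by (auto simp: less_Suc_eq)
  qed
  moreover have "?T \<subseteq> {(i, j). i \<le> j \<and> j < Suc b}" using C S by auto
  ultimately show ?thesis unfolding extendable_def col using S by auto
qed

lemma sum_extendable: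
  assumes "0 \<in> R"
  shows "(\<Sum>S | extendable b R S. \<Prod>s\<in>S. x (fst s)) = column_prod b R"
  using assms
proof (induction b arbitrary: R)
  case 0
  have "{S. extendable 0 R S} = {{}}" by (auto simp: extendable_def)
  then show ?case by (simp add: column_prod_def)
next
  case (Suc b)
  let ?w = "\<lambda>S. \<Prod>s\<in>S. x (fst s)"
  let ?ok = "\<lambda>C. if C = {} then Suc b \<in> R else Min C \<in> R"
  let ?K = "{C \<in> Pow {..b}. ?ok C}"
  let ?g = "\<lambda>(C, S). S \<union> C \<times> {b}"
  let ?D = "SIGMA C:?K. {S. extendable b (R \<union> C) S}"
  have sub: "S \<subseteq> {(i, j). i \<le> j \<and> j < b'}" if "extendable b' R' S" for S b' R'
    using that by (simp add: extendable_def)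
  have inj: "inj_on ?g ?D"
  proof (rule inj_onI, clarsimp)
    fix C S C' S' assume *: "extendable b (R \<union> C) S" "extendable b (R \<union> C') S'"
      and eq: "S \<union> C \<times> {b} = S' \<union> C' \<times> {b}"
    have S: "(i, b) \<notin> S" "(i, b) \<notin> S'" for i using sub[OF *(1)] sub[OF *(2)] by auto
    have "i \<in> C \<longleftrightarrow> i \<in> C'" for i
      using eq S[of i] by (metis SigmaE2 SigmaI UnCI UnE singletonI)
    moreover have "S = {s \<in> S \<union> C \<times> {b}. snd s < b}" using sub[OF *(1)] by auto
    moreover have "S' = {s \<in> S' \<union> C' \<times> {b}. snd s < b}" using sub[OF *(2)] by auto
    ultimately show "C = C' \<and> S = S'" using eq by auto
  qed
  have img: "?g ` ?D = {S. extendable (Suc b) R S}"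
  proof (intro equalityI subsetI)
    fix S assume "S \<in> ?g ` ?D"
    then obtain C S' where *: "C \<in> ?K" "extendable b (R \<union> C) S'" "S = S' \<union> C \<times> {b}" by auto
    then show "S \<in> {S. extendable (Suc b) R S}"
      using extendable_Suc[OF _ sub[OF *(2)], of C R] by auto
  next
    fix S assume "S \<in> {S. extendable (Suc b) R S}"
    then have S: "extendable (Suc b) R S" by simp
    let ?C = "{i. (i, b) \<in> S}" and ?S = "{s \<in> S. snd s < b}"
    have C: "?C \<subseteq> {..b}" and S': "?S \<subseteq> {(i, j). i \<le> j \<and> j < b}" using sub[OF S] by auto
    have "S = ?S \<union> ?C \<times> {b}" using sub[OF S] by (auto simp: less_Suc_eq)
    then show "S \<in> ?g ` ?D"
      using extendable_Suc[OF C S', of R] S C by (intro image_eqI[of _ _ "(?C, ?S)"]) auto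
  qed
  have "(\<Sum>S | extendable (Suc b) R S. ?w S) = (\<Sum>z\<in>?D. ?w (?g z))"
    unfolding img[symmetric] by (subst sum.reindex[OF inj]) simp
  also have "\<dots> = (\<Sum>(C, S)\<in>?D. prod x C * ?w S)"
  proof (rule sum.cong[OF refl])
    fix z assume z: "z \<in> ?D"
    obtain C S where CS: "z = (C, S)" by (cases z)
    have C: "C \<subseteq> {..b}" and S: "extendable b (R \<union> C) S" using z CS by auto
    have "S \<subseteq> {..<b} \<times> {..<b}" using sub[OF S] by auto
    then have "finite S" by (rule finite_subset) simp
    moreover have "finite C" using C finite_subset by blast
    moreover have "S \<inter> C \<times> {b} = {}" using sub[OF S] by auto
    moreover have "?w (C \<times> {b}) = prod x C"
      by (rule prod.reindex_bij_witness[of _ "\<lambda>i. (i, b)" fst]) auto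
    ultimately show "?w (?g z) = (case z of (C, S) \<Rightarrow> prod x C * ?w S)"
      by (simp add: CS prod.union_disjoint mult.commute)
  qed
  also have "\<dots> = (\<Sum>C\<in>?K. prod x C * (\<Sum>S | extendable b (R \<union> C) S. ?w S))"
    by (subst sum.Sigma[symmetric]) (auto simp: finite_extendable sum_distrib_left)
  also have "\<dots> = (\<Sum>C\<in>?K. prod x C * column_prod b (R \<union> C))"
    using Suc by (intro sum.cong) auto
  \<comment> \<open>The sum is spread over all subsets so that \<open>sum_admissible\<close>
    applies; \<open>admissible\<close> removes the forbidden nonempty ones, and the second summand
    accounts for the empty column.\<close>
  also have "\<dots> = (\<Sum>C\<in>Pow {..b}. admissible R C * prod x C * column_prod b (R \<union> C)
      + of_bool (C = {}) * (of_bool (Suc b \<in> R) * column_prod b R))"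
    by (rule sum.mono_neutral_cong_left) (auto simp: admissible_def)
  also have "\<dots> = column_prod b R * (row_prod b - 1) + of_bool (Suc b \<in> R) * column_prod b R"
  proof -
    have "(\<Sum>C\<in>Pow {..b}. of_bool (C = {}) * (of_bool (Suc b \<in> R) * column_prod b R))
        = of_bool (Suc b \<in> R) * column_prod b R"
      by (subst sum.remove[of _ "{}"]) (auto intro!: sum.neutral)
    then show ?thesis using sum_admissible[OF Suc.prems, of b] by (simp add: sum.distrib)
  qed
  also have "\<dots> = column_prod (Suc b) R"
    by (cases "Suc b \<in> R") (simp_all add: column_prod_def algebra_simps)
  finally show ?case .
qed

end

lemma sum_balanced_set:
  fixes x :: "nat \<Rightarrow> 'a::comm_ring_1"
  assumes "1 \<le> n"
  shows "(\<Sum>S | balanced_set n S. \<Prod>s\<in>S. x (fst s)) = (\<Prod>r<n. (\<Prod>s\<le>r. 1 + x s) - 1)"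
  using sum_extendable[of "{0}" x n]
  by (simp add: balanced_set_iff_extendable[OF assms] column_prod_def row_prod_def)

lemma finite_balanced_set: "finite {S. balanced_set n S}"
proof (rule finite_subset)
  show "{S. balanced_set n S} \<subseteq> Pow ({..<n} \<times> {..<n})"
    by (auto simp: balanced_set_def)
qed simp

section \<open>Coefficients of the polynomial\<close>

lemma lookup_h_poly:
  assumes "1 \<le> n"
  shows "Poly_Mapping.lookup (h_poly n) (\<Sum>i=1..n. Poly_Mapping.single i (t i)) =
    int (card {S. balanced_set n S \<and> (\<forall>i<n. card {s \<in> S. fst s = i} = t (Suc i))})"
proof -
  let ?t = "\<Sum>i=1..n. Poly_Mapping.single i (t i)"
  let ?e = "\<lambda>S. \<Sum>s\<in>S. Poly_Mapping.single (Suc (fst s)) (1::nat)"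
  have w: "(\<Prod>s\<in>S. indet (Suc (fst s))) = Poly_Mapping.single (?e S) 1" for S :: "(nat \<times> nat) set"
  proof (induction S rule: infinite_finite_induct)
    case (insert s S)
    then show ?case by (simp add: indet_def Poly_Mapping.mult_single)
  qed simp_all
  have h: "h_poly n = (\<Sum>S | balanced_set n S. Poly_Mapping.single (?e S) 1)"
  proof -
    have "h_poly n = (\<Prod>r<n. (\<Prod>s\<le>r. 1 + indet (Suc s)) - 1)"
      unfolding h_poly_def
      by (simp add: prod.atLeast1_atMost_eq lessThan_Suc_atMost)
    then show ?thesis using sum_balanced_set[OF assms, of "\<lambda>s. indet (Suc s)"] w by simp
  qed
  have e: "?e S = ?t \<longleftrightarrow> (\<forall>i<n. card {s \<in> S. fst s = i} = t (Suc i))" if S: "balanced_set n S" for S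
  proof -
    have "S \<subseteq> {..<n} \<times> {..<n}" using S by (auto simp: balanced_set_def)
    then have fin: "finite S" by (rule finite_subset) simp
    have l: "Poly_Mapping.lookup (?e S) (Suc i) = card {s \<in> S. fst s = i}" for i
    proof -
      have "Poly_Mapping.lookup (?e S) (Suc i) = (\<Sum>s\<in>S. if fst s = i then 1 else 0)"
        unfolding lookup_sum lookup_single when_def by (rule sum.cong) auto
      also have "\<dots> = card {s \<in> S. fst s = i}"
        by (subst sum.inter_filter[OF fin, symmetric]) simp
      finally show ?thesis .
    qed
    \<comment> \<open>Index \<open>0\<close> belongs to no variable, and no interval starts at
      \<open>n\<close> or later. Both exponents vanish at such indices, so only \<open>1\<close> to
      \<open>n\<close> have to be compared.\<close>
    have l0: "Poly_Mapping.lookup (?e S) 0 = 0"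
      by (simp add: lookup_sum lookup_single)
    have r: "Poly_Mapping.lookup ?t k = (if k \<in> {1..n} then t k else 0)" for k
      by (simp add: lookup_sum lookup_single when_def sum.delta)
    have "fst s < n" if "s \<in> S" for s using S that by (auto simp: balanced_set_def)
    then have big: "card {s \<in> S. fst s = i} = 0" if "i \<ge> n" for i
    proof -
      have "{s \<in> S. fst s = i} = {}" using that \<open>\<And>s. s \<in> S \<Longrightarrow> fst s < n\<close> by fastforce
      then show ?thesis by (simp only: card.empty)
    qed
    show ?thesis
    proof
      assume eq: "?e S = ?t"
      show "\<forall>i<n. card {s \<in> S. fst s = i} = t (Suc i)"
      proof (intro allI impI)
        fix i assume "i < n"
        then show "card {s \<in> S. fst s = i} = t (Suc i)"
          using l[of i] r[of "Suc i"] unfolding eq by simp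
      qed
    next
      assume *: "\<forall>i<n. card {s \<in> S. fst s = i} = t (Suc i)"
      show "?e S = ?t"
      proof (rule poly_mapping_eqI)
        fix k show "Poly_Mapping.lookup (?e S) k = Poly_Mapping.lookup ?t k"
        proof (cases k)
          case 0
          then show ?thesis using l0 r by simp
        next
          case (Suc i)
          then show ?thesis using * big[of i] l[of i] r[of k] by (cases "i < n") auto
        qed
      qed
    qed
  qed
  have "Poly_Mapping.lookup (h_poly n) ?t = (\<Sum>S | balanced_set n S. of_bool (?e S = ?t))"
    unfolding h lookup_sum lookup_single when_def of_bool_def by (rule sum.cong) auto
  also have "\<dots> = (\<Sum>S | balanced_set n S.
      of_bool (\<forall>i<n. card {s \<in> S. fst s = i} = t (Suc i)))"
    by (rule sum.cong[OF refl]) (simp only: e mem_Collect_eq)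
  also have "\<dots> = int (card {S. balanced_set n S \<and> (\<forall>i<n. card {s \<in> S. fst s = i} = t (Suc i))})"
    using finite_balanced_set by (simp add: sum.inter_filter[symmetric] Collect_conj_eq[symmetric] of_bool_def)
  finally show ?thesis .
qed


section \<open>Faithfully balanced modules\<close>

text \<open>Both sides of the linearity condition are additive in the matrix, so matrix units
  decide.\<close>

lemma lmod_homI_unit:
  fixes M :: "('k::field mat, 'a) module" and N :: "('k mat, 'b) module"
  assumes M: "left_module (LT n) M" and N: "left_module (LT n) N"
    and closed: "\<And>x. x \<in> carrier M \<Longrightarrow> f x \<in> carrier N"
    and add: "\<And>x y. x \<in> carrier M \<Longrightarrow> y \<in> carrier M \<Longrightarrow> f (x \<oplus>\<^bsub>M\<^esub> y) = f x \<oplus>\<^bsub>N\<^esub> f y"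
    and unit: "\<And>k l c x. l \<le> k \<Longrightarrow> k < n \<Longrightarrow> x \<in> carrier M \<Longrightarrow>
      f (unit_mat n k l c \<odot>\<^bsub>M\<^esub> x) = unit_mat n k l c \<odot>\<^bsub>N\<^esub> f x"
  shows "lmod_hom (LT n) M N f"
proof (rule lmod_homI[OF closed add])
  interpret M: left_module "LT n" M by fact
  interpret N: left_module "LT n" N by fact
  fix A :: "'k mat" and x assume A: "A \<in> carrier (LT n)" and x: "x \<in> carrier M"
  have "f \<zero>\<^bsub>M\<^esub> = \<zero>\<^bsub>N\<^esub>"
    using add[of "\<zero>\<^bsub>M\<^esub>" "\<zero>\<^bsub>M\<^esub>"] closed[of "\<zero>\<^bsub>M\<^esub>"] by (simp add: N.M.add.l_cancel_one')
  then have zero: "f (0\<^sub>m n n \<odot>\<^bsub>M\<^esub> x) = 0\<^sub>m n n \<odot>\<^bsub>N\<^esub> f x"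
    using M.zero_smult[OF x] N.zero_smult[OF closed[OF x]] by simp
  from A show "f (A \<odot>\<^bsub>M\<^esub> x) = A \<odot>\<^bsub>N\<^esub> f x"
  proof (induction rule: LT_induct)
    case (add X Y)
    have "f ((X + Y) \<odot>\<^bsub>M\<^esub> x) = f (X \<odot>\<^bsub>M\<^esub> x \<oplus>\<^bsub>M\<^esub> Y \<odot>\<^bsub>M\<^esub> x)"
      using M.smult_l_distr[of X Y x] add x by simp
    also have "\<dots> = f (X \<odot>\<^bsub>M\<^esub> x) \<oplus>\<^bsub>N\<^esub> f (Y \<odot>\<^bsub>M\<^esub> x)"
      using add x M.smult_closed assms(4) by blast
    also have "\<dots> = (X + Y) \<odot>\<^bsub>N\<^esub> f x"
      using N.smult_l_distr[of X Y "f x"] add closed[OF x] by simp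
    finally show ?case .
  qed (use zero unit x in auto)
qed

definition single_vec :: "'i \<Rightarrow> nat \<Rightarrow> 'k::zero \<Rightarrow> 'i \<Rightarrow> nat \<Rightarrow> 'k" where
  "single_vec s l c = (\<lambda>t k. if t = s \<and> k = l then c else 0)"

text \<open>The counterpart of \<open>LT_induct\<close> for vectors: over a finite index set every
  vector is a finite sum of vectors with one entry.\<close>

lemma interval_sum_induct [consumes 2, case_names zero add single_vec]:
  assumes I: "finite I" and y: "y \<in> carrier (interval_sum I iv :: ('k::field mat, _) module)"
    and zero: "P (\<lambda>_ _. 0)"
    and add: "\<And>y z. y \<in> carrier (interval_sum I iv :: ('k mat, _) module) \<Longrightarrow>
      z \<in> carrier (interval_sum I iv :: ('k mat, _) module) \<Longrightarrow> P y \<Longrightarrow> P z \<Longrightarrow> P (\<lambda>s k. y s k + z s k)"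
    and single_vec: "\<And>s l c. s \<in> I \<Longrightarrow> fst (iv s) \<le> l \<Longrightarrow> l \<le> snd (iv s) \<Longrightarrow> P (single_vec s l c)"
  shows "P y"
proof -
  let ?T = "SIGMA s:I. {fst (iv s)..snd (iv s)}"
  define part where "part F = (\<lambda>s k. if (s, k) \<in> F then y s k else 0)" for F
  have mem: "part F \<in> carrier (interval_sum I iv :: ('k mat, _) module)" for F
    using y by (auto simp: part_def)
  have "finite ?T" using I by simp
  have "P (part F)" if "F \<subseteq> ?T" for F
    using finite_subset[OF that \<open>finite ?T\<close>] that
  proof (induction F rule: finite_induct)
    case empty
    then show ?case using zero by (simp add: part_def)
  next
    case (insert p F)
    obtain s l where p: "p = (s, l)" by (cases p)
    have sl: "s \<in> I" "fst (iv s) \<le> l" "l \<le> snd (iv s)" using insert.prems p by auto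
    have "part (insert p F) = (\<lambda>t k. part F t k + single_vec s l (y s l) t k)"
      using insert.hyps(2) by (auto simp: part_def p single_vec_def fun_eq_iff)
    moreover have "single_vec s l (y s l) \<in> carrier (interval_sum I iv :: ('k mat, _) module)"
      using sl by (auto simp: single_vec_def)
    ultimately show ?case
      using add[of "part F" "single_vec s l (y s l)"] mem[of F] insert single_vec[OF sl] by simp
  qed
  moreover have "part ?T = y"
    using y by (auto simp: part_def fun_eq_iff)
  ultimately show ?thesis by (metis subset_refl)
qed


subsection \<open>The combinatorial conditions are sufficient\<close>

lemma balanced_set_extend:
  assumes "balanced_set n S" "(i, j) \<in> S" "(i, j) \<noteq> (0, n - 1)"
  shows "(\<exists>c<i. (c, j) \<in> S) \<or> (\<exists>d>j. (i, d) \<in> S)"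
  using assms unfolding balanced_set_def by blast

lemma balanced_set_bounds:
  "balanced_set n S \<Longrightarrow> (i, j) \<in> S \<Longrightarrow> i \<le> j \<and> j < n"
  unfolding balanced_set_def by blast

text \<open>An extremal choice: among the members through \<open>l\<close> that start after
  \<open>k\<close>, take the earliest start \<open>p\<close>, and then the latest end
  \<open>q\<close> for that start. The member \<open>(p, q)\<close> has no longer neighbour to the
  right, so one with the same end starts earlier, and by the choice of \<open>p\<close> it starts at
  or before \<open>k\<close>.\<close>

lemma balanced_set_crossing:
  assumes S: "balanced_set n S" and a: "(a, b) \<in> S" "k < a" "a \<le> l" "l \<le> b"
  shows "\<exists>c a b. (c, b) \<in> S \<and> (a, b) \<in> S \<and> c \<le> k \<and> k < a \<and> a \<le> l \<and> l \<le> b"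
proof -
  let ?P = "\<lambda>a. k < a \<and> a \<le> l \<and> (\<exists>b\<ge>l. (a, b) \<in> S)"
  define p where "p = (LEAST a. ?P a)"
  have "?P a" using a by blast
  then have p: "?P p" unfolding p_def by (rule LeastI)
  have min: "\<not> ?P c" if "c < p" for c using that not_less_Least unfolding p_def by blast
  let ?B = "{b. (p, b) \<in> S}"
  have fin: "finite ?B"
    by (rule finite_subset[of _ "{..<n}"]) (use balanced_set_bounds[OF S] in auto)
  define q where "q = Max ?B"
  have ne: "?B \<noteq> {}" using p by blast
  have q: "(p, q) \<in> S" using Max_in[OF fin ne] unfolding q_def by simp
  have max: "b \<le> q" if "(p, b) \<in> S" for b using Max_ge[OF fin] that unfolding q_def by simp
  have "l \<le> q" using p max by (meson le_trans)
  have "(p, q) \<noteq> (0, n - 1)" using p by simp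
  from balanced_set_extend[OF S q this] obtain c where c: "c < p" "(c, q) \<in> S"
    using max by (metis leD)
  have "c \<le> k"
  proof (rule ccontr)
    assume "\<not> c \<le> k"
    then have "?P c" using c p \<open>l \<le> q\<close> by auto
    then show False using min[OF c(1)] by blast
  qed
  then show ?thesis using p q c \<open>l \<le> q\<close> by blast
qed

text \<open>Two members sharing one end point, the longer containing \<open>k\<close> and
  \<open>l\<close> and the shorter only one of them, are what later forces the entry
  \<open>(k, l)\<close> above the diagonal to vanish. A member starting at \<open>l\<close> leads to
  a common end. A member ending at \<open>l - 1\<close> is treated by the mirrored choice, the
  latest end \<open>d < l\<close> and then the earliest start; if that start still exceeds
  \<open>k\<close>, the extended member feeds the crossing lemma.\<close>

lemma balanced_set_separates:
  assumes S: "balanced_set n S" and kl: "k < l" "l < n"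
  shows "(\<exists>c a b. (c, b) \<in> S \<and> (a, b) \<in> S \<and> c \<le> k \<and> k < a \<and> a \<le> l \<and> l \<le> b) \<or>
    (\<exists>c d b. (c, d) \<in> S \<and> (c, b) \<in> S \<and> c \<le> k \<and> k \<le> d \<and> d < l \<and> l \<le> b)"
proof -
  have "(\<exists>d. (l, d) \<in> S) \<or> (\<exists>c. (c, l - 1) \<in> S)"
    using S kl unfolding balanced_set_def by auto
  then show ?thesis
  proof
    assume "\<exists>d. (l, d) \<in> S"
    then obtain d where d: "(l, d) \<in> S" by blast
    show ?thesis
      using balanced_set_crossing[OF S d kl(1)] balanced_set_bounds[OF S d] by blast
  next
    assume "\<exists>c. (c, l - 1) \<in> S"
    then have ne: "l - 1 \<in> {d. k \<le> d \<and> d < l \<and> (\<exists>c. (c, d) \<in> S)}" (is "_ \<in> ?D") using kl by auto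
    have fin: "finite ?D" by (rule finite_subset[of _ "{..<l}"]) auto
    define d where "d = Max ?D"
    have "d \<in> ?D" unfolding d_def using Max_in[OF fin] ne by blast
    then have d: "k \<le> d" "d < l" "\<exists>c. (c, d) \<in> S" by auto
    have max: "d' \<le> d" if "k \<le> d'" "d' < l" "(c, d') \<in> S" for c d'
      using Max_ge[OF fin, of d'] that unfolding d_def by blast
    define c where "c = (LEAST c. (c, d) \<in> S)"
    have c: "(c, d) \<in> S" unfolding c_def using d(3) by (rule LeastI_ex)
    have min: "(c', d) \<notin> S" if "c' < c" for c' using that not_less_Least unfolding c_def by blast
    have "(c, d) \<noteq> (0, n - 1)" using d(2) kl(2) by auto
    from balanced_set_extend[OF S c this] obtain b where b: "b > d" "(c, b) \<in> S" using min by blast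
    have "l \<le> b" using max[of b c] b d(1) by (meson leD le_trans less_imp_le not_le)
    show ?thesis
    proof (cases "c \<le> k")
      case True
      then show ?thesis using c b d \<open>l \<le> b\<close> by blast
    next
      case False
      then show ?thesis
        using balanced_set_crossing[OF S b(2), of k l] balanced_set_bounds[OF S c] d \<open>l \<le> b\<close> by simp
    qed
  qed
qed

section \<open>Operators on the direct sum of a set of intervals\<close>

context
  fixes n :: nat and S :: "(nat \<times> nat) set" and M :: "('k::field mat, nat \<times> nat \<Rightarrow> nat \<Rightarrow> 'k) module" (structure)
  assumes S: "S \<subseteq> {(i, j). i \<le> j \<and> j < n}"
  defines "M \<equiv> interval_sum S id"
begin

lemma finite_S: "finite S"
  by (rule finite_subset[of _ "{..<n} \<times> {..<n}"]) (use S in auto)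

lemma S_bounds: "s \<in> S \<Longrightarrow> fst s \<le> snd s \<and> snd s < n"
  using S by auto

lemma left_module_M: "left_module (LT n) M"
  unfolding M_def using S by (intro left_module_interval_sum) auto

lemma M_carrier: "y \<in> carrier M \<longleftrightarrow> (\<forall>s k. y s k \<noteq> 0 \<longrightarrow> s \<in> S \<and> fst s \<le> k \<and> k \<le> snd s)"
  by (simp add: M_def)

lemma M_nonzero: "y \<in> carrier M \<Longrightarrow> y s k \<noteq> 0 \<Longrightarrow> s \<in> S \<and> fst s \<le> k \<and> k \<le> snd s"
  unfolding M_carrier by blast

lemma M_add: "y \<oplus> z = (\<lambda>s k. y s k + z s k)"
  by (simp add: M_def)

lemma M_zero: "\<zero> = (\<lambda>_ _. 0)"
  by (simp add: M_def)

lemma M_unit: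
  assumes "y \<in> carrier M" "l \<le> k"
  shows "unit_mat n k l c \<odot> y = (\<lambda>s m. if m = k \<and> k \<le> snd s then c * y s l else 0)"
proof -
  have "snd (id s) < n" if "s \<in> S" for s using S that by auto
  from unit_mat_smult_sum[OF assms(1)[unfolded M_def] this assms(2)] show ?thesis
    by (simp add: M_def)
qed

lemma hom_unit:
  assumes f: "lmod_hom (LT n) M M f" and "l \<le> k" "y \<in> carrier M"
  shows "f (unit_mat n k l c \<odot> y) = (\<lambda>s m. if m = k \<and> k \<le> snd s then c * f y s l else 0)"
  using lmod_hom_smult[OF f unit_mat_LT[OF assms(2), where n = n] assms(3)]
    M_unit[OF lmod_hom_closed[OF f assms(3)] assms(2)] by simp

lemma single_vec_mem: "s \<in> S \<Longrightarrow> fst s \<le> l \<Longrightarrow> l \<le> snd s \<Longrightarrow> single_vec s l c \<in> carrier M"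
  by (auto simp: M_carrier single_vec_def)

lemma smult_single:
  assumes "A \<in> carrier (LT n)" "s \<in> S" "fst s \<le> l" "l \<le> snd s"
  shows "A \<odot> single_vec s l c = (\<lambda>t k. if t = s \<and> fst s \<le> k \<and> k \<le> snd s then A $$ (k, l) * c else 0)"
proof (intro ext)
  fix t k
  have "(\<Sum>m=fst s..snd s. A $$ (k, m) * (if m = l then c else 0)) = A $$ (k, l) * c"
    using assms(3,4) by (simp add: if_distrib[of "\<lambda>x. _ * x"] sum.delta cong: if_cong)
  then show "(A \<odot> single_vec s l c) t k
      = (if t = s \<and> fst s \<le> k \<and> k \<le> snd s then A $$ (k, l) * c else 0)"
    by (cases "t = s") (simp_all add: M_def single_vec_def)
qed

lemma M_induct [consumes 1, case_names zero add single_vec]: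
  assumes "y \<in> carrier M" "P (\<lambda>_ _. 0)"
    and "\<And>y z. y \<in> carrier M \<Longrightarrow> z \<in> carrier M \<Longrightarrow> P y \<Longrightarrow> P z \<Longrightarrow> P (\<lambda>s k. y s k + z s k)"
    and "\<And>s l c. s \<in> S \<Longrightarrow> fst s \<le> l \<Longrightarrow> l \<le> snd s \<Longrightarrow> P (single_vec s l c)"
  shows "P y"
  using interval_sum_induct[OF finite_S, of y id P] assms unfolding M_def by simp

text \<open>Operators in \<open>bicommutant\<close> are only required to be additive; commuting with
  these endomorphisms makes them linear over the field.\<close>

lemma scaling_hom: "lmod_hom (LT n) M M (\<lambda>y s k. c * y s k)"
proof (rule lmod_homI_unit[OF left_module_M left_module_M])
  fix k l :: nat and d y assume lk: "l \<le> k" and y: "y \<in> carrier M"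
  have cy: "(\<lambda>s k. c * y s k) \<in> carrier M" using y by (auto simp: M_carrier)
  show "(\<lambda>s m. c * (unit_mat n k l d \<odot> y) s m) = unit_mat n k l d \<odot> (\<lambda>s k. c * y s k)"
    unfolding M_unit[OF y lk] M_unit[OF cy lk] by (auto simp: fun_eq_iff)
qed (auto simp: M_carrier M_add algebra_simps)

text \<open>If \<open>t\<close> starts and ends no later than \<open>s\<close>, the interval from
  \<open>fst s\<close> to \<open>snd t\<close>, when nonempty, is a quotient of \<open>s\<close> and
  a submodule of \<open>t\<close>. This is the resulting homomorphism, extended by zero to the other
  summands; for \<open>s = t\<close> it is the projection onto the summand.\<close>

definition overlap :: "nat \<times> nat \<Rightarrow> nat \<times> nat \<Rightarrow> (nat \<times> nat \<Rightarrow> nat \<Rightarrow> 'k) \<Rightarrow> nat \<times> nat \<Rightarrow> nat \<Rightarrow> 'k" where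
  "overlap s t y = (\<lambda>u k. if u = t \<and> fst s \<le> k \<and> k \<le> snd t then y s k else 0)"

lemma overlap_hom:
  assumes st: "s \<in> S" "t \<in> S" "fst t \<le> fst s" "snd t \<le> snd s"
  shows "lmod_hom (LT n) M M (overlap s t)"
proof (rule lmod_homI_unit[OF left_module_M left_module_M])
  show closed: "overlap s t y \<in> carrier M" if "y \<in> carrier M" for y
    using that st by (auto simp: M_carrier overlap_def)
  fix k l :: nat and d y assume lk: "l \<le> k" and y: "y \<in> carrier M"
  have "fst s \<le> l \<and> l \<le> snd s" if "y s l \<noteq> 0" using M_nonzero[OF y that] by simp
  then show "overlap s t (unit_mat n k l d \<odot> y) = unit_mat n k l d \<odot> overlap s t y"
    unfolding M_unit[OF y lk] M_unit[OF closed[OF y] lk] using lk st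
    by (auto simp: fun_eq_iff overlap_def)
qed (auto simp: M_add overlap_def fun_eq_iff)

lemma overlap_single:
  "overlap s t (single_vec s l c) = (if fst s \<le> l \<and> l \<le> snd t then single_vec t l c else (\<lambda>_ _. 0))"
  by (auto simp: overlap_def single_vec_def fun_eq_iff)

lemma faithfully_balanced_if_balanced_set:
  assumes n: "1 \<le> n" and bal: "balanced_set n S"
  shows "faithfully_balanced (LT n) M"
  unfolding faithfully_balanced_iff[OF left_module_M]
proof (intro conjI ballI allI impI)
  define m where "m = n - 1"
  have m: "m < n" "\<And>k. k < n \<Longrightarrow> k \<le> m" using n by (auto simp: m_def)
  let ?P = "(0, m)"
  have P: "?P \<in> S" using bal by (simp add: balanced_set_def m_def)
  fix A B :: "'k mat" assume A: "A \<in> carrier (LT n)" and B: "B \<in> carrier (LT n)"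
    and eq: "\<forall>y\<in>carrier M. A \<odot> y = B \<odot> y"
  \<comment> \<open>On the full interval a matrix acts as on all column vectors, so each of its
    entries is visible there.\<close>
  have entry: "A $$ (k, l) = B $$ (k, l)" if "k < n" "l < n" for k l
  proof -
    have l: "fst ?P \<le> l" "l \<le> snd ?P" using that m by auto
    have "(A \<odot> single_vec ?P l 1) ?P k = (B \<odot> single_vec ?P l 1) ?P k"
      using eq single_vec_mem[OF P l] by simp
    then show ?thesis using smult_single[OF A P l, of 1] smult_single[OF B P l, of 1] m(2)[OF that(1)] by simp
  qed
  show "A = B" using A B entry by (intro eq_matI) (auto simp: LT_carrier_iff)
next
  define m where "m = n - 1"
  have m: "m < n" "\<And>k. k < n \<Longrightarrow> k \<le> m" using n by (auto simp: m_def)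
  let ?P = "(0, m)"
  have P: "?P \<in> S" using bal by (simp add: balanced_set_def m_def)
  fix g assume g: "bicommutant (LT n) M g"
  have g_closed: "g y \<in> carrier M" if "y \<in> carrier M" for y
    using g that by (auto simp: bicommutant_def)
  have g_add: "g (\<lambda>s k. y s k + z s k) = (\<lambda>s k. g y s k + g z s k)" if "y \<in> carrier M" "z \<in> carrier M" for y z
    using g that unfolding bicommutant_def M_add by blast
  have g_hom: "g (f y) = f (g y)" if "lmod_hom (LT n) M M f" "y \<in> carrier M" for f y
    using g that unfolding bicommutant_def by blast
  have zero: "(\<lambda>_ _. 0) \<in> carrier M" by (simp add: M_carrier)
  have g_zero: "g (\<lambda>_ _. 0) = (\<lambda>_ _. 0)"
  proof (intro ext)
    fix s k
    have "g (\<lambda>_ _. 0) s k = g (\<lambda>_ _. 0) s k + g (\<lambda>_ _. 0) s k"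
      using fun_cong[OF fun_cong[OF g_add[OF zero zero], of s], of k] by simp
    then show "g (\<lambda>_ _. 0) s k = 0" by (metis add_cancel_right_right)
  qed
  \<comment> \<open>The entry of \<open>g\<close> on the summand \<open>s\<close> in row
    \<open>k\<close> and column \<open>l\<close>. By \<open>G_off\<close> there are no entries
    between different summands, since \<open>g\<close> commutes with the projections.\<close>
  define G where "G s k l = g (single_vec s l 1) s k" for s k l
  have G_off: "g (single_vec s l 1) t k = 0" if "s \<in> S" "fst s \<le> l" "l \<le> snd s" "t \<noteq> s" for s l t k
  proof -
    have "g (overlap s s (single_vec s l 1)) = overlap s s (g (single_vec s l 1))"
      using that by (intro g_hom overlap_hom single_vec_mem) auto
    then have "g (single_vec s l 1) = overlap s s (g (single_vec s l 1))" using that by (simp add: overlap_single)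
    from fun_cong[OF fun_cong[OF this, of t], of k] show ?thesis using that(4) by (simp add: overlap_def)
  qed
  \<comment> \<open>For a column \<open>l\<close> that survives the map from \<open>s\<close> to
    \<open>t\<close>, commuting determines the whole column on \<open>t\<close>: it agrees with that
    on \<open>s\<close> within the overlap and is zero outside.\<close>
  have G_source: "G t k l = (if fst s \<le> k \<and> k \<le> snd t then G s k l else 0)"
    if "s \<in> S" "t \<in> S" "fst t \<le> fst s" "snd t \<le> snd s" "fst s \<le> l" "l \<le> snd t" for s t k l
  proof -
    have "g (overlap s t (single_vec s l 1)) = overlap s t (g (single_vec s l 1))"
      using that by (intro g_hom overlap_hom single_vec_mem) auto
    then have "g (single_vec t l 1) = overlap s t (g (single_vec s l 1))" using that by (simp add: overlap_single)
    from fun_cong[OF fun_cong[OF this, of t], of k] show ?thesis by (simp add: overlap_def G_def)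
  qed
  \<comment> \<open>Dually, if the map kills the basis vector at \<open>l\<close>, it must also kill
    the image of this vector under \<open>g\<close>; the rows that survive in \<open>t\<close> are
    therefore zero.\<close>
  have G_target: "G s k l = 0"
    if "s \<in> S" "t \<in> S" "fst t \<le> fst s" "snd t \<le> snd s" "snd t < l" "l \<le> snd s" "fst s \<le> k" "k \<le> snd t"
    for s t k l
  proof -
    have "g (overlap s t (single_vec s l 1)) = overlap s t (g (single_vec s l 1))"
      using that by (intro g_hom overlap_hom single_vec_mem) auto
    then have "(\<lambda>_ _. 0) = overlap s t (g (single_vec s l 1))" using that by (simp add: overlap_single g_zero)
    from fun_cong[OF fun_cong[OF this, of t], of k] show ?thesis using that by (simp add: overlap_def G_def)
  qed
  \<comment> \<open>All blocks are cut out of the block of the full interval. The measure drops on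
    passing to a longer neighbour with a common start or end, and such neighbours exist until the
    full interval is reached.\<close>
  have G_P: "G s k l = G ?P k l" if "s \<in> S" "fst s \<le> k" "k \<le> snd s" "fst s \<le> l" "l \<le> snd s" for s k l
    using that
  proof (induction "fst s + (n - snd s)" arbitrary: s rule: less_induct)
    case less
    obtain i j where s: "s = (i, j)" by (cases s)
    show ?case
    proof (cases "s = ?P")
      case False
      have j: "j < n" using S_bounds[OF less.prems(1)] s by simp
      from balanced_set_extend[OF bal, of i j] less.prems(1) False s
      consider c where "c < i" "(c, j) \<in> S" | d where "d > j" "(i, d) \<in> S" unfolding m_def by blast
      then show ?thesis
      proof cases
        case 1
        have "G (c, j) k l = G s k l"
          using G_source[OF less.prems(1) 1(2)] 1 less.prems s by simp
        moreover have "G (c, j) k l = G ?P k l"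
          using less.hyps[of "(c, j)"] 1 less.prems s by simp
        ultimately show ?thesis by simp
      next
        case 2
        have "G s k l = G (i, d) k l"
          using G_source[OF 2(2) less.prems(1)] 2 less.prems s by simp
        moreover have "G (i, d) k l = G ?P k l"
          using less.hyps[of "(i, d)"] 2 less.prems s j by simp
        ultimately show ?thesis by simp
      qed
    qed simp
  qed
  \<comment> \<open>With a common end, row \<open>k\<close> lies before the shorter interval and
    \<open>G_source\<close> gives zero; with a common start, column \<open>l\<close> lies beyond the
    shorter interval and \<open>G_target\<close> applies.\<close>
  have upper: "G ?P k l = 0" if kl: "k < l" "l < n" for k l
    using balanced_set_separates[OF bal kl]
  proof
    assume "\<exists>c a b. (c, b) \<in> S \<and> (a, b) \<in> S \<and> c \<le> k \<and> k < a \<and> a \<le> l \<and> l \<le> b"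
    then obtain c a b where *: "(c, b) \<in> S" "(a, b) \<in> S" "c \<le> k" "k < a" "a \<le> l" "l \<le> b" by blast
    have "G (c, b) k l = 0" using G_source[OF *(2,1), of l k] * by simp
    then show ?thesis using G_P[OF *(1), of k l] * kl by simp
  next
    assume "\<exists>c d b. (c, d) \<in> S \<and> (c, b) \<in> S \<and> c \<le> k \<and> k \<le> d \<and> d < l \<and> l \<le> b"
    then obtain c d b where *: "(c, d) \<in> S" "(c, b) \<in> S" "c \<le> k" "k \<le> d" "d < l" "l \<le> b" by blast
    have "G (c, b) k l = 0" using G_target[OF *(2,1), of l k] * by simp
    then show ?thesis using G_P[OF *(2), of k l] * kl by simp
  qed
  define A where "A = mat n n (\<lambda>(k, l). if l \<le> k then G ?P k l else 0)"
  have A: "A \<in> carrier (LT n)" by (auto simp: A_def LT_carrier_iff)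
  interpret left_module "LT n" M by (rule left_module_M)
  have "g y = A \<odot> y" if "y \<in> carrier M" for y
    using that
  proof (induction rule: M_induct)
    case zero
    then show ?case using smult_zero[OF A] g_zero by (simp add: M_zero)
  next
    case (add y z)
    then show ?case using g_add smult_r_distr[OF A, of y z] by (simp add: M_add)
  next
    case (single_vec s l c)
    have "single_vec s l c = (\<lambda>t k. c * single_vec s l 1 t k)" by (auto simp: single_vec_def fun_eq_iff)
    then have "g (single_vec s l c) = (\<lambda>t k. c * g (single_vec s l 1) t k)"
      using g_hom[OF scaling_hom single_vec_mem[OF single_vec]] by simp
    moreover have "c * g (single_vec s l 1) t k =
      (if t = s \<and> fst s \<le> k \<and> k \<le> snd s then A $$ (k, l) * c else 0)" for t k
    proof (cases "t = s \<and> fst s \<le> k \<and> k \<le> snd s")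
      case True
      then have "k < n" "l < n" using S_bounds[OF single_vec(1)] single_vec(3) by auto
      then have "A $$ (k, l) = G s k l"
        using G_P[OF single_vec(1), of k l] upper[of k l] True single_vec by (auto simp: A_def not_le)
      then show ?thesis using True by (simp add: G_def)
    next
      case False
      have "g (single_vec s l 1) \<in> carrier M" by (intro g_closed single_vec_mem single_vec)
      then have "g (single_vec s l 1) s k = 0" if "\<not> (fst s \<le> k \<and> k \<le> snd s)"
        using M_nonzero[of "g (single_vec s l 1)" s k] that by blast
      then show ?thesis using False G_off[OF single_vec, of t k] by auto
    qed
    ultimately show ?case unfolding smult_single[OF A single_vec] by simp
  qed
  then show "\<exists>a\<in>carrier (LT n). \<forall>y\<in>carrier M. g y = a \<odot> y" using A by blast
qed


subsection \<open>The combinatorial conditions are necessary\<close>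

lemma balanced_set_if_faithfully_balanced:
  assumes n: "1 \<le> n" and fb: "faithfully_balanced (LT n) M"
  shows "balanced_set n S"
proof -
  define m where "m = n - 1"
  have m: "m < n" "\<And>k. k < n \<Longrightarrow> k \<le> m" using n by (auto simp: m_def)
  let ?P = "(0, m)"
  interpret left_module "LT n" M by (rule left_module_M)
  have faithful: "A = B" if "A \<in> carrier (LT n)" "B \<in> carrier (LT n)"
    "\<And>y. y \<in> carrier M \<Longrightarrow> A \<odot> y = B \<odot> y" for A B
    using fb that unfolding faithfully_balanced_iff[OF left_module_M] by blast
  have double: "\<exists>A\<in>carrier (LT n). \<forall>y\<in>carrier M. g y = A \<odot> y" if "bicommutant (LT n) M g" for g
    using fb that unfolding faithfully_balanced_iff[OF left_module_M] by blast
  have P: "?P \<in> S"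
  proof (rule ccontr)
    assume nP: "?P \<notin> S"
    \<comment> \<open>The path from the first to the last vertex is zero on every proper interval,
      so without the full interval it contradicts faithfulness.\<close>
    have "unit_mat n m 0 1 \<odot> y = 0\<^sub>m n n \<odot> y" if y: "y \<in> carrier M" for y
    proof -
      have "y s 0 = 0" if "m \<le> snd s" for s
      proof (rule ccontr)
        assume "y s 0 \<noteq> 0"
        then have "s \<in> S" "fst s = 0" using M_nonzero[OF y, of s 0] by auto
        moreover have "snd s = m" using S_bounds[OF \<open>s \<in> S\<close>] m(2)[of "snd s"] that by linarith
        ultimately show False using nP by (metis prod.collapse)
      qed
      then have "unit_mat n m 0 1 \<odot> y = \<zero>"
        unfolding M_unit[OF y le0] M_zero by (auto simp: fun_eq_iff)
      then show ?thesis using zero_smult[OF y] by simp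
    qed
    then have "unit_mat n m 0 1 = (0\<^sub>m n n :: 'k mat)"
      using R.zero_closed by (intro faithful) auto
    then have "unit_mat n m 0 1 $$ (m, 0) = (0\<^sub>m n n :: 'k mat) $$ (m, 0)" by simp
    then show False using n m(1) by simp
  qed
  have extend: "(\<exists>c<a. (c, b) \<in> S) \<or> (\<exists>d>b. (a, d) \<in> S)" if s: "(a, b) \<in> S" "(a, b) \<noteq> ?P" for a b
  proof (rule ccontr)
    assume "\<not> ?thesis"
    then have left: "\<And>c. c < a \<Longrightarrow> (c, b) \<notin> S" and right: "\<And>d. d > b \<Longrightarrow> (a, d) \<notin> S"
      by blast+
    have ab: "a \<le> b" "b < n" "a \<le> m" "b \<le> m" using S_bounds[OF s(1)] m(2)[of a] m(2)[of b] by auto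
    \<comment> \<open>Top to socle on the summand \<open>(a, b)\<close>, zero elsewhere. It commutes
      with \<open>f\<close> because \<open>f\<close> multiplies the top coordinate
      (\<open>f_a\<close>) and the socle vector (\<open>f_b\<close>) by one and the same scalar,
      with no contribution from or to other summands.\<close>
    define g where "g y = single_vec (a, b) b (y (a, b) a)" for y :: "nat \<times> nat \<Rightarrow> nat \<Rightarrow> 'k"
    have "bicommutant (LT n) M g"
      unfolding bicommutant_def
    proof (intro conjI ballI allI impI)
      show "g \<in> carrier M \<rightarrow> carrier M" using single_vec_mem[OF s(1), of b] ab by (auto simp: g_def)
      show "g (y \<oplus> z) = g y \<oplus> g z" for y z
        by (auto simp: g_def M_add single_vec_def fun_eq_iff)
      fix f y assume f: "lmod_hom (LT n) M M f" and y: "y \<in> carrier M"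
      note f_unit = hom_unit[OF f]
      define w where "w = f (single_vec (a, b) a 1)"
      have ea: "single_vec (a, b) a 1 \<in> carrier M" using single_vec_mem[OF s(1)] ab by auto
      have w: "w \<in> carrier M" unfolding w_def by (rule lmod_hom_closed[OF f ea])
      have f_b: "f (single_vec (a, b) b c) = single_vec (a, b) b (c * w (a, b) a)" for c
      proof -
        have "single_vec (a, b) b c = unit_mat n b a c \<odot> single_vec (a, b) a 1"
          using M_unit[OF ea, of a b c] ab by (auto simp: single_vec_def fun_eq_iff)
        then have 1: "f (single_vec (a, b) b c) = (\<lambda>t m. if m = b \<and> b \<le> snd t then c * w t a else 0)"
          using f_unit[OF _ ea, of a b c] ab unfolding w_def by simp
        have "w t a = 0" if t: "t \<noteq> (a, b)" "b \<le> snd t" for t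
        proof (rule ccontr)
          \<comment> \<open>Such a \<open>t\<close> starts at or before \<open>a\<close> and, by
            \<open>left\<close>, does not end at \<open>b\<close>, so it reaches
            \<open>Suc b\<close>. The path from \<open>a\<close> to \<open>Suc b\<close> is nonzero
            on \<open>t\<close> but kills the vector in \<open>(a, b)\<close>.\<close>
          assume wt: "w t a \<noteq> 0"
          then have tS: "t \<in> S" "fst t \<le> a" using M_nonzero[OF w] by auto
          have "snd t \<noteq> b"
            using left[of "fst t"] t(1) tS by (metis le_neq_implies_less prod.collapse)
          then have t': "Suc b \<le> snd t" "Suc b < n" using t(2) S_bounds[OF tS(1)] by auto
          have "unit_mat n (Suc b) a 1 \<odot> single_vec (a, b) a 1 = \<zero>"
            using M_unit[OF ea, of a "Suc b" 1] ab by (auto simp: single_vec_def fun_eq_iff M_zero)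
          then have "(\<lambda>t m. if m = Suc b \<and> Suc b \<le> snd t then 1 * w t a else 0) = (\<lambda>_ _. 0)"
            using f_unit[OF _ ea, of a "Suc b" 1] ab lmod_hom_zero[OF left_module_M left_module_M f]
            unfolding w_def by (simp add: M_zero)
          from fun_cong[OF fun_cong[OF this, of t], of "Suc b"] show False using wt t' by simp
        qed
        then show ?thesis unfolding 1 using ab by (auto simp: single_vec_def fun_eq_iff)
      qed
      have f_a: "f y (a, b) a = w (a, b) a * y (a, b) a"
        using y
      proof (induction rule: M_induct)
        case zero
        then show ?case using lmod_hom_zero[OF left_module_M left_module_M f] by (simp add: M_zero)
      next
        case (add y z)
        then show ?case using lmod_hom_add[OF f, of y z] by (simp add: M_add algebra_simps)
      next
        case (single_vec t l c)
        have mem: "single_vec t l c \<in> carrier M" by (rule single_vec_mem[OF single_vec])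
        have loc: "single_vec t l c = unit_mat n l l 1 \<odot> single_vec t l c"
          using M_unit[OF mem order_refl] single_vec by (auto simp: single_vec_def fun_eq_iff)
        \<comment> \<open>Besides the summand itself: a vector at another vertex stays there; if
          \<open>t\<close> starts before \<open>a\<close>, the vector comes from vertex
          \<open>a - 1\<close>, where \<open>(a, b)\<close> is zero; if \<open>t\<close> starts at
          \<open>a\<close>, it ends before \<open>b\<close> by \<open>right\<close>, so the path to
          \<open>b\<close> kills the vector but is injective at \<open>a\<close> on
          \<open>(a, b)\<close>.\<close>
        consider "l \<noteq> a" | "t = (a, b)" "l = a" | "t \<noteq> (a, b)" "l = a" "fst t < a" | "t \<noteq> (a, b)" "l = a" "fst t = a"
          using single_vec by fastforce
        then show ?case
        proof cases
          case 1
          have "f (single_vec t l c) = f (unit_mat n l l 1 \<odot> single_vec t l c)"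
            using loc by (rule arg_cong)
          also have "\<dots> = (\<lambda>s m. if m = l \<and> l \<le> snd s then 1 * f (single_vec t l c) s l else 0)"
            by (rule f_unit[OF order_refl mem])
          finally have "f (single_vec t l c) (a, b) a = 0"
            using 1 fun_cong[of "f (single_vec t l c)" _ "(a, b)"] by (metis (no_types, lifting))
          then show ?thesis using 1 by (simp add: single_vec_def)
        next
          case 2
          have "single_vec t l c = unit_mat n a a c \<odot> single_vec (a, b) a 1"
            using M_unit[OF ea order_refl, of a c] ab 2 by (auto simp: single_vec_def fun_eq_iff)
          then have "f (single_vec t l c) (a, b) a = c * w (a, b) a"
            using f_unit[OF order_refl ea, of a c] ab by (simp add: w_def)
          then show ?thesis using 2 by (simp add: single_vec_def)
        next
          case 3
          then obtain a' where a': "a = Suc a'" by (cases a) auto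
          have mem': "single_vec t a' 1 \<in> carrier M" using single_vec 3 a' by (intro single_vec_mem) auto
          have "single_vec t l c = unit_mat n a a' c \<odot> single_vec t a' 1"
            using M_unit[OF mem', of a' a c] 3 single_vec a' by (auto simp: single_vec_def fun_eq_iff)
          then have "f (single_vec t l c) (a, b) a = c * f (single_vec t a' 1) (a, b) a'"
            using f_unit[OF _ mem', of a' a c] ab a' by simp
          also have "f (single_vec t a' 1) (a, b) a' = 0"
          proof (rule ccontr)
            assume "f (single_vec t a' 1) (a, b) a' \<noteq> 0"
            then show False using M_nonzero[OF lmod_hom_closed[OF f mem'], of "(a, b)" a'] a' by simp
          qed
          finally show ?thesis using 3 by (simp add: single_vec_def)
        next
          case 4
          have "snd t \<noteq> b" using 4 by (metis prod.collapse)
          moreover have "\<not> b < snd t" using right[of "snd t"] single_vec(1) 4 by (metis prod.collapse)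
          ultimately have tb: "snd t < b" by simp
          have "unit_mat n b a 1 \<odot> single_vec t l c = \<zero>"
            using M_unit[OF mem, of a b 1] ab tb by (auto simp: single_vec_def fun_eq_iff M_zero)
          then have "(\<lambda>s m. if m = b \<and> b \<le> snd s then 1 * f (single_vec t l c) s a else 0) = (\<lambda>_ _. 0)"
            using f_unit[OF _ mem, of a b 1] ab lmod_hom_zero[OF left_module_M left_module_M f]
            by (simp add: M_zero)
          from fun_cong[OF fun_cong[OF this, of "(a, b)"], of b] show ?thesis
            using 4 by (simp add: single_vec_def)
        qed
      qed
      show "g (f y) = f (g y)" unfolding g_def f_a f_b by (simp add: mult.commute)
    qed
    then obtain A where A: "A \<in> carrier (LT n)" "\<And>y. y \<in> carrier M \<Longrightarrow> g y = A \<odot> y"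
      using double by blast
    \<comment> \<open>As a multiplication, \<open>g\<close> would have \<open>1\<close> at
      \<open>(b, a)\<close> because of the summand \<open>(a, b)\<close> and \<open>0\<close>
      because of the full interval.\<close>
    have "single_vec (a, b) b 1 (a, b) b = A $$ (b, a) * 1"
    proof -
      have "g (single_vec (a, b) a 1) = A \<odot> single_vec (a, b) a 1"
        using A(2) single_vec_mem[OF s(1), of a 1] ab by simp
      then have "single_vec (a, b) b 1 = A \<odot> single_vec (a, b) a 1" by (simp add: g_def) (simp add: single_vec_def)
      then show ?thesis using smult_single[OF A(1) s(1), of a 1] ab by simp
    qed
    moreover have "A $$ (b, a) * 1 = 0"
    proof -
      have "g (single_vec ?P a 1) = A \<odot> single_vec ?P a 1"
        using A(2) single_vec_mem[OF P, of a 1] ab by simp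
      moreover have "g (single_vec ?P a 1) ?P b = 0" using s(2) by (auto simp: g_def single_vec_def)
      ultimately show ?thesis using smult_single[OF A(1) P, of a 1] ab by simp
    qed
    ultimately show False by (simp add: single_vec_def)
  qed
  have vertex: "(\<exists>d. (Suc i, d) \<in> S) \<or> (\<exists>c. (c, i) \<in> S)" if l: "Suc i < n" for i
  proof (rule ccontr)
    assume "\<not> ?thesis"
    then have start: "\<And>t. t \<in> S \<Longrightarrow> fst t \<noteq> Suc i" and stop: "\<And>t. t \<in> S \<Longrightarrow> snd t \<noteq> i"
      by (metis prod.collapse)+
    let ?l = "Suc i"
    \<comment> \<open>The inverse of the arrow from \<open>i\<close> to \<open>Suc i\<close>, zero
      at all other vertices. On every summand that arrow is onto because nothing starts at
      \<open>Suc i\<close>, and injective because nothing ends at \<open>i\<close>.\<close>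
    define g where "g y = (\<lambda>t k. if k = i then y t ?l else 0)" for y :: "nat \<times> nat \<Rightarrow> nat \<Rightarrow> 'k"
    have g_mem: "g y \<in> carrier M" if "y \<in> carrier M" for y
      unfolding M_carrier
    proof (intro allI impI)
      fix t k assume "g y t k \<noteq> 0"
      then have "k = i" "y t ?l \<noteq> 0" by (auto simp: g_def split: if_splits)
      moreover from this have t: "t \<in> S" "fst t \<le> ?l" "?l \<le> snd t" using M_nonzero[OF that] by auto
      ultimately show "t \<in> S \<and> fst t \<le> k \<and> k \<le> snd t" using start[OF t(1)] by auto
    qed
    have "bicommutant (LT n) M g"
      unfolding bicommutant_def
    proof (intro conjI ballI allI impI)
      show "g \<in> carrier M \<rightarrow> carrier M" using g_mem by blast
      show "g (y \<oplus> z) = g y \<oplus> g z" for y z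
        by (auto simp: g_def M_add fun_eq_iff)
      fix f y assume f: "lmod_hom (LT n) M M f" and y: "y \<in> carrier M"
      note f_unit = hom_unit[OF f]
      let ?x = "g y"
      have le: "i \<le> ?l" by simp
      have above: "y t ?l = 0" if "\<not> i \<le> snd t" for t using M_nonzero[OF y, of t ?l] that by fastforce
      \<comment> \<open>The arrow carries \<open>g y\<close> to the component of \<open>y\<close> at
        \<open>?l\<close>. Applying \<open>f\<close> preserves this relation and hence determines
        \<open>f (g y)\<close> wherever the interval reaches \<open>?l\<close>.\<close>
      have "unit_mat n ?l i 1 \<odot> ?x = unit_mat n ?l ?l 1 \<odot> y"
        unfolding M_unit[OF g_mem[OF y] le] M_unit[OF y order_refl] by (auto simp: g_def fun_eq_iff)
      then have "f (unit_mat n ?l i 1 \<odot> ?x) = f (unit_mat n ?l ?l 1 \<odot> y)" by (rule arg_cong)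
      then have 1: "(\<lambda>s m. if m = ?l \<and> ?l \<le> snd s then 1 * f ?x s i else 0)
          = (\<lambda>s m. if m = ?l \<and> ?l \<le> snd s then 1 * f y s ?l else 0)"
        unfolding f_unit[OF le g_mem[OF y]] f_unit[OF order_refl y] .
      have "?x = unit_mat n (i) i 1 \<odot> ?x"
        unfolding M_unit[OF g_mem[OF y] order_refl] using above by (auto simp: g_def fun_eq_iff)
      then have "f ?x = f (unit_mat n i i 1 \<odot> ?x)" by (rule arg_cong)
      then have 2: "f ?x = (\<lambda>s m. if m = i \<and> i \<le> snd s then 1 * f ?x s i else 0)"
        unfolding f_unit[OF order_refl g_mem[OF y]] .
      show "g (f y) = f (g y)"
      proof (intro ext)
        fix t k
        show "g (f y) t k = f ?x t k"
        proof (cases "k = i")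
          case True
          have 3: "f y t ?l = f ?x t i" if "?l \<le> snd t"
            using fun_cong[OF fun_cong[OF 1, of t], of ?l] that by simp
          show ?thesis
          proof (cases "?l \<le> snd t")
            case True
            then show ?thesis using 3 \<open>k = i\<close> by (simp add: g_def)
          next
            case False
            have "f y t ?l = 0" using M_nonzero[OF lmod_hom_closed[OF f y], of t ?l] False by blast
            \<comment> \<open>An interval that contains \<open>i\<close> but not \<open>?l\<close>
              would end at \<open>i\<close>, which \<open>stop\<close> excludes.\<close>
            moreover have "f ?x t i = 0"
            proof (rule ccontr)
              assume "f ?x t i \<noteq> 0"
              then have "t \<in> S" "i \<le> snd t"
                using M_nonzero[OF lmod_hom_closed[OF f g_mem[OF y]], of t i] by auto
              then show False using stop[of t] False by linarith
            qed
            ultimately show ?thesis using \<open>k = i\<close> by (simp add: g_def)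
          qed
        next
          case False
          then show ?thesis using fun_cong[OF fun_cong[OF 2, of t], of k] by (simp add: g_def)
        qed
      qed
    qed
    then obtain A where A: "A \<in> carrier (LT n)" "\<And>y. y \<in> carrier M \<Longrightarrow> g y = A \<odot> y"
      using double by blast
    have "g (single_vec ?P ?l 1) = A \<odot> single_vec ?P ?l 1"
      using A(2) single_vec_mem[OF P, of ?l 1] l m by simp
    then have "g (single_vec ?P ?l 1) ?P (i) = A $$ (i, ?l) * 1"
      using smult_single[OF A(1) P, of ?l 1] l m by simp
    \<comment> \<open>The inverse arrow would need an entry just above the diagonal.\<close>
    moreover have "A $$ (i, ?l) = 0" using LT_index_0[OF A(1), of i ?l] l m by simp
    ultimately show False by (simp add: g_def single_vec_def)
  qed
  show ?thesis
    unfolding balanced_set_def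
  proof (intro conjI allI impI)
    show "(\<exists>d. (l, d) \<in> S) \<or> (\<exists>c. (c, l - 1) \<in> S)" if "0 < l \<and> l < n" for l
      using vertex[of "l - 1"] that by simp
    show "(i, j) = (0, n - 1) \<or> (\<exists>c<i. (c, j) \<in> S) \<or> (\<exists>d>j. (i, d) \<in> S)" if "(i, j) \<in> S" for i j
      using extend[OF that] unfolding m_def by blast
  qed (use S P in \<open>simp_all add: m_def\<close>)
qed

end


section \<open>Isomorphism classes\<close>

lemma interval_sum_nonzero:
  "y \<in> carrier (interval_sum I iv) \<Longrightarrow> y s k \<noteq> 0 \<Longrightarrow> s \<in> I \<and> fst (iv s) \<le> k \<and> k \<le> snd (iv s)"
  unfolding interval_sum_simps by blast

text \<open>For a basic module distinct summands have distinct intervals, so the submodules can be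
  replaced as indices by the intervals themselves.\<close>

lemma interval_sum_reindex:
  assumes inj: "inj_on iv D" and iv: "\<And>N. N \<in> D \<Longrightarrow> snd (iv N) < n"
  shows "isomorphic (LT n) (interval_sum (iv ` D) id :: ('k::field mat, _) module) (interval_sum D iv)"
proof -
  let ?S = "interval_sum (iv ` D) id :: ('k mat, _) module" and ?T = "interval_sum D iv :: ('k mat, _) module"
  have S: "left_module (LT n) ?S" using iv by (intro left_module_interval_sum) auto
  define f where "f y = (\<lambda>N. if N \<in> D then y (iv N) else (\<lambda>_. 0 :: 'k))" for y :: "nat \<times> nat \<Rightarrow> nat \<Rightarrow> 'k"
  have closed: "f y \<in> carrier ?T" if y: "y \<in> carrier ?S" for y
    using interval_sum_nonzero[OF y] by (simp add: f_def)
  have "lmod_hom (LT n) ?S ?T f"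
  proof (rule lmod_homI[OF closed])
  qed (auto simp: f_def fun_eq_iff)
  moreover have "bij_betw f (carrier ?S) (carrier ?T)"
    unfolding bij_betw_def
  proof
    show "inj_on f (carrier ?S)"
    proof (rule inj_onI)
      fix y z assume yz: "y \<in> carrier ?S" "z \<in> carrier ?S" "f y = f z"
      show "y = z"
      proof
        fix p show "y p = z p"
        proof (cases "p \<in> iv ` D")
          case True
          then obtain N where "N \<in> D" "p = iv N" by blast
          then show ?thesis using fun_cong[OF yz(3), of N] by (simp add: f_def)
        next
          case False
          then have "y p k = 0" "z p k = 0" for k
            using interval_sum_nonzero[OF yz(1), of p k] interval_sum_nonzero[OF yz(2), of p k] by blast+
          then show ?thesis by (simp add: fun_eq_iff)
        qed
      qed
    qed
    show "f ` carrier ?S = carrier ?T"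
    proof
      show "f ` carrier ?S \<subseteq> carrier ?T" using closed by blast
      show "carrier ?T \<subseteq> f ` carrier ?S"
      proof
        fix y assume y: "y \<in> carrier ?T"
        define z where "z p = (if p \<in> iv ` D then y (the_inv_into D iv p) else (\<lambda>_. 0))" for p
        have zN: "z (iv N) = y N" if "N \<in> D" for N
          using that by (simp add: z_def the_inv_into_f_f[OF inj])
        have "z \<in> carrier ?S"
          unfolding interval_sum_simps
        proof (intro allI impI)
          fix p k assume zp: "z p k \<noteq> 0"
          then have "p \<in> iv ` D" unfolding z_def by (metis (full_types))
          then obtain N where "N \<in> D" "p = iv N" by blast
          then show "p \<in> iv ` D \<and> fst (id p) \<le> k \<and> k \<le> snd (id p)" using zp zN[of N] interval_sum_nonzero[OF y, of N k] by simp
        qed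
        moreover have "f z = y"
        proof
          fix N show "f z N = y N"
          proof (cases "N \<in> D")
            case False
            then have "y N k = 0" for k using interval_sum_nonzero[OF y, of N k] by blast
            then show ?thesis using False by (simp add: f_def fun_eq_iff)
          qed (simp add: f_def zN)
        qed
        ultimately show "y \<in> f ` carrier ?S" by blast
      qed
    qed
  qed
  ultimately show ?thesis using isomorphic_iff[OF S] unfolding lmod_iso_def by blast
qed

text \<open>One top vector per summand generates, since paths from the start of an interval reach
  all its basis vectors.\<close>

lemma finitely_generated_interval_sum:
  assumes M: "left_module (LT n) M" and I: "finite I"
    and iv: "\<And>s. s \<in> I \<Longrightarrow> fst (iv s) \<le> snd (iv s) \<and> snd (iv s) < n"
    and iso: "isomorphic (LT n) (interval_sum I iv :: ('k::field mat, _) module) M"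
  shows "finitely_generated (LT n) M"
proof -
  let ?S = "interval_sum I iv :: ('k mat, _) module"
  have iv': "snd (iv s) < n" if "s \<in> I" for s using iv[OF that] by simp
  have S: "left_module (LT n) ?S" by (rule left_module_interval_sum[OF iv'])
  obtain \<phi> where \<phi>: "lmod_iso (LT n) ?S M \<phi>" using iso isomorphic_iff[OF S] by blast
  then have hom: "lmod_hom (LT n) ?S M \<phi>" and onto: "\<phi> ` carrier ?S = carrier M"
    by (auto simp: lmod_iso_def bij_betw_def)
  define e where "e s = single_vec s (fst (iv s)) (1::'k)" for s
  have e: "e s \<in> carrier ?S" if "s \<in> I" for s using iv[OF that] that by (auto simp: e_def single_vec_def)
  show ?thesis
  proof (rule finitely_generatedI[OF M, of "(\<lambda>s. \<phi> (e s)) ` I"])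
    show "finite ((\<lambda>s. \<phi> (e s)) ` I)" using I by simp
    show "(\<lambda>s. \<phi> (e s)) ` I \<subseteq> carrier M" using e lmod_hom_closed[OF hom] by blast
  next
    fix N assume N: "submodule N (LT n) M" "(\<lambda>s. \<phi> (e s)) ` I \<subseteq> N"
    have "\<phi> y \<in> N" if "y \<in> carrier ?S" for y
      using I that
    proof (induction rule: interval_sum_induct)
      case zero
      then show ?case
        using lmod_hom_zero[OF S M hom] left_module.submodule_zero[OF M N(1)] by simp
    next
      case (add y z)
      then show ?case
        using lmod_hom_add[OF hom, of y z] left_module.submodule_add[OF M N(1)] by simp
    next
      case (single_vec s l c)
      have "unit_mat n l (fst (iv s)) c \<odot>\<^bsub>?S\<^esub> e s =
        (\<lambda>t m. if m = l \<and> l \<le> snd (iv t) then c * e s t (fst (iv s)) else 0)"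
        using e[OF single_vec(1)] iv' single_vec(2) by (rule unit_mat_smult_sum)
      also have "\<dots> = single_vec s l c" using single_vec(3) by (auto simp: e_def single_vec_def fun_eq_iff)
      finally have eq: "unit_mat n l (fst (iv s)) c \<odot>\<^bsub>?S\<^esub> e s = single_vec s l c" .
      have U: "unit_mat n l (fst (iv s)) c \<in> carrier (LT n)" using single_vec(2) by simp
      have "\<phi> (single_vec s l c) = unit_mat n l (fst (iv s)) c \<odot>\<^bsub>M\<^esub> \<phi> (e s)"
        using lmod_hom_smult[OF hom U e[OF single_vec(1)]] eq by simp
      then show ?case
        using left_module.submodule_smult[OF M N(1) U] N(2) single_vec(1) by auto
    qed
    then show "carrier M \<subseteq> N" unfolding onto[symmetric] by (rule image_subsetI)
  qed
qed

section \<open>From modules to sets of intervals and back\<close>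

lemma summands_with_top:
  fixes M :: "('k::field mat, 'a) module"
  assumes M: "left_module (LT n) M" and D: "indecomposable_decomposition (LT n) M D"
    and iv: "\<And>N. N \<in> D \<Longrightarrow> fst (iv N) \<le> snd (iv N) \<and> snd (iv N) < n"
    and iso: "\<And>N. N \<in> D \<Longrightarrow> isomorphic (LT n) (interval_module (fst (iv N)) (snd (iv N))) (restrict_to M N)"
    and i: "i < n"
  shows "{N \<in> D. isomorphic (LT n) (top_of (LT n) (restrict_to M N)) (simple_module (Suc i) :: ('k mat, 'k) module)}
    = {N \<in> D. fst (iv N) = i}"
proof -
  have sub: "submodule N (LT n) M" if "N \<in> D" for N
    using D that by (simp add: indecomposable_decomposition_def)
  have "isomorphic (LT n) (top_of (LT n) (restrict_to M N)) (simple_module (Suc i) :: ('k mat, 'k) module)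
      \<longleftrightarrow> fst (iv N) = i" if N: "N \<in> D" for N
    using iv[OF N] by (intro top_of_interval[OF left_module_restrict_to[OF M sub[OF N]] _ _ iso[OF N] i]) auto
  then show ?thesis by blast
qed

definition summand_counts :: "nat \<Rightarrow> (nat \<Rightarrow> nat) \<Rightarrow> (nat \<times> nat) set set" where
  "summand_counts n t = {S. balanced_set n S \<and> (\<forall>i<n. card {s \<in> S. fst s = i} = t (Suc i))}"

lemma balanced_set_subset: "balanced_set n S \<Longrightarrow> S \<subseteq> {(i, j). i \<le> j \<and> j < n}"
  by (simp add: balanced_set_def)

lemma exists_balanced_set:
  fixes M :: "('k::field mat, 'a) module"
  assumes n: "1 \<le> n" and M: "left_module (LT n) M" and basic: "basic (LT n) M"
    and fb: "faithfully_balanced (LT n) M"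
    and tops: "\<And>i. i \<in> {1..n} \<Longrightarrow>
      has_summands_with_top (LT n) M (simple_module i :: ('k mat, 'k) module) (t i)"
  shows "\<exists>S\<in>summand_counts n t. isomorphic (LT n) (interval_sum S id :: ('k mat, _) module) M"
proof -
  obtain D where D: "indecomposable_decomposition (LT n) M D"
    and mult_free: "\<And>X Y. X \<in> D \<Longrightarrow> Y \<in> D \<Longrightarrow>
      isomorphic (LT n) (restrict_to M X) (restrict_to M Y) \<Longrightarrow> X = Y"
    using basic unfolding basic_def by blast
  obtain iv \<phi> where iv: "\<And>N. N \<in> D \<Longrightarrow> fst (iv N) \<le> snd (iv N) \<and> snd (iv N) < n"
    and summand: "\<And>N. N \<in> D \<Longrightarrow> isomorphic (LT n) (interval_module (fst (iv N)) (snd (iv N))) (restrict_to M N)"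
    and \<phi>: "lmod_iso (LT n) (interval_sum D iv) M \<phi>"
    using decomposition_imp_interval_sum[OF M D] by blast
  have sub: "submodule N (LT n) M" if "N \<in> D" for N
    using D that by (simp add: indecomposable_decomposition_def)
  have fin: "finite D" using D by (simp add: indecomposable_decomposition_def)
  have inj: "inj_on iv D"
  proof (rule inj_onI)
    fix X Y assume XY: "X \<in> D" "Y \<in> D" "iv X = iv Y"
    let ?I = "interval_module (fst (iv X)) (snd (iv X)) :: ('k mat, _) module"
    have I: "left_module (LT n) ?I" using iv[OF XY(1)] by (intro left_module_interval_module) simp
    have X: "left_module (LT n) (restrict_to M X)" by (rule left_module_restrict_to[OF M sub[OF XY(1)]])
    have "isomorphic (LT n) (restrict_to M X) ?I"
      by (rule isomorphic_sym[OF I X summand[OF XY(1)]])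
    moreover have "isomorphic (LT n) ?I (restrict_to M Y)" using summand[OF XY(2)] XY(3) by simp
    ultimately have "isomorphic (LT n) (restrict_to M X) (restrict_to M Y)"
      by (rule isomorphic_trans[OF X I])
    then show "X = Y" by (rule mult_free[OF XY(1,2)])
  qed
  define S where "S = iv ` D"
  have S: "S \<subseteq> {(i, j). i \<le> j \<and> j < n}"
  proof
    fix p assume "p \<in> S"
    then obtain N where "N \<in> D" "p = iv N" unfolding S_def by blast
    then show "p \<in> {(i, j). i \<le> j \<and> j < n}" using iv by (simp add: case_prod_beta)
  qed
  have finS: "finite S" using fin by (simp add: S_def)
  have Sn: "fst (id s) \<le> snd (id s)" "snd (id s) < n" if "s \<in> S" for s using S that by auto
  let ?S = "interval_sum S id :: ('k mat, _) module"
  have lmS: "left_module (LT n) ?S" by (rule left_module_interval_sum[OF Sn(2)])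
  have lmD: "left_module (LT n) (interval_sum D iv :: ('k mat, _) module)"
    using iv by (intro left_module_interval_sum) auto
  have "isomorphic (LT n) ?S (interval_sum D iv)"
    unfolding S_def using inj iv by (intro interval_sum_reindex) auto
  moreover have "isomorphic (LT n) (interval_sum D iv) M" using \<phi> isomorphic_iff[OF lmD] by blast
  ultimately have iso: "isomorphic (LT n) ?S M" by (rule isomorphic_trans[OF lmS lmD])
  have "faithfully_balanced (LT n) ?S"
    by (rule faithfully_balanced_isomorphic[OF M lmS isomorphic_sym[OF lmS M iso] fb])
  then have bal: "balanced_set n S" by (rule balanced_set_if_faithfully_balanced[OF S n])
  have "card {s \<in> S. fst s = i} = t (Suc i)" if i: "i < n" for i
  proof -
    have "Suc i \<in> {1..n}" using i by simp
    \<comment> \<open>The decomposition \<open>D'\<close> that witnesses the count for this vertex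
      may differ from \<open>D\<close>. Both describe \<open>M\<close>, so they have equal path
      ranks, and these determine the number of summands with a given start.\<close>
    from tops[OF this] obtain D' where D': "indecomposable_decomposition (LT n) M D'"
      and card: "card {N \<in> D'. isomorphic (LT n) (top_of (LT n) (restrict_to M N))
        (simple_module (Suc i) :: ('k mat, 'k) module)} = t (Suc i)"
      unfolding has_summands_with_top_def by blast
    obtain iv' \<phi>' where iv': "\<And>N. N \<in> D' \<Longrightarrow> fst (iv' N) \<le> snd (iv' N) \<and> snd (iv' N) < n"
      and summand': "\<And>N. N \<in> D' \<Longrightarrow> isomorphic (LT n) (interval_module (fst (iv' N)) (snd (iv' N))) (restrict_to M N)"
      and \<phi>': "lmod_iso (LT n) (interval_sum D' iv') M \<phi>'"
      using decomposition_imp_interval_sum[OF M D'] by blast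
    have iv'1: "fst (iv' N) \<le> snd (iv' N)" and iv'2: "snd (iv' N) < n" if "N \<in> D'" for N
      using iv'[OF that] by auto
    have fin': "finite D'" using D' by (simp add: indecomposable_decomposition_def)
    have lmD': "left_module (LT n) (interval_sum D' iv' :: ('k mat, _) module)"
      by (rule left_module_interval_sum[OF iv'2])
    have "isomorphic (LT n) (interval_sum D' iv') M" using \<phi>' isomorphic_iff[OF lmD'] by blast
    moreover have "isomorphic (LT n) M ?S" by (rule isomorphic_sym[OF lmS M iso])
    ultimately have "isomorphic (LT n) (interval_sum D' iv') ?S" by (rule isomorphic_trans[OF lmD' M])
    then have rank: "path_rank D' iv' k l = path_rank S id k l" if "k \<le> l" "l < n" for k l
      using fin' finS iv'2 Sn(2) that by (intro path_rank_eq) auto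
    have "{N \<in> D'. isomorphic (LT n) (top_of (LT n) (restrict_to M N))
        (simple_module (Suc i) :: ('k mat, 'k) module)} = {N \<in> D'. fst (iv' N) = i}"
      by (rule summands_with_top[OF M D' iv' summand' i])
    then have "t (Suc i) = card {N \<in> D'. fst (iv' N) = i}" using card by simp
    also have "\<dots> = path_rank D' iv' i i - (if i = 0 then 0 else path_rank D' iv' (i - 1) i)"
      by (rule card_fst_eq_path_rank[OF fin' iv'1])
    also have "\<dots> = path_rank S id i i - (if i = 0 then 0 else path_rank S id (i - 1) i)"
      using i rank[of i i] rank[of "i - 1" i] by simp
    also have "\<dots> = card {s \<in> S. fst (id s) = i}"
      by (rule card_fst_eq_path_rank[OF finS Sn(1), symmetric])
    finally show ?thesis by simp
  qed
  then show ?thesis using bal iso unfolding summand_counts_def by blast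
qed

lemma exists_module:
  assumes n: "1 \<le> n" and S: "S \<in> summand_counts n t"
  shows "\<exists>M :: ('k::field mat, 'k vec) module.
    left_module (LT n) M \<and> finitely_generated (LT n) M \<and> basic (LT n) M \<and> faithfully_balanced (LT n) M \<and>
    (\<forall>i\<in>{1..n}. has_summands_with_top (LT n) M (simple_module i :: ('k mat, 'k) module) (t i)) \<and>
    isomorphic (LT n) (interval_sum S id :: ('k mat, _) module) M"
proof -
  let ?S = "interval_sum S id :: ('k mat, _) module"
  have bal: "balanced_set n S" and card: "\<And>i. i < n \<Longrightarrow> card {s \<in> S. fst s = i} = t (Suc i)"
    using S by (auto simp: summand_counts_def)
  note sub = balanced_set_subset[OF bal]
  have fin: "finite S" by (rule finite_subset[of _ "{..<n} \<times> {..<n}"]) (use sub in auto)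
  have Sn: "fst (id s) \<le> snd (id s) \<and> snd (id s) < n" if "s \<in> S" for s using sub that by auto
  have lmS: "left_module (LT n) ?S" using Sn by (intro left_module_interval_sum) auto
  \<comment> \<open>The interval sum consists of functions, whereas the classes are formed among
    modules carried by vectors; finite generation is what permits the transfer.\<close>
  have "finitely_generated (LT n) ?S"
    by (rule finitely_generated_interval_sum[OF lmS fin Sn isomorphic_refl[OF lmS]])
  then obtain M :: "('k mat, 'k vec) module" where M: "left_module (LT n) M" "isomorphic (LT n) ?S M"
    using finitely_generated_isomorphic_on_vectors[OF lmS] by blast
  have fg: "finitely_generated (LT n) M" by (rule finitely_generated_interval_sum[OF M(1) fin Sn M(2)])
  have fb: "faithfully_balanced (LT n) M"
    by (rule faithfully_balanced_isomorphic[OF lmS M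
        faithfully_balanced_if_balanced_set[OF sub n bal]])
  obtain \<phi> where \<phi>: "lmod_iso (LT n) ?S M \<phi>" using M(2) isomorphic_iff[OF lmS] by blast
  obtain X where inj: "inj_on X S" and D: "indecomposable_decomposition (LT n) M (X ` S)"
    and X: "\<And>s. s \<in> S \<Longrightarrow> isomorphic (LT n) (interval_module (fst (id s)) (snd (id s))) (restrict_to M (X s))"
    using interval_sum_decomposition[OF M(1) fin Sn \<phi>] by blast
  have subm: "submodule (X s) (LT n) M" if "s \<in> S" for s
    using D that by (simp add: indecomposable_decomposition_def)
  have "s = t" if st: "s \<in> S" "t \<in> S"
    and iso: "isomorphic (LT n) (restrict_to M (X s)) (restrict_to M (X t))" for s t
  proof -
    have I: "left_module (LT n) (interval_module (fst s) (snd s) :: ('k mat, _) module)" if "s \<in> S" for s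
      using Sn[OF that] by (intro left_module_interval_module) simp
    have R: "left_module (LT n) (restrict_to M (X s))" if "s \<in> S" for s
      by (rule left_module_restrict_to[OF M(1) subm[OF that]])
    have "isomorphic (LT n) (interval_module (fst s) (snd s) :: ('k mat, _) module) (restrict_to M (X t))"
      using isomorphic_trans[OF I[OF st(1)] R[OF st(1)] X[OF st(1), simplified] iso] .
    moreover have "isomorphic (LT n) (restrict_to M (X t)) (interval_module (fst t) (snd t))"
      using isomorphic_sym[OF I[OF st(2)] R[OF st(2)] X[OF st(2), simplified]] .
    ultimately have "isomorphic (LT n) (interval_module (fst s) (snd s) :: ('k mat, _) module)
        (interval_module (fst t) (snd t))"
      by (rule isomorphic_trans[OF I[OF st(1)] R[OF st(2)]])
    then show ?thesis
      using interval_module_isomorphic_unique Sn[OF st(1)] Sn[OF st(2)] by (metis id_apply prod_eqI)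
  qed
  then have basic: "basic (LT n) M" unfolding basic_def using D by blast
  have "has_summands_with_top (LT n) M (simple_module i :: ('k mat, 'k) module) (t i)" if i: "i \<in> {1..n}" for i
  proof -
    obtain i' where i': "i = Suc i'" "i' < n" using i by (cases i) auto
    let ?iv = "the_inv_into S X"
    have iv: "?iv (X s) = s" if "s \<in> S" for s by (rule the_inv_into_f_f[OF inj that])
    have "{N \<in> X ` S. isomorphic (LT n) (top_of (LT n) (restrict_to M N)) (simple_module (Suc i') :: ('k mat, 'k) module)}
      = {N \<in> X ` S. fst (?iv N) = i'}"
    proof (rule summands_with_top[OF M(1) D _ _ i'(2)])
      fix N assume "N \<in> X ` S"
      then obtain s where s: "s \<in> S" "N = X s" by blast
      show "fst (?iv N) \<le> snd (?iv N) \<and> snd (?iv N) < n" using Sn[OF s(1)] iv[OF s(1)] s(2) by simp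
      show "isomorphic (LT n) (interval_module (fst (?iv N)) (snd (?iv N))) (restrict_to M N)"
        using X[OF s(1)] iv[OF s(1)] s(2) by simp
    qed
    also have "\<dots> = X ` {s \<in> S. fst s = i'}" using iv by auto
    finally have "card {N \<in> X ` S. isomorphic (LT n) (top_of (LT n) (restrict_to M N))
        (simple_module (Suc i') :: ('k mat, 'k) module)} = card (X ` {s \<in> S. fst s = i'})"
      by (rule arg_cong)
    also have "\<dots> = t (Suc i')"
      using card[OF i'(2)] card_image[OF inj_on_subset[OF inj], of "{s \<in> S. fst s = i'}"] by simp
    finally show ?thesis unfolding has_summands_with_top_def i'(1) using D by (intro exI conjI)
  qed
  then show ?thesis using M fg fb basic by blast
qed

theorem theorem1p4:
  fixes n :: nat and t :: "nat \<Rightarrow> nat"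
  assumes "n \<ge> 1"
  shows
    "let \<Lambda> = lower_triangular_algebra TYPE('k::field) n;
         C = isomorphism_classes \<Lambda>
               {M :: ('k mat, 'k vec) module.
                  left_module \<Lambda> M \<and> finitely_generated \<Lambda> M \<and>
                  basic \<Lambda> M \<and> faithfully_balanced \<Lambda> M \<and>
                  (\<forall>i\<in>{1..n}. has_summands_with_top \<Lambda> M (simple_module i) (t i))}
     in finite C \<and>
        Poly_Mapping.lookup (h_poly n) (\<Sum>i=1..n. Poly_Mapping.single i (t i)) = int (card C)"
proof -
  let ?R = "LT n :: 'k mat ring"
  let ?S = "\<lambda>S. interval_sum S id :: ('k mat, _) module"
  define \<M> where "\<M> = {M :: ('k mat, 'k vec) module.
                  left_module ?R M \<and> finitely_generated ?R M \<and>
                  basic ?R M \<and> faithfully_balanced ?R M \<and>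
                  (\<forall>i\<in>{1..n}. has_summands_with_top ?R M (simple_module i) (t i))}"
  define r where "r = {(M, N) \<in> \<M> \<times> \<M>. isomorphic ?R M N}"
  have lm: "left_module ?R M" if "M \<in> \<M>" for M using that by (simp add: \<M>_def)
  have equiv: "equiv \<M> r"
  proof (rule equivI)
    show "r \<subseteq> \<M> \<times> \<M>" by (auto simp: r_def)
    show "refl_on \<M> r" using isomorphic_refl[OF lm] by (auto simp: r_def refl_on_def)
    show "sym r" using isomorphic_sym[OF lm lm] by (auto simp: r_def sym_def)
    show "trans r" using isomorphic_trans[OF lm lm] unfolding r_def trans_def by blast
  qed
  let ?B = "summand_counts n t"
  have "\<forall>S\<in>?B. \<exists>M. M \<in> \<M> \<and> isomorphic ?R (?S S) M"
    using exists_module[OF assms] unfolding \<M>_def by blast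
  then obtain rep where rep: "\<And>S. S \<in> ?B \<Longrightarrow> rep S \<in> \<M>" "\<And>S. S \<in> ?B \<Longrightarrow> isomorphic ?R (?S S) (rep S)"
    by metis
  have sub: "S \<subseteq> {(i, j). i \<le> j \<and> j < n}" if "S \<in> ?B" for S
    using that balanced_set_subset by (simp add: summand_counts_def)
  have fin: "finite S" if "S \<in> ?B" for S
    by (rule finite_subset[of _ "{..<n} \<times> {..<n}"]) (use sub[OF that] in auto)
  have lmS: "left_module ?R (?S S)" if "S \<in> ?B" for S
    using sub[OF that] by (intro left_module_interval_sum) auto
  \<comment> \<open>Injectivity rests on the recovery of \<open>S\<close> from ranks in
    \<open>intervals_unique\<close>, surjectivity on \<open>exists_balanced_set\<close>.\<close>
  have "bij_betw (\<lambda>S. r `` {rep S}) ?B (\<M> // r)"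
    unfolding bij_betw_def
  proof
    show "inj_on (\<lambda>S. r `` {rep S}) ?B"
    proof (rule inj_onI)
      fix S T assume ST: "S \<in> ?B" "T \<in> ?B" "r `` {rep S} = r `` {rep T}"
      then have "(rep S, rep T) \<in> r" using eq_equiv_class[OF ST(3) equiv rep(1)] by blast
      then have "isomorphic ?R (rep S) (rep T)" by (simp add: r_def)
      then have "isomorphic ?R (?S S) (rep T)"
        by (rule isomorphic_trans[OF lmS[OF ST(1)] lm[OF rep(1)[OF ST(1)]] rep(2)[OF ST(1)]])
      moreover have "isomorphic ?R (rep T) (?S T)"
        by (rule isomorphic_sym[OF lmS[OF ST(2)] lm[OF rep(1)[OF ST(2)]] rep(2)[OF ST(2)]])
      ultimately have "isomorphic ?R (?S S) (?S T)"
        by (rule isomorphic_trans[OF lmS[OF ST(1)] lm[OF rep(1)[OF ST(2)]]])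
      then show "S = T" by (rule intervals_unique[OF fin[OF ST(1)] sub[OF ST(1)] fin[OF ST(2)] sub[OF ST(2)]])
    qed
    show "(\<lambda>S. r `` {rep S}) ` ?B = \<M> // r"
    proof
      show "(\<lambda>S. r `` {rep S}) ` ?B \<subseteq> \<M> // r" using rep(1) by (auto intro: quotientI)
      show "\<M> // r \<subseteq> (\<lambda>S. r `` {rep S}) ` ?B"
      proof
        fix c assume "c \<in> \<M> // r"
        then obtain M where M: "M \<in> \<M>" "c = r `` {M}" by (rule quotientE)
        obtain S where S: "S \<in> ?B" "isomorphic ?R (?S S) M"
          using exists_balanced_set[OF assms, of M t] M(1) unfolding \<M>_def by blast
        have "isomorphic ?R (rep S) (?S S)"
          by (rule isomorphic_sym[OF lmS[OF S(1)] lm[OF rep(1)[OF S(1)]] rep(2)[OF S(1)]])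
        then have "isomorphic ?R (rep S) M"
          using S(2) by (rule isomorphic_trans[OF lm[OF rep(1)[OF S(1)]] lmS[OF S(1)]])
        then have "(rep S, M) \<in> r" using rep(1)[OF S(1)] M(1) by (simp add: r_def)
        then have "r `` {rep S} = c" using equiv_class_eq[OF equiv] M(2) by blast
        then show "c \<in> (\<lambda>S. r `` {rep S}) ` ?B" using S(1) by blast
      qed
    qed
  qed
  moreover have "finite ?B"
    by (rule finite_subset[OF _ finite_balanced_set[of n]]) (auto simp: summand_counts_def)
  ultimately have "finite (\<M> // r)" "card (\<M> // r) = card ?B"
    using bij_betw_finite bij_betw_same_card by metis+
  moreover have "isomorphism_classes ?R \<M> = \<M> // r" by (simp add: isomorphism_classes_def r_def)
  moreover have "Poly_Mapping.lookup (h_poly n) (\<Sum>i=1..n. Poly_Mapping.single i (t i)) = int (card ?B)"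
    using lookup_h_poly[OF assms] by (simp add: summand_counts_def)
  ultimately show ?thesis unfolding Let_def \<M>_def[symmetric] by simp
qed

end
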